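(* Fix $\lambda>0$ and $z>0$. For every $h\in\mathcal{D}(A^{\lambda,z})$, the process $$M^{\lambda,z}_t=h(\mathbb{I}_{\{t<\sigma_z^\lambda\}},\xi^{\lambda,z}_t)-h(1,0)-\int_0^t\Big(-\lambda\frac{\partial h}{\partial y_2}(1,\xi^{\lambda,z}_s)+\frac12\frac{\partial^2h}{\partial y_2^2}(1,\xi^{\lambda,z}_s)\Big)\mathbb{I}_{\{z<\xi^{\lambda,z}_s\}}\,\mathrm{d}s-\int_0^t\Big(\lambda\frac{\partial h}{\partial y_2}(1,\xi^{\lambda,z}_s)+\frac12\frac{\partial^2h}{\partial y_2^2}(1,\xi^{\lambda,z}_s)\Big)\mathbb{I}_{\{\xi^{\lambda,z}_s<z\}}\,\mathrm{d}s,\quad t\ge0,$$ is a martingale with respect to $\mathbb{F}^{\xi^{\lambda,z}}$.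
   Context: Let $B=(B_t)_{t\ge 0}$ be a standard Brownian motion started at $0$ on a complete probability space. For $\lambda>0$, $z>0$, put $B^\lambda_t=B_t+\lambda t$, $\sigma_z^\lambda=\sup\{t>0: B^\lambda_t=z\}$ (almost surely finite), and $\xi^{\lambda,z}_t=B^\lambda_{t\wedge\sigma_z^\lambda}$, $t\ge 0$, with natural filtration $\mathbb{F}^{\xi^{\lambda,z}}$ (understood up to $\mathbb{P}$-null sets). Let $\mathcal{S}=\{0,1\}\times\mathbb{R}$ (points $(y_1,y_2)$) and $C_0(\mathcal{S})$ the continuous functions on $\mathcal{S}$ vanishing at infinity. The process $\zeta^{\lambda,z}_t=(\mathbb{I}_{\{t<\sigma_z^\lambda\}},\xi^{\lambda,z}_t)$ is a Feller process on $\mathcal{S}$ with semigroup $Q_0$ the identity and, for $t>0$, $$Q_th(y_1,y_2)=(1-y_1)h(y_1,y_2)+y_1h(0,z)\Big[\Phi\Big(\lambda\sqrt t-\tfrac{|z-y_2|}{\sqrt t}\Big)-e^{2\lambda|z-y_2|}\Phi\Big(-\lambda\sqrt t-\tfrac{|z-y_2|}{\sqrt t}\Big)\Big]+y_1e^{\lambda\alpha(z,y_2)}\int_{\mathbb{R}}h(1,\eta)e^{-\lambda\alpha(z,\eta)}p(t,\eta-y_2,\lambda t)\,\mathrm{d}\eta,$$ where $\Phi$ is the standard normal distribution function, $\alpha(z,x)=|z-x|-(z-x)$, and $p(t,x,y)=\frac{1}{\sqrt{2\pi t}}\exp\big(-\frac{(x-y)^2}{2t}\big)$. $A^{\lambda,z}$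 is the infinitesimal generator of $\zeta^{\lambda,z}$: its domain $\mathcal{D}(A^{\lambda,z})$ is the set of $h\in C_0(\mathcal{S})$ for which the limit $A^{\lambda,z}h=\lim_{t\to0}\frac{Q_th-h}{t}$ exists in $C_0(\mathcal{S})$. *)

theory Defs
  imports "HOL-Probability.Probability"
begin

section \<open>Brownian motion, filtrations and martingales\<close>

text \<open>Only the values \<open>B t\<close> with \<open>0 \<le> t\<close> matter; path continuity and \<open>B 0 = 0\<close> hold almost surely.\<close>

locale standard_brownian_motion = prob_space M for M :: "'a measure" +
  fixes B :: "real \<Rightarrow> 'a \<Rightarrow> real"
  assumes measurable_B: "\<And>t. 0 \<le> t \<Longrightarrow> B t \<in> borel_measurable M"
    and start_zero: "AE \<omega> in M. B 0 \<omega> = 0"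
    and continuous_paths: "AE \<omega> in M. continuous_on {0..} (\<lambda>t. B t \<omega>)"
    and normal_increments: "\<And>s t. 0 \<le> s \<Longrightarrow> s < t \<Longrightarrow>
      distributed M lborel (\<lambda>\<omega>. B t \<omega> - B s \<omega>) (\<lambda>x. ennreal (normal_density 0 (sqrt (t - s)) x))"
    and indep_increments: "\<And>(n::nat) (u::nat \<Rightarrow> real). 0 \<le> u 0 \<Longrightarrow> (\<And>i. i < n \<Longrightarrow> u i < u (Suc i)) \<Longrightarrow>
      indep_vars (\<lambda>_. borel) (\<lambda>i \<omega>. B (u (Suc i)) \<omega> - B (u i) \<omega>) {..<n}"

definition completed_natural_filtration ::
    "'a measure \<Rightarrow> (real \<Rightarrow> 'a \<Rightarrow> real) \<Rightarrow> real \<Rightarrow> 'a measure" where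
  "completed_natural_filtration M X t =
     sigma (space M)
       ({X s -` A \<inter> space M | s A. 0 \<le> s \<and> s \<le> t \<and> A \<in> sets borel} \<union> null_sets M)"

definition martingale ::
    "'a measure \<Rightarrow> (real \<Rightarrow> 'a measure) \<Rightarrow> (real \<Rightarrow> 'a \<Rightarrow> real) \<Rightarrow> bool" where
  "martingale M F X \<longleftrightarrow>
     filtration (space M) F \<and>
     (\<forall>t\<ge>0. subalgebra M (F t)) \<and>
     (\<forall>t\<ge>0. X t \<in> borel_measurable (F t)) \<and>
     (\<forall>t\<ge>0. integrable M (X t)) \<and>
     (\<forall>s t. 0 \<le> s \<longrightarrow> s \<le> t \<longrightarrow> (AE \<omega> in M. real_cond_exp M (F s) (X t) \<omega> = X s \<omega>))"

section \<open>Drifted Brownian motion stopped at its last passage time\<close>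

definition drifted :: "(real \<Rightarrow> 'a \<Rightarrow> real) \<Rightarrow> real \<Rightarrow> real \<Rightarrow> 'a \<Rightarrow> real" where
  "drifted B lam t \<omega> = B t \<omega> + lam * t"

text \<open>For Brownian \<open>B\<close> and \<open>lam, z > 0\<close> the set below is almost surely nonempty and bounded; on the
  exceptional null set the value of the real supremum is irrelevant.\<close>

definition last_passage :: "(real \<Rightarrow> 'a \<Rightarrow> real) \<Rightarrow> real \<Rightarrow> real \<Rightarrow> 'a \<Rightarrow> real" where
  "last_passage B lam z \<omega> = Sup {t. 0 < t \<and> drifted B lam t \<omega> = z}"

definition stopped :: "(real \<Rightarrow> 'a \<Rightarrow> real) \<Rightarrow> real \<Rightarrow> real \<Rightarrow> real \<Rightarrow> 'a \<Rightarrow> real" where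
  "stopped B lam z t \<omega> = drifted B lam (min t (last_passage B lam z \<omega>)) \<omega>"

section \<open>The semigroup and the domain of its generator\<close>

text \<open>Functions on the state space \<open>S\<close> are represented by functions on the plane of which only the
  restriction to \<open>S\<close> is used.\<close>

definition state_space :: "(real \<times> real) set" where
  "state_space = {0, 1} \<times> UNIV"

definition C0 :: "'b::topological_space set \<Rightarrow> ('b \<Rightarrow> real) set" where
  "C0 S = {h. continuous_on S h \<and>
     (\<forall>\<epsilon>>0. \<exists>K. compact K \<and> K \<subseteq> S \<and> (\<forall>x\<in>S - K. \<bar>h x\<bar> < \<epsilon>))}"

definition \<alpha>_fun :: "real \<Rightarrow> real \<Rightarrow> real" where
  "\<alpha>_fun z x = \<bar>z - x\<bar> - (z - x)"

definition std_normal_cdf :: "real \<Rightarrow> real" where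
  "std_normal_cdf = cdf std_normal_distribution"

definition gauss_kernel :: "real \<Rightarrow> real \<Rightarrow> real \<Rightarrow> real" where
  "gauss_kernel t x y = 1 / sqrt (2 * pi * t) * exp (- ((x - y)\<^sup>2 / (2 * t)))"

definition semigroup_Q :: "real \<Rightarrow> real \<Rightarrow> real \<Rightarrow> (real \<times> real \<Rightarrow> real) \<Rightarrow> real \<times> real \<Rightarrow> real" where
  "semigroup_Q lam z t h = (\<lambda>(y1, y2).
     if t = 0 then h (y1, y2)
     else (1 - y1) * h (y1, y2)
        + y1 * h (0, z) *
            (std_normal_cdf (lam * sqrt t - \<bar>z - y2\<bar> / sqrt t)
             - exp (2 * lam * \<bar>z - y2\<bar>) * std_normal_cdf (- lam * sqrt t - \<bar>z - y2\<bar> / sqrt t))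
        + y1 * exp (lam * \<alpha>_fun z y2) *
            (LINT \<eta>|lborel. h (1, \<eta>) * exp (- lam * \<alpha>_fun z \<eta>) * gauss_kernel t (\<eta> - y2) (lam * t)))"

text \<open>The limit in \<open>C0 S\<close> is with respect to the supremum norm, i.e. uniform on \<open>S\<close>.\<close>

definition generator_domain ::
    "'b::topological_space set \<Rightarrow> (real \<Rightarrow> ('b \<Rightarrow> real) \<Rightarrow> 'b \<Rightarrow> real) \<Rightarrow> ('b \<Rightarrow> real) set" where
  "generator_domain S P = {h \<in> C0 S. \<exists>g \<in> C0 S.
     uniform_limit S (\<lambda>t x. (P t h x - h x) / t) g (at_right 0)}"

section \<open>Partial derivative in the second variable\<close>

text \<open>For \<open>h\<close> in the generator domain the derivatives of \<open>h (1, _)\<close> may fail to exist at \<open>z\<close>, where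
  \<open>D2\<close> takes an unspecified value.\<close>

definition D2 :: "(real \<times> real \<Rightarrow> real) \<Rightarrow> real \<times> real \<Rightarrow> real" where
  "D2 h = (\<lambda>(y1, y2). deriv (\<lambda>v. h (y1, v)) y2)"

end

theory Submission
  imports Defs "HOL-Real_Asymp.Real_Asymp"
begin

text \<open>Write \<open>X\<^sub>t = B\<^sub>t + lam t\<close> and let \<open>\<phi>(x) = exp (- lam \<alpha>(z, x))\<close>, the probability that \<open>X\<close> started at \<open>x\<close>
  ever hits \<open>z\<close>. Given the past of \<open>B\<close> up to time \<open>s\<close>, the event \<open>s < \<sigma>\<close> has probability \<open>\<phi>(X\<^sub>s)\<close>; this is
  optional stopping for the martingale \<open>exp (- 2 lam X)\<close>, done on finite grids with an overshoot estimate.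
  Hence, with \<open>P\<close> the transition semigroup of \<open>X\<close> and \<open>u = (h(1, \<cdot>) - h(0, z)) \<phi>\<close>, the semigroup satisfies
  \<open>Q\<^sub>t h(1, \<cdot>) = h(0, z) + (P\<^sub>t u) / \<phi>\<close> and describes the conditional law of the stopped process.
  The uniform limit \<open>g\<close> of \<open>(Q\<^sub>t h - h) / t\<close> then yields the Dynkin martingale with integrand \<open>g\<close>
  by differentiating \<open>E[h(\<zeta>\<^sub>r); A]\<close> in \<open>r\<close>, without the semigroup law or the Feller property.
  Off \<open>z\<close>, \<open>(P\<^sub>t u - u) / t\<close> converges to \<open>\<phi> g\<close>, and a maximum principle, which only needs Gaussian moments up
  to order four, identifies \<open>u\<close> with a classical solution of \<open>u'' / 2 + lam u' = \<phi> g\<close>, so that \<open>g\<close> is the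
  differential expression in the theorem. Finally \<open>X\<^sub>r \<noteq> z\<close> almost surely for each \<open>r > 0\<close>, so the point \<open>z\<close>
  is irrelevant for the integrals.\<close>

section \<open>Gaussian kernels and the semigroup\<close>

text \<open>The time \<open>\<sigma>\<close> looks into the future, so it is not a stopping time of
  the filtration of \<open>B\<close>, while the Markov property of \<open>X\<close> is available
  only there. Two filtrations are therefore kept apart. Events of \<open>F s\<close> are traded for
  events of \<open>past s\<close> on \<open>s < \<sigma>\<close>, where the two processes agree, and
  \<open>\<sigma>\<close> re-enters through its conditional probability \<open>\<phi>\<close>. The
  stopped process is thus a Doob transform of \<open>X\<close> by the excessive function
  \<open>\<phi>\<close>; as \<open>\<phi>' / \<phi> = - 2 lam\<close> above \<open>z\<close>, the
  transform turns the drift \<open>lam\<close> into \<open>- lam\<close> there, which is the sign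
  change in the theorem. Subtracting \<open>h(0, z)\<close> makes everything vanish from
  \<open>\<sigma>\<close> on, so each expectation lives on the event of survival. The generator
  limit offers no derivative of \<open>h\<close>; a continuous function with prescribed generator is
  instead compared with an explicit solution of a linear equation with constant coefficients,
  separately on each side of \<open>z\<close>, where \<open>\<phi>\<close> is smooth.\<close>

definition hit_prob :: "real \<Rightarrow> real \<Rightarrow> real \<Rightarrow> real" where
  "hit_prob lam z x = exp (- lam * \<alpha>_fun z x)"

definition bm_transition :: "real \<Rightarrow> real \<Rightarrow> (real \<Rightarrow> real) \<Rightarrow> real \<Rightarrow> real" where
  "bm_transition lam t f x = (LINT \<eta>|lborel. f \<eta> * normal_density (x + lam * t) (sqrt t) \<eta>)"

lemma gauss_kernel_eq_normal_density:
  assumes "0 < t"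
  shows "gauss_kernel t (\<eta> - x) m = normal_density (x + m) (sqrt t) \<eta>"
  using assms by (simp add: gauss_kernel_def normal_density_def diff_diff_eq)

lemma hit_prob_pos: "0 < hit_prob lam z x"
  by (simp add: hit_prob_def)

lemma hit_prob_le_1: "0 < lam \<Longrightarrow> hit_prob lam z x \<le> 1"
  by (simp add: hit_prob_def \<alpha>_fun_def mult_nonneg_nonneg)

lemma hit_prob_below: "x \<le> z \<Longrightarrow> hit_prob lam z x = 1"
  by (simp add: hit_prob_def \<alpha>_fun_def)

lemma hit_prob_above: "z \<le> x \<Longrightarrow> hit_prob lam z x = exp (- 2 * lam * (x - z))"
  by (simp add: hit_prob_def \<alpha>_fun_def algebra_simps)

lemma continuous_on_hit_prob: "continuous_on S (hit_prob lam z)"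
  unfolding hit_prob_def \<alpha>_fun_def by (intro continuous_intros)

lemma borel_measurable_hit_prob [measurable]: "hit_prob lam z \<in> borel_measurable borel"
  by (intro borel_measurable_continuous_onI continuous_on_hit_prob)

section \<open>Gaussian moments and one-sided bounds for the generator\<close>

lemma integrable_bounded_normal:
  fixes f :: "real \<Rightarrow> real"
  assumes "0 < s" "f \<in> borel_measurable borel" "\<And>x. \<bar>f x\<bar> \<le> C"
  shows "integrable lborel (\<lambda>x. f x * normal_density m s x)"
proof (rule Bochner_Integration.integrable_bound)
  show "integrable lborel (\<lambda>x. C * normal_density m s x)"
    using assms(1) by simp
  show "AE x in lborel. norm (f x * normal_density m s x) \<le> norm (C * normal_density m s x)"
    using assms(3) order_trans[OF abs_ge_zero assms(3)]
    by (auto simp: abs_mult intro!: mult_right_mono)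
qed (use assms in simp)

lemma has_integral_normal_quartic:
  assumes "0 < s"
  shows "has_bochner_integral lborel
    (\<lambda>x. (b0 + b1 * (x - m) + b2 * (x - m)^2 + b3 * (x - m)^3 + b4 * (x - m)^4) * normal_density m s x)
    (b0 + b2 * s^2 + 3 * b4 * s^4)"
proof -
  note e = normal_moment_even[OF assms, of m] and o = normal_moment_odd[OF assms, of m]
  have f: "fact (Suc (Suc (Suc (Suc 0)))) = (24::real)" by (simp add: fact_numeral)
  have 0: "has_bochner_integral lborel (\<lambda>x. normal_density m s x * (x - m)^0) 1"
    using e[of 0] by simp
  have 1: "has_bochner_integral lborel (\<lambda>x. normal_density m s x * (x - m)) 0"
    using o[of 0] by simp
  have 2: "has_bochner_integral lborel (\<lambda>x. normal_density m s x * (x - m)^2) (s^2)"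
    using e[of 1] by (simp add: numeral_2_eq_2)
  have 3: "has_bochner_integral lborel (\<lambda>x. normal_density m s x * (x - m)^3) 0"
    using o[of 1] by (simp add: numeral_3_eq_3)
  have "fact (2 * 2) / ((2 / s\<^sup>2)^2 * fact 2) = 3 * s^4"
    using assms by (simp add: fact_numeral field_simps power2_eq_square power4_eq_xxxx)
  with e[of 2] have 4: "has_bochner_integral lborel (\<lambda>x. normal_density m s x * (x - m)^4) (3 * s^4)"
    by simp
  have "has_bochner_integral lborel
    (\<lambda>x. b0 * (normal_density m s x * (x - m)^0) + b1 * (normal_density m s x * (x - m))
       + b2 * (normal_density m s x * (x - m)^2) + b3 * (normal_density m s x * (x - m)^3)
       + b4 * (normal_density m s x * (x - m)^4))
    (b0 * 1 + b1 * 0 + b2 * s^2 + b3 * 0 + b4 * (3 * s^4))"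
    by (intro has_bochner_integral_add has_bochner_integral_mult_right impI 0 1 2 3 4)
  then show ?thesis
    by (simp add: algebra_simps)
qed

text \<open>A polynomial majorant of \<open>u\<close> is integrated exactly against the Gaussian of
  mean \<open>x + lam * t\<close> and variance \<open>t\<close>. The quartic term contributes only
  order \<open>t^2\<close>, so it costs nothing in a generator limit.\<close>

lemma bm_transition_le_quartic:
  assumes t: "0 < t" and u: "u \<in> borel_measurable borel" "\<And>y. \<bar>u y\<bar> \<le> K"
    and le: "\<And>y. u y \<le> u x + c * (y - x) + d * (y - x)^2 + C * (y - x)^4"
  shows "bm_transition lam t u x - u x
    \<le> c * (lam * t) + d * (t + (lam * t)^2) + C * (3 * t^2 + 6 * (lam * t)^2 * t + (lam * t)^4)"
proof -
  define a where "a = lam * t"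
  let ?n = "normal_density (x + a) (sqrt t)"
  have st: "0 < sqrt t" using t by simp
  have t4: "sqrt t ^ 4 = t^2" using t
    by (metis less_eq_real_def mult_2 numeral_Bit0 power_even_eq power2_eq_square real_sqrt_pow2)
  have quart: "has_bochner_integral lborel
     (\<lambda>y. (u x + c * (y - x) + d * (y - x)^2 + C * (y - x)^4) * ?n y)
     (u x + c * a + d * (t + a^2) + C * (3 * t^2 + 6 * a^2 * t + a^4))"
    (is "has_bochner_integral _ ?f ?I")
  proof -
    \<comment> \<open>Expanded about the mean \<open>x + a\<close> instead of \<open>x\<close>, so
      that the odd powers integrate to zero and the even ones to \<open>t\<close> and
      \<open>3 * t^2\<close>.\<close>
    have eq: "?f = (\<lambda>y. ((u x + c * a + d * a^2 + C * a^4) + (c + 2 * d * a + 4 * C * a^3) * (y - (x + a))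
        + (d + 6 * C * a^2) * (y - (x + a))^2 + (4 * C * a) * (y - (x + a))^3 + C * (y - (x + a))^4) * ?n y)"
      by (rule ext, rule arg_cong[where f="\<lambda>v. v * _"]) algebra
    have "has_bochner_integral lborel ?f
       ((u x + c * a + d * a^2 + C * a^4) + (d + 6 * C * a^2) * (sqrt t)^2 + 3 * C * sqrt t ^ 4)"
      unfolding eq by (rule has_integral_normal_quartic[OF st])
    also have "(u x + c * a + d * a^2 + C * a^4) + (d + 6 * C * a^2) * (sqrt t)^2 + 3 * C * sqrt t ^ 4 = ?I"
      using t by (simp add: t4 algebra_simps)
    finally show ?thesis .
  qed
  have "bm_transition lam t u x \<le> (LINT y|lborel. ?f y)"
    unfolding bm_transition_def a_def[symmetric]
    by (intro integral_mono integrable_bounded_normal[OF st u] integrable.intros[OF quart]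
        mult_right_mono le) auto
  also have "\<dots> = ?I" by (rule has_bochner_integral_integral_eq[OF quart])
  finally show ?thesis unfolding a_def by simp
qed

text \<open>A parabola touching \<open>u\<close> from above at \<open>x\<close> controls the
  generator there; \<open>d\<close> stands for half a second derivative. The touching is only local:
  a large multiple of \<open>(y - x)^4\<close> extends it to all \<open>y\<close> and disappears
  after division by \<open>t\<close> as \<open>t\<close> tends to 0.\<close>

lemma bm_generator_le:
  assumes u: "u \<in> borel_measurable borel" "\<And>y. \<bar>u y\<bar> \<le> K"
    and "0 < r" and le: "\<And>y. \<bar>y - x\<bar> < r \<Longrightarrow> u y \<le> u x + c * (y - x) + d * (y - x)^2"
    and lim: "((\<lambda>t. (bm_transition lam t u x - u x) / t) \<longlongrightarrow> G) (at_right 0)"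
  shows "G \<le> lam * c + d"
proof -
  \<comment> \<open>In the units \<open>w = \<bar>y - x\<bar> / r\<close>, at least 1 outside the
    local range, \<open>w^4\<close> dominates \<open>1\<close>, \<open>w\<close> and
    \<open>w^2\<close>; the numerator adds up the oscillation \<open>2 * K\<close> of
    \<open>u\<close> and the two lower order terms at \<open>w = 1\<close>.\<close>
  define C where "C = (2 * K + \<bar>c\<bar> * r + \<bar>d\<bar> * r^2) / r^4"
  have K: "0 \<le> K" using u(2)[of 0] by linarith
  have C0: "0 \<le> C" using K \<open>0 < r\<close> by (simp add: C_def)
  have glob: "u y \<le> u x + c * (y - x) + d * (y - x)^2 + C * (y - x)^4" for y
  proof (cases "\<bar>y - x\<bar> < r")
    case True
    have "0 \<le> C * (y - x)^4" using C0 by simp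
    with le[OF True] show ?thesis by linarith
  next
    case False
    define w where "w = \<bar>y - x\<bar> / r"
    have w1: "1 \<le> w" using False \<open>0 < r\<close> by (simp add: w_def)
    have w: "\<bar>y - x\<bar> = r * w" using \<open>0 < r\<close> by (simp add: w_def)
    have w4: "w \<le> w^4" "w^2 \<le> w^4" "1 \<le> w^4" 
      using w1 power_increasing[of 1 4 w] power_increasing[of 2 4 w] one_le_power[of w 4] by simp_all
    have "(y - x)^4 = (r * w)^4" using w by (metis power_even_abs_numeral even_numeral)
    then have "C * (y - x)^4 = (2 * K + \<bar>c\<bar> * r + \<bar>d\<bar> * r^2) * w^4"
      using \<open>0 < r\<close> by (simp add: C_def power_mult_distrib)
    also have "\<dots> \<ge> 2 * K * 1 + (\<bar>c\<bar> * r) * w + (\<bar>d\<bar> * r^2) * w^2"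
      unfolding distrib_right using K \<open>0 < r\<close> w4 by (intro add_mono mult_left_mono) auto
    finally have "C * (y - x)^4 \<ge> 2 * K + \<bar>c\<bar> * \<bar>y - x\<bar> + \<bar>d\<bar> * (y - x)^2"
      using w by (simp add: power_mult_distrib mult.assoc) (metis power2_abs power_mult_distrib)
    moreover have "c * (y - x) \<ge> - (\<bar>c\<bar> * \<bar>y - x\<bar>)"
      by (metis abs_ge_minus_self abs_mult minus_le_iff)
    moreover have "d * (y - x)^2 \<ge> - (\<bar>d\<bar> * (y - x)^2)"
      by (metis abs_ge_minus_self mult_minus_left minus_le_iff mult_right_mono zero_le_power2)
    moreover have "u y \<le> u x + 2 * K" using u(2)[of x] u(2)[of y] by linarith
    ultimately show ?thesis by linarith
  qed
  have "((\<lambda>t::real. c * lam + d * (1 + lam^2 * t) + C * (3 * t + 6 * lam^2 * t^2 + lam^4 * t^3))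
      \<longlongrightarrow> c * lam + d * (1 + lam^2 * 0) + C * (3 * 0 + 6 * lam^2 * 0^2 + lam^4 * 0^3)) (at_right 0)"
    by (intro tendsto_intros)
  moreover have "\<forall>\<^sub>F t in at_right 0. (bm_transition lam t u x - u x) / t
      \<le> c * lam + d * (1 + lam^2 * t) + C * (3 * t + 6 * lam^2 * t^2 + lam^4 * t^3)"
    using eventually_at_right_less[of 0]
  proof eventually_elim
    case (elim t)
    have "(c * (lam * t) + d * (t + (lam * t)^2) + C * (3 * t^2 + 6 * (lam * t)^2 * t + (lam * t)^4))
      = (c * lam + d * (1 + lam^2 * t) + C * (3 * t + 6 * lam^2 * t^2 + lam^4 * t^3)) * t"
      by algebra
    with bm_transition_le_quartic[OF elim u glob, of lam] show ?case
      by (simp only: pos_divide_le_eq[OF elim])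
  qed
  ultimately have "G \<le> c * lam + d * (1 + lam^2 * 0) + C * (3 * 0 + 6 * lam^2 * 0^2 + lam^4 * 0^3)"
    using lim by (intro tendsto_le[OF _ _ lim]) auto
  then show ?thesis by (simp add: mult.commute)
qed

section \<open>The normal distribution function and the transition of the hitting
  probability\<close>

lemma std_normal_cdf_eq: "std_normal_cdf x = (LINT y|lborel. indicator {..x} y * std_normal_density y)"
proof -
  have "prob_space std_normal_distribution"
    using prob_space_normal_density[of 1 0] by simp
  then interpret prob_space std_normal_distribution .
  have "std_normal_cdf x = (LINT y|std_normal_distribution. indicator {..x} y)"
    unfolding std_normal_cdf_def cdf_def by simp
  also have "\<dots> = (LINT y|lborel. indicator {..x} y * std_normal_density y)"
    by (subst integral_density) (auto simp: mult.commute)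
  finally show ?thesis .
qed

lemma integral_normal_atMost:
  assumes "0 < s"
  shows "(LINT y|lborel. indicator {..x} y * normal_density m s y) = std_normal_cdf ((x - m) / s)"
proof -
  have "(LINT y|lborel. indicator {..x} y * normal_density m s y)
     = \<bar>s\<bar> * (LINT y|lborel. indicator {..x} (m + s * y) * normal_density m s (m + s * y))"
    using lborel_integral_real_affine[of s "\<lambda>y. indicator {..x} y * normal_density m s y" m] assms by simp
  also have "\<dots> = (LINT y|lborel. s * (indicator {..x} (m + s * y) * normal_density m s (m + s * y)))"
    using assms by simp
  also have "\<dots> = (LINT y|lborel. indicator {..(x - m) / s} y * std_normal_density y)"
  proof (rule Bochner_Integration.integral_cong[OF refl])
    fix y
    have "s * normal_density m s (m + s * y) = std_normal_density y"
      using assms by (simp add: normal_density_def real_sqrt_mult power_mult_distrib field_simps)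
    moreover have "indicator {..x} (m + s * y) = (indicator {..(x - m) / s} y :: real)"
      using assms by (auto simp: indicator_def field_simps)
    ultimately show "s * (indicator {..x} (m + s * y) * normal_density m s (m + s * y))
        = indicator {..(x - m) / s} y * std_normal_density y"
      by (simp add: mult.left_commute)
  qed
  also have "\<dots> = std_normal_cdf ((x - m) / s)" by (simp add: std_normal_cdf_eq)
  finally show ?thesis .
qed

lemma std_normal_cdf_uminus: "std_normal_cdf (- x) = 1 - std_normal_cdf x"
proof -
  have int: "integrable lborel (\<lambda>y. indicator {..x} y * std_normal_density y)" for x
    using integrable_bounded_normal[of 1 "indicator {..x}" 1 0] by (simp add: indicator_def)
  have "std_normal_cdf (- x) = (LINT y|lborel. indicator {..- x} (0 + (-1) * y) * std_normal_density (0 + (-1) * y))"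
    unfolding std_normal_cdf_eq
    by (subst lborel_integral_real_affine[of "-1" _ 0]) simp_all
  also have "\<dots> = (LINT y|lborel. std_normal_density y - indicator {..x} y * std_normal_density y)"
  proof (rule integral_cong_AE)
    have "AE y in lborel. y \<noteq> x" by (rule AE_lborel_singleton)
    then show "AE y in lborel. indicator {..- x} (0 + (-1) * y) * std_normal_density (0 + (-1) * y)
       = std_normal_density y - indicator {..x} y * std_normal_density y"
      by eventually_elim (auto simp: indicator_def normal_density_def)
  qed auto
  also have "\<dots> = 1 - std_normal_cdf x"
    using int by (simp add: std_normal_cdf_eq)
  finally show ?thesis .
qed

text \<open>Completing the square: exponential tilting keeps the variance and moves the mean by
  \<open>- a * s^2\<close>.\<close>

lemma exp_times_normal_density:
  assumes "0 < s"
  shows "exp (- (a * y)) * normal_density m s y = exp (a^2 * s^2 / 2 - a * m) * normal_density (m - a * s^2) s y"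
proof -
  have "- (a * y) - (y - m)^2 / (2 * s^2) = a^2 * s^2 / 2 - a * m - (y - (m - a * s^2))^2 / (2 * s^2)"
    using assms by (simp add: field_simps power2_eq_square)
  then have "exp (- (a * y)) * exp (- (y - m)\<^sup>2 / (2 * s^2))
      = exp (a^2 * s^2 / 2 - a * m) * exp (- (y - (m - a * s^2))\<^sup>2 / (2 * s^2))"
    by (simp add: exp_add[symmetric])
  then show ?thesis
    unfolding normal_density_def by (metis mult.left_commute)
qed

text \<open>The bracket in the semigroup is thereby \<open>1 - P\<^sub>t \<phi> / \<phi>\<close>,
  the probability that a path at \<open>x\<close> with a visit to \<open>z\<close> ahead makes its
  last one within time \<open>t\<close>.\<close>

lemma bm_transition_hit_prob:
  assumes "0 < lam" "0 < t"
  shows "bm_transition lam t (hit_prob lam z) x = hit_prob lam z x *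
    (1 - (std_normal_cdf (lam * sqrt t - \<bar>z - x\<bar> / sqrt t)
        - exp (2 * lam * \<bar>z - x\<bar>) * std_normal_cdf (- lam * sqrt t - \<bar>z - x\<bar> / sqrt t)))"
proof -
  let ?n = "normal_density (x + lam * t) (sqrt t)" and ?k = "normal_density (x - lam * t) (sqrt t)"
  have st: "0 < sqrt t" using assms by simp
  have int: "integrable lborel (\<lambda>y. indicator {..z} y * normal_density m (sqrt t) y)" for m
    by (rule integrable_bounded_normal[OF st, of _ 1]) (auto simp: indicator_def)
  \<comment> \<open>Above \<open>z\<close>, \<open>\<phi>\<close> is an exponential, and tilting by
    \<open>2 * lam\<close> reverses the drift: the mean \<open>x + lam * t\<close> becomes
    \<open>x - lam * t\<close>, the mean of \<open>?k\<close>.\<close>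
  have pt: "hit_prob lam z y * ?n y = indicator {..z} y * ?n y
      + exp (2 * lam * (z - x)) * (?k y - indicator {..z} y * ?k y)" for y
  proof (cases "y \<le> z")
    case True then show ?thesis by (simp add: hit_prob_below)
  next
    case False
    have "exp (- (2 * lam * y)) * ?n y = exp (- (2 * lam * x)) * ?k y"
    proof -
      have "exp ((2 * lam)^2 * (sqrt t)^2 / 2 - 2 * lam * (x + lam * t)) = exp (- (2 * lam * x))"
        using assms by (intro arg_cong[where f=exp]) (simp add: power2_eq_square algebra_simps)
      moreover have "x + lam * t - 2 * lam * (sqrt t)^2 = x - lam * t" using assms by simp
      ultimately show ?thesis using exp_times_normal_density[OF st, of "2 * lam" y "x + lam * t"]
        by (simp only:)
    qed
    then have "(exp (2 * lam * z) * exp (- (2 * lam * y))) * ?n y = (exp (2 * lam * z) * exp (- (2 * lam * x))) * ?k y"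
      by (simp only: mult.assoc)
    moreover have "exp (2 * lam * z) * exp (- (2 * lam * y)) = exp (- 2 * lam * (y - z))"
        "exp (2 * lam * z) * exp (- (2 * lam * x)) = exp (2 * lam * (z - x))"
      by (simp_all add: exp_add[symmetric] right_diff_distrib)
    ultimately have "exp (- 2 * lam * (y - z)) * ?n y = exp (2 * lam * (z - x)) * ?k y"
      by (simp only:)
    then show ?thesis using False by (simp add: hit_prob_above)
  qed
  have "bm_transition lam t (hit_prob lam z) x = std_normal_cdf ((z - (x + lam * t)) / sqrt t)
      + exp (2 * lam * (z - x)) * (1 - std_normal_cdf ((z - (x - lam * t)) / sqrt t))"
    unfolding bm_transition_def pt using int st
    by (simp add: integral_normal_atMost)
  also have "(z - (x + lam * t)) / sqrt t = (z - x) / sqrt t - lam * sqrt t"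
    using assms by (simp add: field_simps)
  also have "(z - (x - lam * t)) / sqrt t = (z - x) / sqrt t + lam * sqrt t"
    using assms by (simp add: field_simps)
  finally have main: "bm_transition lam t (hit_prob lam z) x = std_normal_cdf ((z - x) / sqrt t - lam * sqrt t)
      + exp (2 * lam * (z - x)) * (1 - std_normal_cdf ((z - x) / sqrt t + lam * sqrt t))" .
  \<comment> \<open>\<open>main\<close> is stated in \<open>z - x\<close>, the goal in
    \<open>\<bar>z - x\<bar>\<close>. Below \<open>z\<close> both distribution functions are
    reflected; above \<open>z\<close> the prefactor \<open>exp (2 * lam * (z - x))\<close> is
    \<open>hit_prob lam z x\<close> itself, and the two terms of \<open>main\<close> match the goal
    in reverse order.\<close>
  show ?thesis
  proof (cases "x \<le> z")
    case True
    have "std_normal_cdf (lam * sqrt t - (z - x) / sqrt t) = 1 - std_normal_cdf ((z - x) / sqrt t - lam * sqrt t)"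
      by (subst std_normal_cdf_uminus[symmetric]) simp
    moreover have "std_normal_cdf (- lam * sqrt t - (z - x) / sqrt t) = 1 - std_normal_cdf ((z - x) / sqrt t + lam * sqrt t)"
      by (subst std_normal_cdf_uminus[symmetric]) (simp add: algebra_simps)
    ultimately show ?thesis using True main by (simp add: hit_prob_below)
  next
    case False
    have 1: "std_normal_cdf ((z - x) / sqrt t + lam * sqrt t) = std_normal_cdf (lam * sqrt t - (x - z) / sqrt t)"
      by (simp add: algebra_simps diff_divide_distrib)
    have 2: "std_normal_cdf ((z - x) / sqrt t - lam * sqrt t) = std_normal_cdf (- lam * sqrt t - (x - z) / sqrt t)"
      by (simp add: algebra_simps diff_divide_distrib)
    have 3: "exp (2 * lam * (z - x)) = hit_prob lam z x"
      using False by (simp add: hit_prob_above algebra_simps)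
    have "hit_prob lam z x * exp (2 * lam * (x - z)) = 1"
      using False by (simp add: hit_prob_above exp_add[symmetric] algebra_simps)
    then have "\<bar>z - x\<bar> = x - z" "hit_prob lam z x * (exp (2 * lam * (x - z)) * c) = c" for c
      using False by (simp_all add: mult.assoc[symmetric])
    then show ?thesis unfolding main 1 2 3 by (simp add: algebra_simps)
  qed
qed

text \<open>As the bracket equals \<open>1 - P\<^sub>t \<phi> / \<phi>\<close>, the contribution of
  the absorbed state splits into the constant \<open>h (0, z)\<close> and a term that merges with
  the integral.\<close>

lemma semigroup_Q_one:
  assumes "0 < lam" "0 < t"
    and h: "(\<lambda>y. h (1, y)) \<in> borel_measurable borel" "\<And>y. \<bar>h (1, y)\<bar> \<le> K"
  shows "semigroup_Q lam z t h (1, x) = h (0, z)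
    + bm_transition lam t (\<lambda>y. (h (1, y) - h (0, z)) * hit_prob lam z y) x / hit_prob lam z x"
proof -
  let ?n = "normal_density (x + lam * t) (sqrt t)"
  let ?\<phi> = "hit_prob lam z"
  have st: "0 < sqrt t" using assms by simp
  have i1: "integrable lborel (\<lambda>y. (h (1, y) * ?\<phi> y) * ?n y)"
  proof (rule integrable_bounded_normal[OF st, of _ K])
    show "\<bar>h (1, y) * ?\<phi> y\<bar> \<le> K" for y
      using mult_mono[OF h(2) hit_prob_le_1[OF \<open>0 < lam\<close>, of z y], of y] hit_prob_pos[of lam z y]
        order_trans[OF abs_ge_zero h(2)]
      by (simp add: abs_mult)
  qed (use h in simp)
  have i2: "integrable lborel (\<lambda>y. (h (0, z) * ?\<phi> y) * ?n y)"
  proof (rule integrable_bounded_normal[OF st, of _ "\<bar>h (0, z)\<bar>"])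
    show "\<bar>h (0, z) * ?\<phi> y\<bar> \<le> \<bar>h (0, z)\<bar>" for y
      using mult_mono[OF order_refl hit_prob_le_1[OF \<open>0 < lam\<close>, of z y], of "\<bar>h (0, z)\<bar>"] hit_prob_pos[of lam z y]
      by (simp add: abs_mult)
  qed simp
  let ?R = "std_normal_cdf (lam * sqrt t - \<bar>z - x\<bar> / sqrt t)
        - exp (2 * lam * \<bar>z - x\<bar>) * std_normal_cdf (- lam * sqrt t - \<bar>z - x\<bar> / sqrt t)"
  have "bm_transition lam t (\<lambda>y. (h (1, y) - h (0, z)) * ?\<phi> y) x
     = (LINT y|lborel. (h (1, y) * ?\<phi> y) * ?n y) - (LINT y|lborel. (h (0, z) * ?\<phi> y) * ?n y)"
    unfolding bm_transition_def
    by (subst Bochner_Integration.integral_diff[OF i1 i2, symmetric]) (simp add: algebra_simps)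
  also have "(LINT y|lborel. (h (0, z) * ?\<phi> y) * ?n y) = h (0, z) * bm_transition lam t ?\<phi> x"
    by (simp add: bm_transition_def mult.assoc)
  finally have P: "bm_transition lam t (\<lambda>y. (h (1, y) - h (0, z)) * ?\<phi> y) x
     = (LINT y|lborel. (h (1, y) * ?\<phi> y) * ?n y) - h (0, z) * (?\<phi> x * (1 - ?R))"
    by (simp add: bm_transition_hit_prob assms)
  have "exp (lam * \<alpha>_fun z x) = 1 / ?\<phi> x"
    by (simp add: hit_prob_def exp_minus field_simps)
  then have "semigroup_Q lam z t h (1, x) = h (0, z) * ?R + (LINT y|lborel. (h (1, y) * ?\<phi> y) * ?n y) / ?\<phi> x"
    using \<open>0 < t\<close> by (simp add: semigroup_Q_def gauss_kernel_eq_normal_density hit_prob_def)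
  with P show ?thesis
    using hit_prob_pos[of lam z x] by (simp add: field_simps)
qed

section \<open>Regularity of functions in the generator domain\<close>

text \<open>Second order expansion with Lagrange remainder; the slack \<open>e\<close> pays for the
  oscillation of \<open>w2\<close> near \<open>x\<close>. It supplies the touching parabola that
  \<open>bm_generator_le\<close> asks for.\<close>

lemma taylor_quadratic_upper:
  fixes w :: "real \<Rightarrow> real"
  assumes x: "a < x" "x < b" and "0 < e"
    and d1: "\<And>y. a < y \<Longrightarrow> y < b \<Longrightarrow> (w has_real_derivative w1 y) (at y)"
    and d2: "\<And>y. a < y \<Longrightarrow> y < b \<Longrightarrow> (w1 has_real_derivative w2 y) (at y)"
    and cont: "isCont w2 x"
  obtains r where "0 < r" "\<And>y. \<bar>y - x\<bar> < r \<Longrightarrow> w y \<le> w x + w1 x * (y - x) + (w2 x / 2 + e) * (y - x)^2"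
proof -
  have "0 < 2 * e" using \<open>0 < e\<close> by simp
  then obtain s where s: "0 < s" "\<And>y. \<bar>y - x\<bar> < s \<Longrightarrow> \<bar>w2 y - w2 x\<bar> < 2 * e"
    using cont unfolding continuous_at_eps_delta dist_real_def by metis
  \<comment> \<open>The half keeps the closed interval \<open>[x - r, x + r]\<close>, on which
    \<open>Taylor\<close> wants derivatives, inside the open one.\<close>
  define r where "r = Min {s, x - a, b - x} / 2"
  have r: "0 < r" "r < s" "a < x - r" "x + r < b"
    using x s by (auto simp: r_def min_def field_simps)
  show ?thesis
  proof (rule that[OF r(1)])
    fix y assume y: "\<bar>y - x\<bar> < r"
    show "w y \<le> w x + w1 x * (y - x) + (w2 x / 2 + e) * (y - x)^2"
    proof (cases "y = x")
      case False
      let ?diff = "\<lambda>m::nat. if m = 0 then w else if m = 1 then w1 else w2"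
      have "\<exists>t. (if y < x then y < t \<and> t < x else x < t \<and> t < y)
         \<and> w y = (\<Sum>m<2. (?diff m x / fact m) * (y - x)^m) + (?diff 2 t / fact 2) * (y - x)^2"
      proof (rule Taylor[of 2 ?diff w "x - r" "x + r" x y])
        show "\<forall>m t. m < 2 \<and> x - r \<le> t \<and> t \<le> x + r \<longrightarrow> (?diff m has_real_derivative ?diff (Suc m) t) (at t)"
          using r d1 d2 by (auto simp: less_2_cases_iff)
      qed (use y r False in auto)
      then obtain t where t': "if y < x then y < t \<and> t < x else x < t \<and> t < y"
         and wy: "w y = w x + w1 x * (y - x) + w2 t / 2 * (y - x)^2"
        by (auto simp: numeral_2_eq_2)
      from t' have t: "\<bar>t - x\<bar> < s"
        using y r by (auto split: if_splits)
      have "w2 t / 2 \<le> w2 x / 2 + e" using s(2)[OF t] by simp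
      then have "w2 t / 2 * (y - x)^2 \<le> (w2 x / 2 + e) * (y - x)^2" by (intro mult_right_mono) auto
      with wy show ?thesis by simp
    qed simp
  qed
qed

text \<open>Maximum principle with a linear perturbation. If \<open>u\<close> exceeds
  \<open>w\<close> somewhere, then \<open>u - w + e * (v - a)\<close> has an interior maximum for a
  small slope \<open>e\<close>. There \<open>w - e * (v - a)\<close>, up to a constant, touches
  \<open>u\<close> from above, and because of the drift \<open>lam > 0\<close> the slope lowers the
  generator by \<open>lam * e\<close>, against the equation for \<open>w\<close>.\<close>

lemma bm_generator_comparison:
  assumes "0 < lam" and u: "u \<in> borel_measurable borel" "\<And>y. \<bar>u y\<bar> \<le> K"
    and cont: "continuous_on {a..b} u" "continuous_on {a..b} w"
    and lim: "\<And>x. a < x \<Longrightarrow> x < b \<Longrightarrow> ((\<lambda>t. (bm_transition lam t u x - u x) / t) \<longlongrightarrow> G x) (at_right 0)"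
    and d1: "\<And>y. a < y \<Longrightarrow> y < b \<Longrightarrow> (w has_real_derivative w1 y) (at y)"
    and d2: "\<And>y. a < y \<Longrightarrow> y < b \<Longrightarrow> (w1 has_real_derivative w2 y) (at y)"
    and c2: "\<And>y. a < y \<Longrightarrow> y < b \<Longrightarrow> isCont w2 y"
    and ode: "\<And>y. a < y \<Longrightarrow> y < b \<Longrightarrow> w2 y / 2 + lam * w1 y = G y"
    and bd: "u a \<le> w a" "u b \<le> w b" and y: "a \<le> y" "y \<le> b"
  shows "u y \<le> w y"
proof (rule ccontr)
  assume "\<not> u y \<le> w y"
  then have gt: "w y < u y" by simp
  then have "a < b" using y bd by (cases "y = a") auto
  \<comment> \<open>Half the slope at which the perturbation at \<open>b\<close> would reach the gap
    at \<open>y\<close>, so both end points stay below the value at \<open>y\<close>.\<close>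
  define e where "e = (u y - w y) / (2 * (b - a))"
  have "0 < g / (2 * c)" "g / (2 * c) * c < g" if "0 < g" "0 < c" for g c :: real using that by simp_all
  from this[of "u y - w y" "b - a"] gt \<open>a < b\<close> have e: "0 < e" "e * (b - a) < u y - w y"
    unfolding e_def by (simp_all only: diff_gt_0_iff_gt)
  define f where "f v = u v - w v + e * (v - a)" for v
  have "continuous_on {a..b} f" unfolding f_def by (intro continuous_intros cont)
  then obtain x where x: "x \<in> {a..b}" and max: "\<And>v. v \<in> {a..b} \<Longrightarrow> f v \<le> f x"
    using continuous_attains_sup[of "{a..b}" f] y by auto
  have "0 \<le> e * (y - a)" using e y by simp
  with bd e gt have "f a < f y" "f b < f y" unfolding f_def diff_self mult_zero_right by linarith+
  with max[of y] x y have x: "a < x" "x < b" by (auto simp: less_le)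
  \<comment> \<open>The Taylor slack is half of the gain \<open>lam * e\<close>, so a strict
    contradiction remains.\<close>
  obtain r where r: "0 < r" "\<And>v. \<bar>v - x\<bar> < r \<Longrightarrow> w v \<le> w x + w1 x * (v - x) + (w2 x / 2 + lam * e / 2) * (v - x)^2"
    using taylor_quadratic_upper[OF x, of "lam * e / 2" w w1 w2] d1 d2 c2[OF x] e \<open>0 < lam\<close>
    by (metis half_gt_zero mult_pos_pos)
  define r' where "r' = Min {r, x - a, b - x}"
  have r': "0 < r'" "r' \<le> r" "a \<le> x - r'" "x + r' \<le> b"
    using x r by (auto simp: r'_def)
  have "u v \<le> u x + (w1 x - e) * (v - x) + (w2 x / 2 + lam * e / 2) * (v - x)^2" if "\<bar>v - x\<bar> < r'" for v
  proof -
    have "f v \<le> f x" using that r' by (intro max) auto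
    moreover have "w v \<le> w x + w1 x * (v - x) + (w2 x / 2 + lam * e / 2) * (v - x)^2"
      using that r' by (intro r(2)) auto
    ultimately show ?thesis by (simp add: f_def algebra_simps)
  qed
  then have "G x \<le> lam * (w1 x - e) + (w2 x / 2 + lam * e / 2)"
    by (rule bm_generator_le[OF u r'(1) _ lim[OF x]])
  with ode[OF x] have "lam * e \<le> lam * e / 2" by (simp add: algebra_simps)
  with \<open>0 < lam\<close> e show False by simp
qed

lemma bm_transition_uminus: "bm_transition lam t (\<lambda>y. - u y) x = - bm_transition lam t u x"
  by (simp add: bm_transition_def)

text \<open>\<open>W\<close> solves the linear equation with the boundary values of
  \<open>u\<close>; comparison from both sides forces \<open>u = W\<close>, so \<open>u\<close>
  inherits two derivatives.\<close>

lemma bm_generator_regular: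
  assumes "0 < lam" and u: "u \<in> borel_measurable borel" "\<And>y. \<bar>u y\<bar> \<le> K"
    and cont: "continuous_on {a..b} u" "continuous_on {a..b} G" and "a < b"
    and lim: "\<And>x. a < x \<Longrightarrow> x < b \<Longrightarrow> ((\<lambda>t. (bm_transition lam t u x - u x) / t) \<longlongrightarrow> G x) (at_right 0)"
  obtains u1 u2 where
    "\<And>y. a < y \<Longrightarrow> y < b \<Longrightarrow> (u has_real_derivative u1 y) (at y)"
    "\<And>y. a < y \<Longrightarrow> y < b \<Longrightarrow> (u1 has_real_derivative u2 y) (at y)"
    "\<And>y. a < y \<Longrightarrow> y < b \<Longrightarrow> u2 y / 2 + lam * u1 y = G y"
proof -
  \<comment> \<open>Integrating factor: a solution \<open>w\<close> satisfies
    \<open>(exp (2 * lam * y) * w')' = 2 * exp (2 * lam * y) * G y\<close>. Thus \<open>E\<close> is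
    the derivative of the particular solution \<open>W0\<close>, while constants and
    \<open>ex\<close> span the homogeneous ones.\<close>
  define I where "I y = integral {a..y} (\<lambda>s. exp (2 * lam * s) * G s)" for y
  define E where "E y = 2 * exp (- (2 * lam * y)) * I y" for y
  have cI: "continuous_on {a..b} (\<lambda>s. exp (2 * lam * s) * G s)"
    by (intro continuous_intros cont)
  have dI: "(I has_real_derivative exp (2 * lam * y) * G y) (at y within {a..b})" if "y \<in> {a..b}" for y
    unfolding I_def by (rule integral_has_real_derivative[OF cI that])
  have cE: "continuous_on {a..b} E"
    unfolding E_def using dI
    by (intro continuous_intros) (meson DERIV_continuous continuous_on_eq_continuous_within)
  define W0 where "W0 y = integral {a..y} E" for y
  have dW0: "(W0 has_real_derivative E y) (at y within {a..b})" if "y \<in> {a..b}" for y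
    unfolding W0_def by (rule integral_has_real_derivative[OF cE that])
  have at: "at y within {a..b} = at y" if "a < y" "y < b" for y
    using that by (intro at_within_interior) auto
  have dI': "(I has_real_derivative exp (2 * lam * y) * G y) (at y)" if "a < y" "y < b" for y
    using dI[of y] at[OF that] that by simp
  have dW0': "(W0 has_real_derivative E y) (at y)" if "a < y" "y < b" for y
    using dW0[of y] at[OF that] that by simp
  define ex where "ex y = exp (- (2 * lam * y))" for y
  have exab: "ex a \<noteq> ex b" using \<open>a < b\<close> \<open>0 < lam\<close> by (simp add: ex_def)
  \<comment> \<open>Fits \<open>W b = u b\<close> once the additive constant fits
    \<open>W a = u a\<close>; solvable because \<open>lam > 0\<close> separates \<open>ex a\<close>
    from \<open>ex b\<close>.\<close>
  define q where "q = (u a - u b + W0 b) / (ex a - ex b)"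
  define W where "W y = W0 y + (u a - q * ex a) + q * ex y" for y
  define W1 where "W1 y = E y - 2 * lam * q * ex y" for y
  define W2 where "W2 y = - (2 * lam) * E y + 2 * G y + 4 * lam^2 * q * ex y" for y
  have dex: "(ex has_real_derivative - (2 * lam) * ex y) (at y)" for y
    unfolding ex_def by (auto intro!: derivative_eq_intros)
  have cW: "continuous_on {a..b} W"
    unfolding W_def ex_def using dW0
    by (intro continuous_intros) (meson DERIV_continuous continuous_on_eq_continuous_within)
  have d1: "(W has_real_derivative W1 y) (at y)" if "a < y" "y < b" for y
    unfolding W_def W1_def using dW0'[OF that]
    by (auto intro!: derivative_eq_intros dex)
  have d2: "(W1 has_real_derivative W2 y) (at y)" if "a < y" "y < b" for y
  proof -
    have "ex y * exp (2 * lam * y) = 1" by (simp add: ex_def exp_add[symmetric])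
    then have eq: "2 * (- (2 * lam) * ex y) * I y + (exp (2 * lam * y) * G y) * (2 * ex y)
        = - (2 * lam) * (2 * ex y * I y) + 2 * G y"
      by algebra
    have "((\<lambda>y. 2 * ex y * I y) has_real_derivative
        2 * (- (2 * lam) * ex y) * I y + (exp (2 * lam * y) * G y) * (2 * ex y)) (at y)"
      using DERIV_mult[OF DERIV_cmult[OF dex] dI'[OF that]] .
    then have "(E has_real_derivative - (2 * lam) * E y + 2 * G y) (at y)"
      unfolding eq by (simp only: E_def[abs_def] ex_def)
    then show ?thesis
      unfolding W1_def W2_def by (auto intro!: derivative_eq_intros dex simp: power2_eq_square)
  qed
  have c2: "isCont W2 y" if "a < y" "y < b" for y
  proof -
    have "continuous_on {a..b} W2"
      unfolding W2_def ex_def by (intro continuous_intros cE cont)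
    with that show ?thesis by (auto simp: continuous_on_interior)
  qed
  have ode: "W2 y / 2 + lam * W1 y = G y" for y
    by (simp add: W1_def W2_def power2_eq_square field_simps)
  have "q * (ex a - ex b) = u a - u b + W0 b" using exab by (simp add: q_def)
  then have bd: "W a = u a" "W b = u b" by (simp_all add: W_def W0_def algebra_simps)
  have eq: "u y = W y" if y: "a \<le> y" "y \<le> b" for y
  proof (rule antisym)
    show "u y \<le> W y"
      by (rule bm_generator_comparison[OF \<open>0 < lam\<close> u cont(1) cW lim d1 d2 c2 ode _ _ y]) (simp_all add: bd)
    have "- u y \<le> - W y"
    proof (rule bm_generator_comparison[where u="\<lambda>y. - u y" and w="\<lambda>y. - W y" and G="\<lambda>y. - G y"
          and ?w1.0="\<lambda>y. - W1 y" and ?w2.0="\<lambda>y. - W2 y" and K=K and lam=lam])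
      show "((\<lambda>t. (bm_transition lam t (\<lambda>y. - u y) x - (- u x)) / t) \<longlongrightarrow> - G x) (at_right 0)"
        if "a < x" "x < b" for x
        using tendsto_minus[OF lim[OF that]] by (simp add: bm_transition_uminus minus_divide_left)
      show "- W2 y / 2 + lam * - W1 y = - G y" for y
        using ode[of y] by simp
    qed (use u cont cW y bd \<open>0 < lam\<close> in \<open>auto intro!: continuous_intros DERIV_minus d1 d2 c2\<close>)
    then show "W y \<le> u y" by simp
  qed
  have "(u has_real_derivative W1 y) (at y)" if "a < y" "y < b" for y
    by (rule has_field_derivative_transform_within_open[OF d1[OF that], of "{a<..<b}"]) (use that eq in auto)
  then show ?thesis using that d2 ode by blast
qed

section \<open>Functions vanishing at infinity and the identification of \<open>g\<close>\<close>

lemma C0_bounded: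
  assumes "h \<in> C0 S"
  obtains K where "\<And>x. x \<in> S \<Longrightarrow> \<bar>h x\<bar> \<le> K"
proof -
  obtain C where C: "compact C" "C \<subseteq> S" "\<forall>x\<in>S - C. \<bar>h x\<bar> < 1"
    using assms unfolding C0_def mem_Collect_eq by (metis zero_less_one)
  have "compact (h ` C)"
    using C assms unfolding C0_def by (intro compact_continuous_image) (auto intro: continuous_on_subset)
  then obtain B where B: "\<And>x. x \<in> C \<Longrightarrow> \<bar>h x\<bar> \<le> B"
    by (meson bounded_real compact_imp_bounded imageI)
  have "\<bar>h x\<bar> \<le> max 1 B" if "x \<in> S" for x
    using C(3) B[of x] that by (cases "x \<in> C") (auto simp: le_max_iff_disj less_imp_le)
  then show ?thesis using that by blast
qed

lemma C0_state_space_continuous: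
  assumes "h \<in> C0 state_space" "i \<in> {0, 1}"
  shows "continuous_on S (\<lambda>y. h (i, y))"
proof -
  have "continuous_on state_space h" using assms by (simp add: C0_def)
  then show ?thesis
    by (rule continuous_on_compose2) (use assms in \<open>auto simp: state_space_def intro!: continuous_intros\<close>)
qed

text \<open>The function \<open>u\<close> of the overview: the excess of \<open>h\<close> over its
  value in the absorbed state, weighted by the chance that a visit to \<open>z\<close> is still
  ahead.\<close>

definition kill_transform :: "real \<Rightarrow> real \<Rightarrow> (real \<times> real \<Rightarrow> real) \<Rightarrow> real \<Rightarrow> real" where
  "kill_transform lam z h y = (h (1, y) - h (0, z)) * hit_prob lam z y"

lemma kill_transform_C0:
  assumes "0 < lam" "h \<in> C0 state_space"
  shows "continuous_on S (kill_transform lam z h)" "kill_transform lam z h \<in> borel_measurable borel"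
    and "\<exists>K. \<forall>y. \<bar>kill_transform lam z h y\<bar> \<le> K"
proof -
  show c: "continuous_on S (kill_transform lam z h)" for S
    unfolding kill_transform_def using assms
    by (intro continuous_intros continuous_on_hit_prob C0_state_space_continuous) auto
  show "kill_transform lam z h \<in> borel_measurable borel"
    by (intro borel_measurable_continuous_onI c)
  obtain K where K: "\<And>x. x \<in> state_space \<Longrightarrow> \<bar>h x\<bar> \<le> K" using C0_bounded[OF assms(2)] by blast
  have "\<bar>kill_transform lam z h y\<bar> \<le> 2 * K" for y
  proof -
    have "\<bar>h (1, y) - h (0, z)\<bar> \<le> 2 * K"
      using K[of "(1, y)"] K[of "(0, z)"] by (auto simp: state_space_def)
    then have "\<bar>h (1, y) - h (0, z)\<bar> * \<bar>hit_prob lam z y\<bar> \<le> (2 * K) * 1"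
      using hit_prob_le_1[OF assms(1), of z y] hit_prob_pos[of lam z y] by (intro mult_mono) auto
    then show ?thesis by (simp add: kill_transform_def abs_mult)
  qed
  then show "\<exists>K. \<forall>y. \<bar>kill_transform lam z h y\<bar> \<le> K" by blast
qed

text \<open>Turns difference quotients of the semigroup into those of the Gaussian transition, up to
  the weight \<open>1 / \<phi>\<close>.\<close>

lemma semigroup_Q_diff_eq:
  assumes "0 < lam" "0 < t" "h \<in> C0 state_space"
  shows "semigroup_Q lam z t h (1, x) - h (1, x)
    = (bm_transition lam t (kill_transform lam z h) x - kill_transform lam z h x) / hit_prob lam z x"
proof -
  obtain K where K: "\<And>x. x \<in> state_space \<Longrightarrow> \<bar>h x\<bar> \<le> K" using C0_bounded[OF assms(3)] by blast
  have "semigroup_Q lam z t h (1, x) = h (0, z) + bm_transition lam t (kill_transform lam z h) x / hit_prob lam z x"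
    unfolding kill_transform_def[abs_def] using assms K
    by (intro semigroup_Q_one[where K=K] borel_measurable_continuous_onI C0_state_space_continuous)
       (auto simp: state_space_def)
  then show ?thesis
    using hit_prob_pos[of lam z x] by (simp add: kill_transform_def field_simps)
qed

lemma D2_eq:
  assumes "open S" "y \<in> S" "\<And>v. v \<in> S \<Longrightarrow> ((\<lambda>v. h (i, v)) has_real_derivative f v) (at v)"
  shows "D2 h (i, y) = f y"
  using assms by (auto simp: D2_def intro: DERIV_imp_deriv)

text \<open>\<open>D2\<close> is built on \<open>deriv\<close>, so differentiating
  \<open>D2 h\<close> at \<open>y\<close> requires knowing it on a whole neighbourhood; hence the
  open set.\<close>

lemma D2_D2_eq:
  assumes "open S" "y \<in> S" "\<And>v. v \<in> S \<Longrightarrow> ((\<lambda>v. h (i, v)) has_real_derivative f v) (at v)"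
    "(f has_real_derivative d) (at y)"
  shows "D2 (D2 h) (i, y) = d"
proof -
  have "((\<lambda>v. D2 h (i, v)) has_real_derivative d) (at y)"
    by (rule has_field_derivative_transform_within_open[OF assms(4,1,2)]) (rule D2_eq[OF assms(1) _ assms(3), symmetric])
  then show ?thesis by (auto simp: D2_def intro: DERIV_imp_deriv)
qed

text \<open>On either side of \<open>z\<close> the factor \<open>\<phi>\<close> is smooth, so
  \<open>h (1, _)\<close> inherits the derivatives of \<open>u\<close>. Below \<open>z\<close> it is
  \<open>u\<close> plus a constant; above \<open>z\<close> the product rule with
  \<open>1 / \<phi> = exp (2 * lam * (v - z))\<close> changes the sign of the first order
  term.\<close>

lemma generator_eq_D2:
  assumes "0 < lam" and h: "h \<in> C0 state_space" and g: "g \<in> C0 state_space"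
    and lim: "uniform_limit state_space (\<lambda>t x. (semigroup_Q lam z t h x - h x) / t) g (at_right 0)"
    and "y \<noteq> z"
  shows "(if z < y then - lam else lam) * D2 h (1, y) + 1 / 2 * D2 (D2 h) (1, y) = g (1, y)"
proof -
  let ?u = "kill_transform lam z h" and ?G = "\<lambda>x. hit_prob lam z x * g (1, x)"
  obtain K where K: "\<And>y. \<bar>?u y\<bar> \<le> K" using kill_transform_C0[OF assms(1,2)] by blast
  note u = kill_transform_C0[OF assms(1,2)]
  have G: "continuous_on S ?G" for S
    by (intro continuous_intros continuous_on_hit_prob C0_state_space_continuous g) auto
  have lim': "((\<lambda>t. (bm_transition lam t ?u x - ?u x) / t) \<longlongrightarrow> ?G x) (at_right 0)" for x
  proof -
    have "((\<lambda>t. (semigroup_Q lam z t h (1, x) - h (1, x)) / t) \<longlongrightarrow> g (1, x)) (at_right 0)"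
      by (rule tendsto_uniform_limitI[OF lim]) (simp add: state_space_def)
    then have "((\<lambda>t. hit_prob lam z x * ((semigroup_Q lam z t h (1, x) - h (1, x)) / t)) \<longlongrightarrow> ?G x) (at_right 0)"
      by (intro tendsto_intros)
    then show ?thesis
    proof (rule Lim_transform_eventually)
      show "\<forall>\<^sub>F t in at_right 0. hit_prob lam z x * ((semigroup_Q lam z t h (1, x) - h (1, x)) / t)
        = (bm_transition lam t ?u x - ?u x) / t"
        using eventually_at_right_less[of 0]
        by eventually_elim
           (use hit_prob_pos[of lam z x] in \<open>simp add: semigroup_Q_diff_eq[OF \<open>0 < lam\<close> _ h]\<close>)
    qed
  qed
  \<comment> \<open>An interval around \<open>y\<close> that ends at \<open>z\<close> on the side
    facing it, so that one formula for \<open>\<phi>\<close> holds throughout.\<close>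
  define a b where "a = (if y < z then y - 1 else z)" and "b = (if y < z then z else y + 1)"
  have ab: "a < y" "y < b" using \<open>y \<noteq> z\<close> by (auto simp: a_def b_def)
  obtain u1 u2 where d1: "\<And>y. a < y \<Longrightarrow> y < b \<Longrightarrow> (?u has_real_derivative u1 y) (at y)"
    and d2: "\<And>y. a < y \<Longrightarrow> y < b \<Longrightarrow> (u1 has_real_derivative u2 y) (at y)"
    and ode: "\<And>y. a < y \<Longrightarrow> y < b \<Longrightarrow> u2 y / 2 + lam * u1 y = ?G y"
    using bm_generator_regular[OF \<open>0 < lam\<close> u(2) K u(1) G _ lim', of a b] ab by auto
  show ?thesis
  proof (cases "y < z")
    case True
    have 1: "((\<lambda>v. h (1, v)) has_real_derivative u1 v) (at v)" if v: "v \<in> {a<..<b}" for v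
    proof (rule has_field_derivative_transform_within_open[of "\<lambda>v. ?u v + h (0, z)" _ _ "{a<..<b}"])
      show "((\<lambda>v. ?u v + h (0, z)) has_real_derivative u1 v) (at v)"
        using d1[of v] v by (auto intro!: derivative_eq_intros)
    qed (use v True in \<open>auto simp: a_def b_def kill_transform_def hit_prob_below\<close>)
    show ?thesis
      using D2_eq[of "{a<..<b}" y h 1 u1, OF _ _ 1] D2_D2_eq[of "{a<..<b}" y h 1 u1, OF _ _ 1 d2] ode[OF ab] ab True
      by (simp add: hit_prob_below)
  next
    case False
    let ?e = "\<lambda>v. exp (2 * lam * (v - z))"
    have e: "hit_prob lam z v * ?e v = 1" if "z \<le> v" for v
      using that by (simp add: hit_prob_above exp_add[symmetric] algebra_simps)
    have de: "(?e has_real_derivative 2 * lam * ?e v) (at v)" for v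
      by (auto intro!: derivative_eq_intros)
    have 1: "((\<lambda>v. h (1, v)) has_real_derivative (u1 v + 2 * lam * ?u v) * ?e v) (at v)" if v: "v \<in> {a<..<b}" for v
    proof (rule has_field_derivative_transform_within_open[of "\<lambda>v. ?u v * ?e v + h (0, z)" _ _ "{a<..<b}"])
      show "((\<lambda>v. ?u v * ?e v + h (0, z)) has_real_derivative (u1 v + 2 * lam * ?u v) * ?e v) (at v)"
        using d1[of v] v by (auto intro!: derivative_eq_intros simp: algebra_simps)
      show "?u v * ?e v + h (0, z) = h (1, v)" if "v \<in> {a<..<b}" for v
        using e[of v] that False by (simp add: kill_transform_def a_def mult.assoc)
    qed (use v in auto)
    have 2: "((\<lambda>v. (u1 v + 2 * lam * ?u v) * ?e v) has_real_derivative
        (u2 y + 4 * lam * u1 y + 4 * lam^2 * ?u y) * ?e y) (at y)"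
      using d1[OF ab] d2[OF ab] by (auto intro!: derivative_eq_intros simp: algebra_simps power2_eq_square)
    \<comment> \<open>The terms in \<open>u\<close> cancel and those in \<open>u1\<close> combine:
      \<open>- lam * (u1 + 2 * lam * u) + (u2 + 4 * lam * u1 + 4 * lam^2 * u) / 2 = u2 / 2 + lam *
      u1\<close>.\<close>
    have "- lam * D2 h (1, y) + 1 / 2 * D2 (D2 h) (1, y) = (u2 y / 2 + lam * u1 y) * ?e y"
      using D2_eq[of "{a<..<b}" y h 1, OF _ _ 1] D2_D2_eq[of "{a<..<b}" y h 1, OF _ _ 1 2] ab
      by (simp add: algebra_simps power2_eq_square)
    also have "\<dots> = g (1, y) * (hit_prob lam z y * ?e y)"
      using ode[OF ab] by (simp only: mult.assoc mult.commute mult.left_commute)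
    also have "\<dots> = g (1, y)" using e[of y] False by simp
    finally show ?thesis using False \<open>y \<noteq> z\<close> by simp
  qed
qed

section \<open>The Markov property of Brownian motion\<close>

lemma space_completed_natural_filtration [simp]: "space (completed_natural_filtration M X t) = space M"
  by (auto simp: completed_natural_filtration_def space_measure_of_conv)

lemma sets_completed_natural_filtration:
  "sets (completed_natural_filtration M X t) = sigma_sets (space M)
     ({X s -` A \<inter> space M | s A. 0 \<le> s \<and> s \<le> t \<and> A \<in> sets borel} \<union> null_sets M)"
  unfolding completed_natural_filtration_def
  by (rule sets_measure_of) (auto dest: sets.sets_into_space)

lemma sets_completed_natural_filtration_mono:
  "s \<le> t \<Longrightarrow> sets (completed_natural_filtration M X s) \<subseteq> sets (completed_natural_filtration M X t)"
  unfolding sets_completed_natural_filtration by (intro sigma_sets_mono') (blast intro: order_trans)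

lemma null_sets_completed_natural_filtration:
  "N \<in> null_sets M \<Longrightarrow> N \<in> sets (completed_natural_filtration M X t)"
  unfolding sets_completed_natural_filtration by (auto intro: sigma_sets.Basic)

lemma measurable_completed_natural_filtration:
  assumes "0 \<le> s" "s \<le> t"
  shows "X s \<in> borel_measurable (completed_natural_filtration M X t)"
proof (rule measurableI)
  fix A :: "real set" assume "A \<in> sets borel"
  then show "X s -` A \<inter> space (completed_natural_filtration M X t) \<in> sets (completed_natural_filtration M X t)"
    unfolding sets_completed_natural_filtration space_completed_natural_filtration
    using assms by (intro sigma_sets.Basic) blast
qed simp

lemma subalgebra_completed_natural_filtration:
  assumes "\<And>s. 0 \<le> s \<Longrightarrow> X s \<in> borel_measurable M"
  shows "subalgebra M (completed_natural_filtration M X t)"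
  unfolding subalgebra_def sets_completed_natural_filtration
  using assms by (auto intro!: sets.sigma_sets_subset measurable_sets)

text \<open>A subset of a null set is null by completeness, and the sub-sigma-algebra contains all
  null sets; it therefore cannot distinguish a set from an almost sure version of it.\<close>

lemma (in complete_measure) AE_eq_sets:
  assumes null: "null_sets M \<subseteq> sets G" and A: "A \<in> sets G" "A \<subseteq> space M" and "D \<subseteq> space M"
    and eq: "AE \<omega> in M. \<omega> \<in> A \<longleftrightarrow> \<omega> \<in> D"
  shows "D \<in> sets G"
proof -
  let ?N = "{\<omega> \<in> space M. \<not> (\<omega> \<in> A \<longleftrightarrow> \<omega> \<in> D)}"
  have N: "?N \<in> null_sets M" using eq by (simp only: AE_iff_null_sets)
  have "?N \<inter> D \<in> null_sets M" by (rule complete2[OF Int_lower1 N])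
  then have "(A - ?N) \<union> (?N \<inter> D) \<in> sets G"
    using N null by (intro sets.Un sets.Diff A) auto
  also have "(A - ?N) \<union> (?N \<inter> D) = D"
    using assms(4) A by auto
  finally show ?thesis .
qed

lemma (in complete_measure) AE_eq_measurable:
  assumes G: "space G = space M" "null_sets M \<subseteq> sets G"
    and f: "f \<in> measurable G N" and eq: "AE \<omega> in M. f \<omega> = g \<omega>"
    and g: "\<And>\<omega>. \<omega> \<in> space M \<Longrightarrow> g \<omega> \<in> space N"
  shows "g \<in> measurable G N"
proof (rule measurableI)
  fix A assume A: "A \<in> sets N"
  have "g -` A \<inter> space M \<in> sets G"
    by (rule AE_eq_sets[OF G(2) measurable_sets[OF f A]]) (use G eq in \<open>auto simp: Int_def\<close>)
  then show "g -` A \<inter> space G \<in> sets G" by (simp add: G)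
qed (simp add: G g)

section \<open>Independence of the past and later increments\<close>

context standard_brownian_motion
begin

abbreviation "past \<equiv> completed_natural_filtration M B"

text \<open>The single-time preimages that generate the filtration are not closed under
  intersection; finite-dimensional cylinders are, as the extension of independence from a generator
  requires.\<close>

definition cylinders :: "real \<Rightarrow> 'a set set" where
  "cylinders s = {{\<omega> \<in> space M. \<forall>r\<in>R. B r \<omega> \<in> A r} | R A. finite R \<and> R \<subseteq> {0..s} \<and> (\<forall>r\<in>R. A r \<in> sets borel)}"

lemma cylinder_measurable:
  assumes "finite R" "R \<subseteq> {0..s}" "\<forall>r\<in>R. A r \<in> sets borel"
  shows "{\<omega> \<in> space M. \<forall>r\<in>R. B r \<omega> \<in> A r} \<in> sets (past s)"
proof -
  have "{\<omega> \<in> space (past s). \<forall>r\<in>R. B r \<omega> \<in> A r} \<in> sets (past s)"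
  proof (rule sets.sets_Collect_finite_All[OF _ assms(1)])
    fix r assume r: "r \<in> R"
    then have "0 \<le> r" "r \<le> s" "A r \<in> sets borel" using assms by auto
    then have "B r -` A r \<inter> space (past s) \<in> sets (past s)"
      using measurable_sets[OF measurable_completed_natural_filtration] by blast
    then show "{\<omega> \<in> space (past s). B r \<omega> \<in> A r} \<in> sets (past s)"
      by (simp add: vimage_def Int_def conj_commute)
  qed
  then show ?thesis by simp
qed

lemma subalgebra_past: "subalgebra M (past s)"
  by (rule subalgebra_completed_natural_filtration[OF measurable_B])

lemma sets_past: "A \<in> sets (past s) \<Longrightarrow> A \<in> sets M"
  using subalgebra_past by (auto simp: subalgebra_def)

lemma past_measurable_M: "f \<in> measurable (past s) N \<Longrightarrow> f \<in> measurable M N"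
  using subalgebra_past measurable_from_subalg by blast

lemma Int_stable_cylinders: "Int_stable (cylinders s \<union> null_sets M)"
proof (rule Int_stableI)
  fix C D assume C: "C \<in> cylinders s \<union> null_sets M" and D: "D \<in> cylinders s \<union> null_sets M"
  have M: "E \<in> cylinders s \<union> null_sets M \<Longrightarrow> E \<in> sets M" for E
    using sets_past[OF cylinder_measurable] by (auto simp: cylinders_def)
  show "C \<inter> D \<in> cylinders s \<union> null_sets M"
  proof (cases "C \<in> null_sets M \<or> D \<in> null_sets M")
    case True
    then show ?thesis using M[OF C] M[OF D] by (auto simp: null_set_Int1 null_set_Int2)
  next
    case False
    with C D obtain R A R' A' where
      1: "C = {\<omega> \<in> space M. \<forall>r\<in>R. B r \<omega> \<in> A r}" "finite R" "R \<subseteq> {0..s}" "\<forall>r\<in>R. A r \<in> sets borel" and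
      2: "D = {\<omega> \<in> space M. \<forall>r\<in>R'. B r \<omega> \<in> A' r}" "finite R'" "R' \<subseteq> {0..s}" "\<forall>r\<in>R'. A' r \<in> sets borel"
      unfolding cylinders_def by blast
    let ?A = "\<lambda>r. (if r \<in> R then A r else UNIV) \<inter> (if r \<in> R' then A' r else UNIV)"
    have "C \<inter> D = {\<omega> \<in> space M. \<forall>r\<in>R \<union> R'. B r \<omega> \<in> ?A r}"
      using 1 2 by auto
    then have "C \<inter> D \<in> cylinders s"
      unfolding cylinders_def using 1 2 by (intro CollectI exI[of _ "R \<union> R'"] exI[of _ ?A]) auto
    then show ?thesis by blast
  qed
qed

lemma sets_past_eq_cylinders: "sets (past s) = sigma_sets (space M) (cylinders s \<union> null_sets M)"
proof (rule antisym)
  show "sigma_sets (space M) (cylinders s \<union> null_sets M) \<subseteq> sets (past s)"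
  proof (subst space_completed_natural_filtration[of M B s, symmetric], rule sets.sigma_sets_subset)
    show "cylinders s \<union> null_sets M \<subseteq> sets (past s)"
      by (auto simp: cylinders_def null_sets_completed_natural_filtration intro: cylinder_measurable)
  qed
  have "B r -` A \<inter> space M \<in> cylinders s" if "0 \<le> r" "r \<le> s" "A \<in> sets borel" for r A
    unfolding cylinders_def using that
    by (intro CollectI exI[of _ "{r}"] exI[of _ "\<lambda>_. A"]) auto
  then show "sets (past s) \<subseteq> sigma_sets (space M) (cylinders s \<union> null_sets M)"
    unfolding sets_completed_natural_filtration by (intro sigma_sets_mono') auto
qed

text \<open>Independence is given only for increments along finitely many times. Along the times of
  the cylinder together with \<open>0\<close>, \<open>s\<close> and \<open>t\<close>, the last
  increment is \<open>B t - B s\<close>, and the earlier ones determine the cylinder almost surely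
  because their partial sums recover the values of \<open>B\<close>.\<close>

lemma prob_cylinder_increment:
  assumes st: "0 \<le> s" "s < t" and C: "C \<in> cylinders s" and D: "D \<in> sets borel"
  shows "prob (C \<inter> ((\<lambda>\<omega>. B t \<omega> - B s \<omega>) -` D \<inter> space M))
     = prob C * prob ((\<lambda>\<omega>. B t \<omega> - B s \<omega>) -` D \<inter> space M)"
proof -
  obtain R A where Ceq: "C = {\<omega> \<in> space M. \<forall>r\<in>R. B r \<omega> \<in> A r}"
    and R: "finite R" "R \<subseteq> {0..s}" and A: "\<forall>r\<in>R. A r \<in> sets borel"
    using C unfolding cylinders_def by blast
  \<comment> \<open>Adding \<open>0\<close> lets the partial sums start from \<open>B 0\<close>;
    adding \<open>s\<close> makes it the last time before \<open>t\<close>.\<close>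
  define xs where "xs = sorted_list_of_set (R \<union> {0, s})"
  have xs: "sorted_wrt (<) xs" "set xs = R \<union> {0, s}"
    unfolding xs_def using R by (simp_all only: strict_sorted_list_of_set set_sorted_list_of_set finite_Un finite.intros)
  define n where "n = length xs - 1"
  have len: "length xs = Suc n" using xs by (cases xs) (auto simp: n_def)
  define u where "u i = (if i \<le> n then xs ! i else t)" for i
  have mono: "xs ! i < xs ! j" if "i < j" "j \<le> n" for i j
    using sorted_wrt_nth_less[OF xs(1) that(1)] that len by simp
  have idx: "\<exists>i\<le>n. r = xs ! i" if "r \<in> R \<union> {0, s}" for r
    using that xs(2) len by (metis in_set_conv_nth less_Suc_eq_le)
  have range: "0 \<le> xs ! i" "xs ! i \<le> s" if "i \<le> n" for i
    using that xs(2) len R st nth_mem[of i xs] by auto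
  obtain i where "i \<le> n" "0 = xs ! i" using idx[of 0] by auto
  then have u0: "u 0 = 0" using mono[of 0 i] range[of 0] by (cases "i = 0") (auto simp: u_def)
  obtain j where "j \<le> n" "s = xs ! j" using idx[of s] by auto
  then have un: "u n = s" using mono[of j n] range[of n] by (cases "j = n") (auto simp: u_def)
  have ut: "u (Suc n) = t" by (simp add: u_def)
  have incr: "u i < u (Suc i)" if "i < Suc n" for i
    using that mono[of i "Suc i"] un ut st by (cases "i = n") (auto simp: u_def)
  define inc where "inc i \<omega> = B (u (Suc i)) \<omega> - B (u i) \<omega>" for i \<omega>
  have iv: "indep_vars (\<lambda>_. borel) inc {..<Suc n}"
    unfolding inc_def[abs_def] using indep_increments[of u "Suc n"] u0 incr by simp
  have ind: "indep_var (PiM {..<n} (\<lambda>_. borel)) (\<lambda>\<omega>. restrict (\<lambda>i. inc i \<omega>) {..<n})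
      (PiM {n} (\<lambda>_. borel)) (\<lambda>\<omega>. restrict (\<lambda>i. inc i \<omega>) {n})"
    by (rule indep_var_restrict[OF iv]) auto
  define S where "S = {v \<in> space (PiM {..<n} (\<lambda>_. borel :: real measure)). \<forall>k\<le>n. u k \<in> R \<longrightarrow> (\<Sum>i<k. v i) \<in> A (u k)}"
  define T where "T = {v \<in> space (PiM {n} (\<lambda>_. borel :: real measure)). v n \<in> D}"
  have S: "S \<in> sets (PiM {..<n} (\<lambda>_. borel))"
  proof -
    have "S = {v \<in> space (PiM {..<n} (\<lambda>_. borel :: real measure)). \<forall>k\<in>{..n} \<inter> {k. u k \<in> R}. (\<Sum>i<k. v i) \<in> A (u k)}"
      unfolding S_def by auto
    also have "\<dots> \<in> sets (PiM {..<n} (\<lambda>_. borel))"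
    proof (rule sets.sets_Collect_finite_All)
      fix k assume k: "k \<in> {..n} \<inter> {k. u k \<in> R}"
      have "(\<lambda>v. \<Sum>i<k. v i) \<in> borel_measurable (PiM {..<n} (\<lambda>_. borel :: real measure))"
        using k by (intro borel_measurable_sum measurable_component_singleton) auto
      from measurable_sets[OF this, of "A (u k)"] k A
      show "{v \<in> space (PiM {..<n} (\<lambda>_. borel :: real measure)). (\<Sum>i<k. v i) \<in> A (u k)} \<in> sets (PiM {..<n} (\<lambda>_. borel))"
        by (simp add: vimage_def Int_def conj_commute)
    qed simp
    finally show ?thesis .
  qed
  have T: "T \<in> sets (PiM {n} (\<lambda>_. borel))"
  proof -
    have "(\<lambda>v. v n) -` D \<inter> space (PiM {n} (\<lambda>_. borel :: real measure)) \<in> sets (PiM {n} (\<lambda>_. borel))"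
      by (rule measurable_sets[OF _ D]) simp
    then show ?thesis unfolding T_def by (simp add: vimage_def Int_def conj_commute)
  qed
  let ?X = "\<lambda>\<omega>. restrict (\<lambda>i. inc i \<omega>) {..<n}" and ?Y = "\<lambda>\<omega>. restrict (\<lambda>i. inc i \<omega>) {n}"
  have eqY: "?Y -` T \<inter> space M = (\<lambda>\<omega>. B t \<omega> - B s \<omega>) -` D \<inter> space M"
    by (auto simp: T_def space_PiM PiE_def extensional_def inc_def un ut)
  have tel: "(\<Sum>i<k. inc i \<omega>) = B (u k) \<omega> - B 0 \<omega>" for k \<omega>
    unfolding inc_def using sum_lessThan_telescope[of "\<lambda>i. B (u i) \<omega>" k] u0 by simp
  have Rr: "(\<forall>k\<le>n. u k \<in> R \<longrightarrow> B (u k) \<omega> \<in> A (u k)) \<longleftrightarrow> (\<forall>r\<in>R. B r \<omega> \<in> A r)" for \<omega>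
    using idx by (auto simp: u_def)
  \<comment> \<open>Only almost surely, as telescoping leaves
    \<open>B (u k) \<omega> - B 0 \<omega>\<close>.\<close>
  have AEC: "AE \<omega> in M. \<omega> \<in> ?X -` S \<inter> space M \<longleftrightarrow> \<omega> \<in> C"
    using start_zero
  proof eventually_elim
    case (elim \<omega>)
    have "(\<Sum>i<k. ?X \<omega> i) = B (u k) \<omega>" if "k \<le> n" for k
    proof -
      have "(\<Sum>i<k. ?X \<omega> i) = (\<Sum>i<k. inc i \<omega>)" using that by (intro sum.cong) auto
      then show ?thesis using tel elim by simp
    qed
    then show ?case unfolding Ceq S_def using Rr[of \<omega>] by (auto simp: space_PiM)
  qed
  have mX: "?X -` S \<inter> space M \<in> sets M" and mY: "?Y -` T \<inter> space M \<in> sets M"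
    using indep_var_rv1[OF ind] indep_var_rv2[OF ind] S T by (auto intro: measurable_sets)
  have mC: "C \<in> sets M" unfolding Ceq using sets_past[OF cylinder_measurable[OF R A]] .
  have "prob (C \<inter> (?Y -` T \<inter> space M)) = prob ((?X -` S \<inter> space M) \<inter> (?Y -` T \<inter> space M))"
    using AEC mX mY mC by (intro finite_measure_eq_AE) (auto elim: eventually_mono)
  also have "(?X -` S \<inter> space M) \<inter> (?Y -` T \<inter> space M) = (\<lambda>\<omega>. (?X \<omega>, ?Y \<omega>)) -` (S \<times> T) \<inter> space M"
    by auto
  also have "prob \<dots> = prob (?X -` S \<inter> space M) * prob (?Y -` T \<inter> space M)"
    by (rule indep_varD[OF ind S T])
  also have "prob (?X -` S \<inter> space M) = prob C"
    using AEC mX mC by (intro finite_measure_eq_AE) auto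
  finally show ?thesis unfolding eqY .
qed

lemma indep_past_increment:
  assumes st: "0 \<le> s" "s < t"
  shows "indep_set (sets (past s))
     (sigma_sets (space M) {(\<lambda>\<omega>. B t \<omega> - B s \<omega>) -` D \<inter> space M | D. D \<in> sets borel})"
proof -
  let ?Q = "{(\<lambda>\<omega>. B t \<omega> - B s \<omega>) -` D \<inter> space M | D. D \<in> sets borel}"
  have m: "(\<lambda>\<omega>. B t \<omega> - B s \<omega>) \<in> borel_measurable M"
    using st by (intro borel_measurable_diff measurable_B) auto
  have "indep_set (cylinders s \<union> null_sets M) ?Q"
  proof (rule indep_setI)
    show "cylinders s \<union> null_sets M \<subseteq> events"
      using sets_past[OF cylinder_measurable] by (auto simp: cylinders_def)
    show "?Q \<subseteq> events" using m by auto
    fix C Q assume C: "C \<in> cylinders s \<union> null_sets M" and "Q \<in> ?Q"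
    then obtain D where D: "D \<in> sets borel" "Q = (\<lambda>\<omega>. B t \<omega> - B s \<omega>) -` D \<inter> space M" by auto
    show "prob (C \<inter> Q) = prob C * prob Q"
    proof (cases "C \<in> cylinders s")
      case True
      then show ?thesis unfolding D(2) by (rule prob_cylinder_increment[OF st _ D(1)])
    next
      case False
      then have "C \<in> null_sets M" using C by auto
      moreover have "Q \<in> sets M" using D m by auto
      ultimately have "C \<inter> Q \<in> null_sets M" "C \<in> null_sets M" by (auto intro: null_set_Int2)
      then show ?thesis by (simp add: measure_eq_0_null_sets)
    qed
  qed
  moreover have "Int_stable ?Q"
  proof (rule Int_stableI)
    fix a b assume "a \<in> ?Q" "b \<in> ?Q"
    then obtain D E where "D \<in> sets borel" "E \<in> sets borel"
      "a = (\<lambda>\<omega>. B t \<omega> - B s \<omega>) -` D \<inter> space M" "b = (\<lambda>\<omega>. B t \<omega> - B s \<omega>) -` E \<inter> space M"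
      by auto
    then show "a \<inter> b \<in> ?Q" by (intro CollectI exI[of _ "D \<inter> E"]) auto
  qed
  ultimately show ?thesis
    unfolding sets_past_eq_cylinders by (intro indep_set_sigma_sets Int_stable_cylinders)
qed

lemma indep_var_past_increment:
  fixes f :: "'a \<Rightarrow> real" and g :: "real \<Rightarrow> real"
  assumes st: "0 \<le> s" "s < t"
    and f: "f \<in> borel_measurable (past s)" and g: "g \<in> borel_measurable borel"
  shows "indep_var borel f borel (\<lambda>\<omega>. g (B t \<omega> - B s \<omega>))"
proof -
  let ?Q = "{(\<lambda>\<omega>. B t \<omega> - B s \<omega>) -` D \<inter> space M | D. D \<in> sets borel}"
  have m: "(\<lambda>\<omega>. B t \<omega> - B s \<omega>) \<in> borel_measurable M"
    using st by (intro borel_measurable_diff measurable_B) auto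
  have 1: "sigma_sets (space M) {f -` A \<inter> space M | A. A \<in> sets borel} \<subseteq> sets (past s)"
    using measurable_sets[OF f] sets.sigma_sets_subset[of "{f -` A \<inter> space M | A. A \<in> sets borel}" "past s"] by auto
  have "(\<lambda>\<omega>. g (B t \<omega> - B s \<omega>)) -` A \<inter> space M \<in> ?Q" if "A \<in> sets borel" for A
  proof -
    have "g -` A \<in> sets borel" using measurable_sets[OF g that] by simp
    then show ?thesis by (intro CollectI exI[of _ "g -` A"]) auto
  qed
  then have 2: "sigma_sets (space M) {(\<lambda>\<omega>. g (B t \<omega> - B s \<omega>)) -` A \<inter> space M | A. A \<in> sets borel}
      \<subseteq> sigma_sets (space M) ?Q"
    by (intro sigma_sets_mono') auto
  note ind = indep_past_increment[OF st]
  show ?thesis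
    unfolding indep_var_eq
  proof (intro conjI)
    show "indep_set (sigma_sets (space M) {f -` A \<inter> space M | A. A \<in> sets borel})
       (sigma_sets (space M) {(\<lambda>\<omega>. g (B t \<omega> - B s \<omega>)) -` A \<inter> space M | A. A \<in> sets borel})"
      using 1 2 indep_setD[OF ind] indep_setD_ev1[OF ind] indep_setD_ev2[OF ind]
      by (intro indep_setI) blast+
    show "random_variable borel f" by (rule past_measurable_M[OF f])
    show "random_variable borel (\<lambda>\<omega>. g (B t \<omega> - B s \<omega>))" by (rule measurable_compose[OF m g])
  qed
qed

lemma distr_increment:
  assumes "0 \<le> s" "s < t"
  shows "distr M borel (\<lambda>\<omega>. B t \<omega> - B s \<omega>) = density lborel (normal_density 0 (sqrt (t - s)))"
proof -
  have "distr M borel (\<lambda>\<omega>. B t \<omega> - B s \<omega>) = distr M lborel (\<lambda>\<omega>. B t \<omega> - B s \<omega>)"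
    by (rule distr_cong) auto
  then show ?thesis using normal_increments[OF assms] by (simp add: distributed_def)
qed

text \<open>Freezing of the past: the identity map, seen as a random element of
  \<open>past s\<close>, and the increment have a product law, so Fubini integrates the increment
  out while \<open>\<omega>\<close> is held fixed. This covers integrands that couple the past with
  the increment.\<close>

lemma integral_past_increment:
  fixes F :: "'a \<Rightarrow> real \<Rightarrow> real"
  assumes st: "0 \<le> s" "s < t"
    and F: "case_prod F \<in> borel_measurable (past s \<Otimes>\<^sub>M borel)" and K: "\<And>\<omega> x. \<bar>F \<omega> x\<bar> \<le> K"
  shows "(LINT \<omega>|M. F \<omega> (B t \<omega> - B s \<omega>))
    = (LINT \<omega>|M. (LINT x|lborel. F \<omega> x * normal_density 0 (sqrt (t - s)) x))"
proof -
  let ?Y = "\<lambda>\<omega>. B t \<omega> - B s \<omega>" and ?n = "normal_density 0 (sqrt (t - s))"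
  let ?P = "distr M (past s) (\<lambda>\<omega>. \<omega>)" and ?D = "distr M borel ?Y"
  have id: "(\<lambda>\<omega>. \<omega>) \<in> measurable M (past s)" by (rule past_measurable_M[of _ s]) simp
  have Y: "?Y \<in> borel_measurable M" using st by (intro borel_measurable_diff measurable_B) auto
  have "?P \<Otimes>\<^sub>M ?D = distr M (past s \<Otimes>\<^sub>M borel) (\<lambda>\<omega>. (\<omega>, ?Y \<omega>))"
  proof (rule pair_measure_eqI)
    show "sigma_finite_measure ?P" "sigma_finite_measure ?D"
      using prob_space_distr[OF id] prob_space_distr[OF Y] by (simp_all add: prob_space_imp_sigma_finite)
    fix A D assume "A \<in> sets ?P" "D \<in> sets ?D"
    then have A: "A \<in> sets (past s)" and D: "D \<in> sets borel" by auto
    have "prob (A \<inter> (?Y -` D \<inter> space M)) = prob A * prob (?Y -` D \<inter> space M)"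
      using indep_past_increment[OF st] A D by (intro indep_setD) (auto intro!: sigma_sets.Basic)
    moreover have "(\<lambda>\<omega>. (\<omega>, ?Y \<omega>)) -` (A \<times> D) \<inter> space M = A \<inter> (?Y -` D \<inter> space M)"
      "(\<lambda>\<omega>. \<omega>) -` A \<inter> space M = A"
      using sets.sets_into_space[OF A] by auto
    moreover have "(\<lambda>\<omega>. (\<omega>, ?Y \<omega>)) \<in> measurable M (past s \<Otimes>\<^sub>M borel)"
      using id Y by (rule measurable_Pair)
    ultimately show "emeasure ?P A * emeasure ?D D = emeasure (distr M (past s \<Otimes>\<^sub>M borel) (\<lambda>\<omega>. (\<omega>, ?Y \<omega>))) (A \<times> D)"
      using A D id Y by (simp add: emeasure_distr emeasure_eq_measure ennreal_mult)
  qed (simp cong: sets_pair_measure_cong)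
  moreover have "(LINT \<omega>|M. F \<omega> (?Y \<omega>)) = (LINT p|distr M (past s \<Otimes>\<^sub>M borel) (\<lambda>\<omega>. (\<omega>, ?Y \<omega>)). case_prod F p)"
    by (subst integral_distr) (use F id Y in \<open>auto intro!: measurable_Pair\<close>)
  ultimately have 1: "(LINT \<omega>|M. F \<omega> (?Y \<omega>)) = (LINT p|(?P \<Otimes>\<^sub>M ?D). case_prod F p)" by simp
  interpret P: prob_space ?P by (rule prob_space_distr[OF id])
  interpret D: prob_space ?D by (rule prob_space_distr[OF Y])
  interpret PD: pair_prob_space ?P ?D ..
  have F': "case_prod F \<in> borel_measurable (?P \<Otimes>\<^sub>M ?D)"
    using F by (simp cong: measurable_cong_sets add: sets_pair_measure_cong[OF sets_distr sets_distr])
  have "integrable (?P \<Otimes>\<^sub>M ?D) (case_prod F)"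
    using K by (intro PD.integrable_const_bound[where B=K] F') auto
  then have "(LINT p|(?P \<Otimes>\<^sub>M ?D). case_prod F p) = (LINT \<omega>|?P. (LINT x|?D. F \<omega> x))"
    using PD.integral_fst'[of "case_prod F"] by simp
  also have "\<dots> = (LINT \<omega>|M. (LINT x|?D. F \<omega> x))"
  proof (rule integral_distr[OF id])
    show "(\<lambda>\<omega>. LINT x|?D. F \<omega> x) \<in> borel_measurable (past s)"
      using F by (intro D.borel_measurable_lebesgue_integral)
         (simp cong: measurable_cong_sets add: sets_pair_measure_cong[OF refl sets_distr])
  qed
  also have "\<dots> = (LINT \<omega>|M. (LINT x|lborel. F \<omega> x * ?n x))"
  proof (rule Bochner_Integration.integral_cong[OF refl])
    fix \<omega> assume "\<omega> \<in> space M"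
    then have "F \<omega> \<in> borel_measurable borel"
      using measurable_Pair2[OF F, of \<omega>] by simp
    then show "(LINT x|?D. F \<omega> x) = (LINT x|lborel. F \<omega> x * ?n x)"
      unfolding distr_increment[OF st] by (subst integral_density) (auto simp: mult.commute)
  qed
  finally show ?thesis using 1 by simp
qed

section \<open>Transitions and exponential moments of the drifted process\<close>

abbreviation "X lam \<equiv> drifted B lam"

lemma measurable_X_past: "0 \<le> r \<Longrightarrow> r \<le> s \<Longrightarrow> X lam r \<in> borel_measurable (past s)"
  unfolding drifted_def[abs_def]
  by (intro borel_measurable_add borel_measurable_const measurable_completed_natural_filtration)

lemma measurable_X: "0 \<le> r \<Longrightarrow> X lam r \<in> borel_measurable M"
  using measurable_X_past[of r r] past_measurable_M by blast

lemma borel_measurable_bm_transition: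
  assumes [measurable]: "f \<in> borel_measurable borel"
  shows "bm_transition lam t f \<in> borel_measurable borel"
  unfolding bm_transition_def[abs_def] normal_density_def by measurable

lemma markov_X:
  assumes "0 \<le> s" "0 < t" and A: "A \<in> sets (past s)"
    and f: "f \<in> borel_measurable borel" "\<And>x. \<bar>f x\<bar> \<le> K"
  shows "(LINT \<omega>|M. indicator A \<omega> * f (X lam (s + t) \<omega>))
     = (LINT \<omega>|M. indicator A \<omega> * bm_transition lam t f (X lam s \<omega>))"
proof -
  define F where "F \<omega> x = indicator A \<omega> * f (X lam s \<omega> + lam * t + x)" for \<omega> x
  have [measurable]: "X lam s \<in> borel_measurable (past s)" "A \<in> sets (past s)" "f \<in> borel_measurable borel"
    using assms by (auto intro: measurable_X_past)
  have "(LINT \<omega>|M. F \<omega> (B (s + t) \<omega> - B s \<omega>))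
     = (LINT \<omega>|M. (LINT x|lborel. F \<omega> x * normal_density 0 (sqrt (s + t - s)) x))"
  proof (rule integral_past_increment)
    show "case_prod F \<in> borel_measurable (past s \<Otimes>\<^sub>M borel)"
      unfolding F_def by measurable
    show "\<bar>F \<omega> x\<bar> \<le> K" for \<omega> x
      using f(2) order_trans[OF abs_ge_zero f(2)] by (auto simp: F_def indicator_def)
  qed (use assms in auto)
  also have "(LINT \<omega>|M. F \<omega> (B (s + t) \<omega> - B s \<omega>)) = (LINT \<omega>|M. indicator A \<omega> * f (X lam (s + t) \<omega>))"
    by (simp add: F_def drifted_def algebra_simps)
  also have "(\<lambda>\<omega>. LINT x|lborel. F \<omega> x * normal_density 0 (sqrt (s + t - s)) x)
      = (\<lambda>\<omega>. indicator A \<omega> * bm_transition lam t f (X lam s \<omega>))"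
  proof
    fix \<omega>
    have "bm_transition lam t f (X lam s \<omega>) = (LINT x|lborel. f (X lam s \<omega> + lam * t + 1 * x)
          * normal_density (X lam s \<omega> + lam * t) (sqrt t) (X lam s \<omega> + lam * t + 1 * x))"
      unfolding bm_transition_def
      by (subst lborel_integral_real_affine[of 1 _ "X lam s \<omega> + lam * t"]) auto
    also have "\<dots> = (LINT x|lborel. f (X lam s \<omega> + lam * t + x) * normal_density 0 (sqrt t) x)"
      by (simp add: normal_density_def)
    finally show "(LINT x|lborel. F \<omega> x * normal_density 0 (sqrt (s + t - s)) x)
        = indicator A \<omega> * bm_transition lam t f (X lam s \<omega>)"
      by (simp add: F_def mult.assoc)
  qed
  finally show ?thesis .
qed

lemma integral_exp_increment:
  assumes "0 \<le> s" "s < t"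
  shows "integrable M (\<lambda>\<omega>. exp (- (a * (B t \<omega> - B s \<omega>))))"
    and "(LINT \<omega>|M. exp (- (a * (B t \<omega> - B s \<omega>)))) = exp (a^2 * (t - s) / 2)"
proof -
  let ?n = "normal_density 0 (sqrt (t - s))"
  have Y: "(\<lambda>\<omega>. B t \<omega> - B s \<omega>) \<in> borel_measurable M" using assms by (intro borel_measurable_diff measurable_B) auto
  have eq: "?n x * exp (- (a * x)) = exp (a^2 * (t - s) / 2) * normal_density (- a * (t - s)) (sqrt (t - s)) x" for x
    using exp_times_normal_density[of "sqrt (t - s)" a x 0] assms by (simp add: mult.commute)
  have i: "integrable lborel (\<lambda>x. ?n x *\<^sub>R exp (- (a * x)))"
    using assms by (simp add: eq)
  have "integrable (distr M borel (\<lambda>\<omega>. B t \<omega> - B s \<omega>)) (\<lambda>x. exp (- (a * x)))"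
    unfolding distr_increment[OF assms] using i by (subst integrable_density) auto
  then show "integrable M (\<lambda>\<omega>. exp (- (a * (B t \<omega> - B s \<omega>))))"
    by (subst (asm) integrable_distr_eq) (use Y in auto)
  have "(LINT \<omega>|M. exp (- (a * (B t \<omega> - B s \<omega>)))) = (LINT x|distr M borel (\<lambda>\<omega>. B t \<omega> - B s \<omega>). exp (- (a * x)))"
    by (subst integral_distr) (use Y in auto)
  also have "\<dots> = (LINT x|lborel. ?n x *\<^sub>R exp (- (a * x)))"
    unfolding distr_increment[OF assms] by (subst integral_density) auto
  also have "\<dots> = exp (a^2 * (t - s) / 2)" using assms by (simp add: eq)
  finally show "(LINT \<omega>|M. exp (- (a * (B t \<omega> - B s \<omega>)))) = exp (a^2 * (t - s) / 2)" .
qed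

text \<open>The exponent \<open>a^2 / 2 - a * lam\<close> per unit time vanishes for
  \<open>a = 2 * lam\<close>, which gives the martingale for optional stopping, and equals
  \<open>- lam^2 / 2\<close> for \<open>a = lam\<close>, which gives decay in time. The exponential
  is unbounded, so independence enters through the product rule for expectations and not through the
  freezing formula.\<close>

lemma exp_X_step:
  assumes "0 \<le> s" "0 < d" and C: "C \<in> sets (past s)"
    and int: "integrable M (\<lambda>\<omega>. exp (- (a * X lam s \<omega>)))"
  shows "integrable M (\<lambda>\<omega>. indicator C \<omega> * exp (- (a * X lam (s + d) \<omega>)))"
    and "(LINT \<omega>|M. indicator C \<omega> * exp (- (a * X lam (s + d) \<omega>)))
      = exp (a^2 * d / 2 - a * lam * d) * (LINT \<omega>|M. indicator C \<omega> * exp (- (a * X lam s \<omega>)))"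
proof -
  let ?f = "\<lambda>\<omega>. indicator C \<omega> * exp (- (a * X lam s \<omega>)) :: real"
  let ?g = "\<lambda>\<omega>. exp (- (a * (B (s + d) \<omega> - B s \<omega>)))"
  have [measurable]: "X lam s \<in> borel_measurable (past s)" "C \<in> sets (past s)"
    using assms by (auto intro: measurable_X_past)
  have sd: "s < s + d" using assms by simp
  have ind: "indep_var borel ?f borel ?g"
    by (rule indep_var_past_increment[OF \<open>0 \<le> s\<close> sd]) measurable
  have if': "integrable M ?f"
    using integrable_mult_indicator[OF sets_past[OF C] int] by simp
  note ig = integral_exp_increment[OF \<open>0 \<le> s\<close> sd, of a]
  have eq: "indicator C \<omega> * exp (- (a * X lam (s + d) \<omega>)) = exp (- (a * lam * d)) * (?f \<omega> * ?g \<omega>)" for \<omega>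
  proof -
    have "exp (- (a * X lam (s + d) \<omega>)) = exp (- (a * lam * d)) * (exp (- (a * X lam s \<omega>)) * ?g \<omega>)"
      by (simp add: exp_add[symmetric] drifted_def algebra_simps)
    then show ?thesis by (simp add: mult_ac)
  qed
  show "integrable M (\<lambda>\<omega>. indicator C \<omega> * exp (- (a * X lam (s + d) \<omega>)))"
    unfolding eq using indep_var_integrable[OF ind if' ig(1)] by simp
  have "(LINT \<omega>|M. indicator C \<omega> * exp (- (a * X lam (s + d) \<omega>)))
     = exp (- (a * lam * d)) * ((LINT \<omega>|M. ?f \<omega>) * exp (a^2 * d / 2))"
    unfolding eq using indep_var_lebesgue_integral[OF ind if' ig(1)] ig(2) by simp
  also have "\<dots> = (exp (- (a * lam * d)) * exp (a^2 * d / 2)) * (LINT \<omega>|M. ?f \<omega>)" by simp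
  also have "exp (- (a * lam * d)) * exp (a^2 * d / 2) = exp (a^2 * d / 2 - a * lam * d)"
    by (simp add: exp_add[symmetric])
  finally show "(LINT \<omega>|M. indicator C \<omega> * exp (- (a * X lam (s + d) \<omega>)))
      = exp (a^2 * d / 2 - a * lam * d) * (LINT \<omega>|M. ?f \<omega>)" .
qed

lemma X_zero_AE: "AE \<omega> in M. X lam 0 \<omega> = 0"
  using start_zero by (auto simp: drifted_def)

lemma integrable_exp_X:
  assumes "0 \<le> s"
  shows "integrable M (\<lambda>\<omega>. exp (- (a * X lam s \<omega>)))"
    and "(LINT \<omega>|M. exp (- (a * X lam s \<omega>))) = exp ((a^2 / 2 - a * lam) * s)"
proof -
  have AE0: "AE \<omega> in M. 1 = exp (- (a * X lam 0 \<omega>))" using X_zero_AE[of lam] by eventually_elim simp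
  have m[measurable]: "X lam 0 \<in> borel_measurable M" by (rule measurable_X) simp
  have 0: "integrable M (\<lambda>\<omega>. exp (- (a * X lam 0 \<omega>)))" "(LINT \<omega>|M. exp (- (a * X lam 0 \<omega>))) = 1"
    using integrable_cong_AE[OF _ _ AE0] integral_cong_AE[OF _ _ AE0] by (simp_all add: prob_space)
  have sp: "space M \<in> sets (past 0)" by (metis sets.top space_completed_natural_filtration)
  have ind: "(LINT \<omega>|M. indicator (space M) \<omega> * f \<omega>) = (LINT \<omega>|M. f \<omega>)"
    "integrable M (\<lambda>\<omega>. indicator (space M) \<omega> * f \<omega>) = integrable M f" for f :: "'a \<Rightarrow> real"
    by (auto intro!: Bochner_Integration.integral_cong Bochner_Integration.integrable_cong)
  show "integrable M (\<lambda>\<omega>. exp (- (a * X lam s \<omega>)))"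
    using exp_X_step(1)[OF _ _ sp 0(1), of s] assms 0(1) by (cases "s = 0") (auto simp: ind)
  show "(LINT \<omega>|M. exp (- (a * X lam s \<omega>))) = exp ((a^2 / 2 - a * lam) * s)"
    using exp_X_step(2)[OF _ _ sp 0(1), of s] assms 0(2) by (cases "s = 0") (auto simp: ind algebra_simps)
qed

text \<open>Increments have a density, hence no atoms. Used both for fixed levels and for
  coincidences of \<open>X\<close> at two times.\<close>

lemma X_ne_AE:
  assumes "0 \<le> s" "s < t"
  shows "AE \<omega> in M. X lam t \<omega> \<noteq> X lam s \<omega> + c"
proof -
  have "AE x in density lborel (normal_density 0 (sqrt (t - s))). x \<noteq> c - lam * (t - s)"
    using AE_lborel_singleton[of "c - lam * (t - s)"] by (subst AE_density) auto
  then have "AE x in distr M borel (\<lambda>\<omega>. B t \<omega> - B s \<omega>). x \<noteq> c - lam * (t - s)"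
    unfolding distr_increment[OF assms] .
  then have "AE \<omega> in M. B t \<omega> - B s \<omega> \<noteq> c - lam * (t - s)"
    using assms by (subst (asm) AE_distr_iff) (auto intro!: borel_measurable_diff measurable_B)
  then show ?thesis by eventually_elim (auto simp: drifted_def algebra_simps)
qed

lemma X_ne_const_AE: "0 < t \<Longrightarrow> AE \<omega> in M. X lam t \<omega> \<noteq> c"
  using X_ne_AE[of 0 t lam c] X_zero_AE[of lam] by auto

end

section \<open>Hitting probabilities\<close>

context standard_brownian_motion
begin

lemma prob_le_0_null: "A \<in> events \<Longrightarrow> prob A \<le> 0 \<Longrightarrow> A \<in> null_sets M"
  using measure_nonneg[of M A] by (intro null_setsI) (auto simp: emeasure_eq_measure)

text \<open>The index \<open>j = 0\<close> counts: there are \<open>k + 1\<close> grid points, and a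
  start at or below \<open>c\<close> is already a hit.\<close>

definition above_grid :: "real \<Rightarrow> real \<Rightarrow> real \<Rightarrow> real \<Rightarrow> nat \<Rightarrow> 'a set" where
  "above_grid lam s d c k = {\<omega> \<in> space M. \<forall>j\<le>k. c < X lam (s + real j * d) \<omega>}"

lemma above_grid_past:
  assumes "0 \<le> s" "0 < d"
  shows "above_grid lam s d c k \<in> sets (past (s + real k * d))"
proof -
  have "above_grid lam s d c k = {\<omega> \<in> space (past (s + real k * d)). \<forall>j\<in>{..k}. c < X lam (s + real j * d) \<omega>}"
    by (auto simp: above_grid_def)
  also have "\<dots> \<in> sets (past (s + real k * d))"
  proof (rule sets.sets_Collect_finite_All)
    fix j assume "j \<in> {..k}"
    then have "X lam (s + real j * d) \<in> borel_measurable (past (s + real k * d))"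
      using assms by (intro measurable_X_past) (auto intro!: mult_right_mono)
    then show "{\<omega> \<in> space (past (s + real k * d)). c < X lam (s + real j * d) \<omega>} \<in> sets (past (s + real k * d))"
      by (rule borel_measurable_less[OF borel_measurable_const])
  qed simp
  finally show ?thesis .
qed

lemma above_grid_Suc: "above_grid lam s d c (Suc k) \<subseteq> above_grid lam s d c k"
  by (auto simp: above_grid_def)

lemma exp_martingale_step:
  assumes "0 \<le> s" "0 < d" "C \<in> sets (past s)"
  shows "(LINT \<omega>|M. indicator C \<omega> * exp (- (2 * lam * X lam (s + d) \<omega>)))
      = (LINT \<omega>|M. indicator C \<omega> * exp (- (2 * lam * X lam s \<omega>)))"
proof -
  have "(2 * lam)^2 * d / 2 - 2 * lam * lam * d = 0" by (simp add: power2_eq_square)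
  then show ?thesis
    using exp_X_step(2)[OF assms integrable_exp_X(1)[OF assms(1)], of "2 * lam" lam] by simp
qed

lemma integral_indicator_split:
  fixes f :: "'a \<Rightarrow> real"
  assumes "C \<in> sets M" "D \<in> sets M" "integrable M f"
  shows "(LINT \<omega>|M. indicator C \<omega> * f \<omega>)
    = (LINT \<omega>|M. indicator (C \<inter> D) \<omega> * f \<omega>) + (LINT \<omega>|M. indicator (C - D) \<omega> * f \<omega>)"
proof -
  have i: "integrable M (\<lambda>\<omega>. indicator E \<omega> * f \<omega>)" if "E \<in> sets M" for E
    using integrable_mult_indicator[OF that assms(3)] by simp
  have "(LINT \<omega>|M. indicator C \<omega> * f \<omega>)
    = (LINT \<omega>|M. indicator (C \<inter> D) \<omega> * f \<omega> + indicator (C - D) \<omega> * f \<omega>)"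
    by (intro Bochner_Integration.integral_cong) (auto simp: indicator_def)
  then show ?thesis
    using assms by (simp add: i)
qed

text \<open>At the first grid point at or below \<open>c\<close> the martingale
  \<open>exp (- 2 * lam * X)\<close> is at least \<open>exp (- 2 * lam * c)\<close>, since an
  overshoot only increases it. The induction carries the mass already stopped plus the mass still
  running; the latter is dropped at the end.\<close>

lemma prob_grid_hit_upper:
  assumes "0 < lam" "0 \<le> s" "0 < d" and A: "A \<in> sets (past s)"
  shows "prob (A - above_grid lam s d c k) \<le> exp (2 * lam * c) * (LINT \<omega>|M. indicator A \<omega> * exp (- (2 * lam * X lam s \<omega>)))"
proof -
  let ?S = "above_grid lam s d c"
  define N where "N j \<omega> = exp (- (2 * lam * X lam (s + real j * d) \<omega>))" for j \<omega>
  have sd: "0 \<le> s + real j * d" for j using assms by simp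
  have [measurable]: "A \<in> sets M" "?S j \<in> sets M" for j
    using sets_past[OF A] sets_past[OF above_grid_past] assms by auto
  have intN: "integrable M (N j)" for j
    unfolding N_def by (rule integrable_exp_X(1)[OF sd])
  \<comment> \<open>\<open>C\<close> has survived up to index \<open>j - 1\<close>, so leaving
    \<open>?S j\<close> means that index \<open>j\<close> itself is at or below \<open>c\<close>;
    for \<open>j = 0\<close> it is the only index.\<close>
  have step: "exp (- (2 * lam * c)) * prob (C - ?S j) \<le> (LINT \<omega>|M. indicator (C - ?S j) \<omega> * N j \<omega>)"
    if C: "C \<in> sets M" "j = 0 \<or> C \<subseteq> ?S (j - 1)" for C j
  proof -
    have "exp (- (2 * lam * c)) * prob (C - ?S j) = (LINT \<omega>|M. indicator (C - ?S j) \<omega> * exp (- (2 * lam * c)))"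
      using C by simp
    also have "\<dots> \<le> (LINT \<omega>|M. indicator (C - ?S j) \<omega> * N j \<omega>)"
    proof (rule integral_mono)
      show "integrable M (\<lambda>\<omega>. indicator (C - ?S j) \<omega> * N j \<omega>)"
        using integrable_mult_indicator[OF _ intN, of "C - ?S j" j] C by simp
      fix \<omega> assume "\<omega> \<in> space M"
      have "exp (- (2 * lam * c)) \<le> N j \<omega>" if w: "\<omega> \<in> C - ?S j"
      proof -
        obtain i where i: "i \<le> j" "X lam (s + real i * d) \<omega> \<le> c"
          using w \<open>\<omega> \<in> space M\<close> by (auto simp: above_grid_def not_less)
        have "i = j"
        proof (rule ccontr)
          assume "i \<noteq> j"
          then have "i \<le> j - 1" "j \<noteq> 0" using i by auto
          with C(2) w have "c < X lam (s + real i * d) \<omega>" by (auto simp: above_grid_def)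
          with i show False by simp
        qed
        then show ?thesis using i \<open>0 < lam\<close> by (simp add: N_def)
      qed
      then show "indicator (C - ?S j) \<omega> * exp (- (2 * lam * c)) \<le> indicator (C - ?S j) \<omega> * N j \<omega>"
        by (simp add: indicator_def)
    qed (use C in \<open>auto simp: less_top[symmetric] intro!: integrable_real_mult_indicator\<close>)
    finally show ?thesis .
  qed
  have "exp (- (2 * lam * c)) * prob (A - ?S k) + (LINT \<omega>|M. indicator (A \<inter> ?S k) \<omega> * N k \<omega>)
      \<le> (LINT \<omega>|M. indicator A \<omega> * N 0 \<omega>)"
  proof (induction k)
    case 0
    show ?case
      using step[of A 0] integral_indicator_split[OF _ _ intN, of A "?S 0" 0] by simp
  next
    case (Suc k)
    have "(LINT \<omega>|M. indicator (A \<inter> ?S k) \<omega> * N k \<omega>) = (LINT \<omega>|M. indicator (A \<inter> ?S k) \<omega> * N (Suc k) \<omega>)"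
    proof -
      have "A \<inter> ?S k \<in> sets (past (s + real k * d))"
        using A assms sets_completed_natural_filtration_mono[of s "s + real k * d" M B]
        by (intro sets.Int above_grid_past) auto
      from exp_martingale_step[OF sd \<open>0 < d\<close> this, of lam] show ?thesis
        by (simp add: N_def algebra_simps)
    qed
    also have "\<dots> = (LINT \<omega>|M. indicator (A \<inter> ?S (Suc k)) \<omega> * N (Suc k) \<omega>)
       + (LINT \<omega>|M. indicator (A \<inter> ?S k - ?S (Suc k)) \<omega> * N (Suc k) \<omega>)"
    proof -
      have "A \<inter> ?S k \<inter> ?S (Suc k) = A \<inter> ?S (Suc k)" using above_grid_Suc by blast
      then show ?thesis using integral_indicator_split[OF _ _ intN, of "A \<inter> ?S k" "?S (Suc k)" "Suc k"] by simp
    qed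
    also have "\<dots> \<ge> (LINT \<omega>|M. indicator (A \<inter> ?S (Suc k)) \<omega> * N (Suc k) \<omega>)
       + exp (- (2 * lam * c)) * prob (A \<inter> ?S k - ?S (Suc k))"
      using step[of "A \<inter> ?S k" "Suc k"] by simp
    finally have 1: "(LINT \<omega>|M. indicator (A \<inter> ?S (Suc k)) \<omega> * N (Suc k) \<omega>)
       + exp (- (2 * lam * c)) * prob (A \<inter> ?S k - ?S (Suc k)) \<le> (LINT \<omega>|M. indicator (A \<inter> ?S k) \<omega> * N k \<omega>)" .
    have "A - ?S (Suc k) = (A - ?S k) \<union> (A \<inter> ?S k - ?S (Suc k))"
      using above_grid_Suc[of lam s d c k] by blast
    then have "prob (A - ?S (Suc k)) = prob (A - ?S k) + prob (A \<inter> ?S k - ?S (Suc k))"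
      using finite_measure_Union[of "A - ?S k" "A \<inter> ?S k - ?S (Suc k)"] by auto
    with 1 Suc show ?case by (simp add: distrib_left)
  qed
  moreover have "0 \<le> (LINT \<omega>|M. indicator (A \<inter> ?S k) \<omega> * N k \<omega>)"
    by (rule Bochner_Integration.integral_nonneg) (simp add: N_def)
  ultimately have "exp (- (2 * lam * c)) * prob (A - ?S k) \<le> (LINT \<omega>|M. indicator A \<omega> * N 0 \<omega>)" by simp
  then have "exp (2 * lam * c) * (exp (- (2 * lam * c)) * prob (A - ?S k)) \<le> exp (2 * lam * c) * (LINT \<omega>|M. indicator A \<omega> * N 0 \<omega>)"
    by (intro mult_left_mono) auto
  then show ?thesis by (simp add: mult.assoc[symmetric] exp_add[symmetric] N_def)
qed

text \<open>The overshoot below the level \<open>c\<close> exceeds \<open>e\<close> only if a single grid increment does; the last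
  summand pays for this with an exponential Chebyshev bound of parameter \<open>p\<close>.\<close>

lemma prob_grid_hit_lower:
  assumes "0 < lam" "0 \<le> s" "0 < d" "0 < e" "0 < p" and A: "A \<in> sets (past s)"
    and above: "\<And>\<omega>. \<omega> \<in> A \<Longrightarrow> c < X lam s \<omega>"
  shows "(LINT \<omega>|M. indicator A \<omega> * exp (- (2 * lam * X lam s \<omega>)))
    \<le> exp (- (lam * c)) * exp (- (lam^2 * (s + real k * d) / 2))
      + exp (- (2 * lam * c)) * (exp (2 * lam * e) * prob (A - above_grid lam s d c k)
         + real k * (exp (- (p * e)) * exp ((2 * lam + p) * p * d / 2)))"
proof -
  let ?S = "above_grid lam s d c"
  let ?L = "exp (- (2 * lam * c))"
  let ?\<eta> = "exp (- (p * e)) * exp ((2 * lam + p) * p * d / 2)"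
  define N where "N j \<omega> = exp (- (2 * lam * X lam (s + real j * d) \<omega>))" for j \<omega>
  have sd: "0 \<le> s + real j * d" for j using assms by simp
  have [measurable]: "A \<in> sets M" "?S j \<in> sets M" for j
    using sets_past[OF A] sets_past[OF above_grid_past] assms by auto
  have intN: "integrable M (N j)" for j
    unfolding N_def by (rule integrable_exp_X(1)[OF sd])
  have NL: "N j \<omega> \<le> ?L" if "\<omega> \<in> ?S j" for j \<omega>
    using that \<open>0 < lam\<close> by (auto simp: above_grid_def N_def less_imp_le)
  \<comment> \<open>Initial mass is bounded by the running mass, the stopped mass with overshoot at
    most \<open>e\<close>, and one error \<open>?\<eta>\<close> per step.\<close>
  have "(LINT \<omega>|M. indicator A \<omega> * N 0 \<omega>)
      \<le> (LINT \<omega>|M. indicator (A \<inter> ?S k) \<omega> * N k \<omega>) + ?L * (exp (2 * lam * e) * prob (A - ?S k) + real k * ?\<eta>)"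
  proof (induction k)
    case 0
    have "A \<inter> ?S 0 = A" using sets.sets_into_space[OF \<open>A \<in> sets M\<close>] above by (auto simp: above_grid_def)
    then show ?case by simp
  next
    case (Suc k)
    let ?D = "A \<inter> ?S k - ?S (Suc k)" and ?r = "s + real k * d"
    let ?I = "\<lambda>\<omega>. exp (- ((2 * lam + p) * (B (?r + d) \<omega> - B ?r \<omega>)))"
    have eq1: "(LINT \<omega>|M. indicator (A \<inter> ?S k) \<omega> * N k \<omega>) = (LINT \<omega>|M. indicator (A \<inter> ?S k) \<omega> * N (Suc k) \<omega>)"
    proof -
      have "A \<inter> ?S k \<in> sets (past (s + real k * d))"
        using A assms sets_completed_natural_filtration_mono[of s "s + real k * d" M B]
        by (intro sets.Int above_grid_past) auto
      from exp_martingale_step[OF sd \<open>0 < d\<close> this, of lam] show ?thesis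
        by (simp add: N_def algebra_simps)
    qed
    have eq2: "\<dots> = (LINT \<omega>|M. indicator (A \<inter> ?S (Suc k)) \<omega> * N (Suc k) \<omega>)
       + (LINT \<omega>|M. indicator ?D \<omega> * N (Suc k) \<omega>)"
    proof -
      have "A \<inter> ?S k \<inter> ?S (Suc k) = A \<inter> ?S (Suc k)" using above_grid_Suc by blast
      then show ?thesis using integral_indicator_split[OF _ _ intN, of "A \<inter> ?S k" "?S (Suc k)" "Suc k"] by simp
    qed
    have rd: "?r < ?r + d" using \<open>0 < d\<close> by simp
    note I = integral_exp_increment[OF sd rd, of "2 * lam + p"]
    \<comment> \<open>Normalised so that \<open>?q * ?I\<close> equals
      \<open>exp (- (p * (\<delta> + e))) * exp (- (2 * lam * \<delta>))\<close> for the increment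
      \<open>\<delta>\<close> of \<open>X\<close>; this exceeds the martingale ratio as soon as
      \<open>\<delta>\<close> falls below \<open>- e\<close>.\<close>
    let ?q = "exp (- (p * e)) * exp (- ((2 * lam + p) * lam * d))"
    have "(LINT \<omega>|M. indicator ?D \<omega> * N (Suc k) \<omega>)
      \<le> (LINT \<omega>|M. ?L * exp (2 * lam * e) * indicator ?D \<omega> + ?L * ?q * ?I \<omega>)"
    proof (rule integral_mono)
      show "integrable M (\<lambda>\<omega>. indicator ?D \<omega> * N (Suc k) \<omega>)"
        using integrable_mult_indicator[OF _ intN, of ?D "Suc k"] by simp
      show "integrable M (\<lambda>\<omega>. ?L * exp (2 * lam * e) * indicator ?D \<omega> + ?L * ?q * ?I \<omega>)"
        using I(1) by (intro Bochner_Integration.integrable_add integrable_mult_right) (auto simp: less_top[symmetric])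
      fix \<omega> assume "\<omega> \<in> space M"
      show "indicator ?D \<omega> * N (Suc k) \<omega> \<le> ?L * exp (2 * lam * e) * indicator ?D \<omega> + ?L * ?q * ?I \<omega>"
      proof (cases "\<omega> \<in> ?D")
        case True
        define \<delta> where "\<delta> = X lam (?r + d) \<omega> - X lam ?r \<omega>"
        have "N (Suc k) \<omega> = N k \<omega> * exp (- (2 * lam * \<delta>))"
          by (simp add: N_def \<delta>_def exp_add[symmetric] algebra_simps)
        also have "\<dots> \<le> ?L * exp (- (2 * lam * \<delta>))"
          using True by (intro mult_right_mono NL) auto
        also have "\<dots> \<le> ?L * (exp (2 * lam * e) + ?q * ?I \<omega>)"
        proof (intro mult_left_mono)
          have qI: "?q * ?I \<omega> = exp (- (p * (\<delta> + e))) * exp (- (2 * lam * \<delta>))"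
            by (simp add: exp_add[symmetric] \<delta>_def drifted_def algebra_simps)
          show "exp (- (2 * lam * \<delta>)) \<le> exp (2 * lam * e) + ?q * ?I \<omega>"
          proof (cases "- e \<le> \<delta>")
            case True
            then have "lam * (- e) \<le> lam * \<delta>" using \<open>0 < lam\<close> by (intro mult_left_mono) auto
            then have "exp (- (2 * lam * \<delta>)) \<le> exp (2 * lam * e)" by (simp add: algebra_simps)
            then show ?thesis by (simp add: add_increasing2)
          next
            case False
            then have "p * (\<delta> + e) \<le> 0" using \<open>0 < p\<close> by (intro mult_nonneg_nonpos) auto
            then have "1 * exp (- (2 * lam * \<delta>)) \<le> exp (- (p * (\<delta> + e))) * exp (- (2 * lam * \<delta>))"
              by (intro mult_right_mono) auto
            then show ?thesis unfolding qI by (simp add: add_increasing)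
          qed
        qed simp
        finally show ?thesis using True by (simp add: algebra_simps)
      qed simp
    qed
    also have "\<dots> = ?L * exp (2 * lam * e) * prob ?D + ?L * ?q * exp ((2 * lam + p)^2 * d / 2)"
      using I by (subst Bochner_Integration.integral_add) (auto simp: less_top[symmetric])
    also have "?L * ?q * exp ((2 * lam + p)^2 * d / 2) = ?L * ?\<eta>"
      by (simp add: exp_add[symmetric] power2_eq_square field_simps)
    finally have eq3: "(LINT \<omega>|M. indicator ?D \<omega> * N (Suc k) \<omega>) \<le> ?L * exp (2 * lam * e) * prob ?D + ?L * ?\<eta>" .
    have "A - ?S (Suc k) = (A - ?S k) \<union> ?D"
      using above_grid_Suc[of lam s d c k] by blast
    then have "prob (A - ?S (Suc k)) = prob (A - ?S k) + prob ?D"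
      using finite_measure_Union[of "A - ?S k" ?D] by auto
    with Suc eq1 eq2 eq3 show ?case by (simp add: algebra_simps)
  qed
  \<comment> \<open>Half of the exponent is spent on paths still above \<open>c\<close>: there
    \<open>exp (- 2 * lam * X)\<close> is at most \<open>exp (- lam * c) * exp (- lam * X)\<close>,
    whose mean decays in time.\<close>
  moreover have "(LINT \<omega>|M. indicator (A \<inter> ?S k) \<omega> * N k \<omega>)
      \<le> (LINT \<omega>|M. exp (- (lam * c)) * exp (- (lam * X lam (s + real k * d) \<omega>)))"
  proof (rule integral_mono)
    show "integrable M (\<lambda>\<omega>. indicator (A \<inter> ?S k) \<omega> * N k \<omega>)"
      using integrable_mult_indicator[OF _ intN, of "A \<inter> ?S k" k] by simp
    show "integrable M (\<lambda>\<omega>. exp (- (lam * c)) * exp (- (lam * X lam (s + real k * d) \<omega>)))"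
      by (intro integrable_mult_right integrable_exp_X(1) sd)
    fix \<omega>
    show "indicator (A \<inter> ?S k) \<omega> * N k \<omega> \<le> exp (- (lam * c)) * exp (- (lam * X lam (s + real k * d) \<omega>))"
    proof (cases "\<omega> \<in> A \<inter> ?S k")
      case True
      then have "c < X lam (s + real k * d) \<omega>" by (auto simp: above_grid_def)
      then have "lam * c \<le> lam * X lam (s + real k * d) \<omega>" using \<open>0 < lam\<close> by simp
      then show ?thesis using True by (simp add: N_def exp_add[symmetric])
    qed simp
  qed
  moreover have "(LINT \<omega>|M. exp (- (lam * c)) * exp (- (lam * X lam (s + real k * d) \<omega>)))
      = exp (- (lam * c)) * exp (- (lam^2 * (s + real k * d) / 2))"
    using integrable_exp_X(2)[OF sd, of lam lam k] by (simp add: power2_eq_square algebra_simps)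
  ultimately show ?thesis by (simp add: N_def)
qed

text \<open>Mesh \<open>4^-m\<close> and horizon \<open>2^m\<close>, that is \<open>8^m\<close>
  steps: the nested grids become finer and longer at once, at rates for which the overshoot error
  vanishes.\<close>

definition grid_hit :: "real \<Rightarrow> real \<Rightarrow> real \<Rightarrow> 'a set" where
  "grid_hit lam s c = (\<Union>m. space M - above_grid lam s (1 / 4 ^ m) c (8 ^ m))"

lemma grid_hit_events [measurable]: "0 \<le> s \<Longrightarrow> grid_hit lam s c \<in> sets M"
  unfolding grid_hit_def using sets_past[OF above_grid_past] by auto

lemma grid_hit_iff: "\<omega> \<in> grid_hit lam s c \<longleftrightarrow>
    \<omega> \<in> space M \<and> (\<exists>m j. j \<le> 8 ^ m \<and> X lam (s + real j / 4 ^ m) \<omega> \<le> c)"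
  by (auto simp: grid_hit_def above_grid_def not_less)

lemma incseq_grid_hit: "incseq (\<lambda>m. A - above_grid lam s (1 / 4 ^ m) c (8 ^ m))"
proof (rule incseq_SucI)
  fix m :: nat
  have "above_grid lam s (1 / 4 ^ Suc m) c (8 ^ Suc m) \<subseteq> above_grid lam s (1 / 4 ^ m) c (8 ^ m)"
  proof
    fix \<omega> assume w: "\<omega> \<in> above_grid lam s (1 / 4 ^ Suc m) c (8 ^ Suc m)"
    have "c < X lam (s + real j * (1 / 4 ^ m)) \<omega>" if "j \<le> 8 ^ m" for j
    proof -
      \<comment> \<open>Point \<open>j\<close> of one grid is point \<open>4 * j\<close> of the
        next, whose range has grown by the factor 8.\<close>
      have "4 * j \<le> 8 ^ Suc m" using that by simp
      with w have "c < X lam (s + real (4 * j) * (1 / 4 ^ Suc m)) \<omega>"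
        unfolding above_grid_def mem_Collect_eq by blast
      then show ?thesis by simp
    qed
    with w show "\<omega> \<in> above_grid lam s (1 / 4 ^ m) c (8 ^ m)" by (auto simp: above_grid_def)
  qed
  then show "A - above_grid lam s (1 / 4 ^ m) c (8 ^ m) \<subseteq> A - above_grid lam s (1 / 4 ^ Suc m) c (8 ^ Suc m)"
    by blast
qed

lemma prob_grid_hit_limit:
  assumes "0 \<le> s" "A \<in> sets M"
  shows "(\<lambda>m. prob (A - above_grid lam s (1 / 4 ^ m) c (8 ^ m))) \<longlonglongrightarrow> prob (A \<inter> grid_hit lam s c)"
proof -
  have "(\<lambda>m. prob (A - above_grid lam s (1 / 4 ^ m) c (8 ^ m)))
     \<longlonglongrightarrow> prob (\<Union>m. A - above_grid lam s (1 / 4 ^ m) c (8 ^ m))"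
    using assms sets_past[OF above_grid_past]
    by (intro finite_Lim_measure_incseq incseq_grid_hit) auto
  also have "(\<Union>m. A - above_grid lam s (1 / 4 ^ m) c (8 ^ m)) = A \<inter> grid_hit lam s c"
    using sets.sets_into_space[OF assms(2)] by (auto simp: grid_hit_def)
  finally show ?thesis .
qed

text \<open>The upper grid bound passes to the limit directly; in the lower one the overshoot, the
  error of large increments and the mass that never stops all vanish.\<close>

lemma prob_grid_hit_above:
  assumes "0 < lam" "0 \<le> s" and A: "A \<in> sets (past s)" and above: "\<And>\<omega>. \<omega> \<in> A \<Longrightarrow> c < X lam s \<omega>"
  shows "prob (A \<inter> grid_hit lam s c) = (LINT \<omega>|M. indicator A \<omega> * hit_prob lam c (X lam s \<omega>))"
proof -
  let ?p = "prob (A \<inter> grid_hit lam s c)"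
  let ?I = "LINT \<omega>|M. indicator A \<omega> * exp (- (2 * lam * X lam s \<omega>))"
  let ?L = "exp (- (2 * lam * c))"
  note AM = sets_past[OF A]
  have up: "?p \<le> exp (2 * lam * c) * ?I"
    using prob_grid_hit_upper[OF assms(1,2) _ A]
    by (intro LIMSEQ_le_const2[OF prob_grid_hit_limit[OF assms(2) AM]]) auto
  have lo: "?I \<le> ?L * ?p"
  proof (rule LIMSEQ_le_const)
    \<comment> \<open>Here \<open>x = 2^m\<close>, so the mesh is \<open>1 / x^2\<close> and there
      are \<open>x^3\<close> steps. The free parameters are the overshoot
      \<open>e = 1 / sqrt x\<close> and the Chebyshev parameter \<open>p = x\<close>: then
      \<open>exp (- (p * e))\<close> is \<open>exp (- sqrt x)\<close> and beats \<open>x^3\<close>,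
      while \<open>(2 * lam + p) * p * d\<close> stays bounded.\<close>
    let ?f = "\<lambda>x::real. exp (- (lam * c)) * exp (- (lam^2 * (s + x) / 2))
        + ?L * (exp (2 * lam * (1 / sqrt x)) * ?p + x^3 * (exp (- (x * (1 / sqrt x))) * exp ((2 * lam + x) * x * (1 / x^2) / 2)))"
    have "(?f \<longlongrightarrow> ?L * ?p) at_top"
    proof -
      have "((\<lambda>x::real. exp (- (lam^2 * (s + x) / 2))) \<longlongrightarrow> 0) at_top"
        using \<open>0 < lam\<close> by real_asymp
      moreover have "((\<lambda>x::real. exp (2 * lam * (1 / sqrt x))) \<longlongrightarrow> 1) at_top"
        by real_asymp
      moreover have "((\<lambda>x::real. x^3 * (exp (- (x * (1 / sqrt x))) * exp ((2 * lam + x) * x * (1 / x^2) / 2))) \<longlongrightarrow> 0) at_top"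
        by real_asymp
      ultimately have "(?f \<longlongrightarrow> exp (- (lam * c)) * 0 + ?L * (1 * ?p + 0)) at_top"
        by (intro tendsto_intros)
      then show ?thesis by simp
    qed
    moreover have "filterlim (\<lambda>m::nat. 2 ^ m :: real) at_top sequentially"
      by real_asymp
    ultimately show "(\<lambda>m. ?f (2 ^ m)) \<longlonglongrightarrow> ?L * ?p"
      by (rule filterlim_compose)
    have "?I \<le> ?f (2 ^ m)" for m :: nat
    proof -
      have e: "(2::real) ^ m * 2 ^ m = 4 ^ m" "(2::real) ^ m * (2 ^ m * 2 ^ m) = 8 ^ m"
        by (simp_all flip: power_mult_distrib)
      have sq: "((2::real) ^ m)^2 = 4 ^ m" "((2::real) ^ m)^3 = 8 ^ m" "(8::real) ^ m * (1 / 4 ^ m) = 2 ^ m"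
        using e by (simp_all add: power2_eq_square power3_eq_cube field_simps flip: e)
      have "?I \<le> exp (- (lam * c)) * exp (- (lam^2 * (s + real (8 ^ m) * (1 / 4 ^ m)) / 2))
        + ?L * (exp (2 * lam * (1 / sqrt (2 ^ m))) * prob (A - above_grid lam s (1 / 4 ^ m) c (8 ^ m))
         + real (8 ^ m) * (exp (- (2 ^ m * (1 / sqrt (2 ^ m)))) * exp ((2 * lam + 2 ^ m) * 2 ^ m * (1 / 4 ^ m) / 2)))"
        by (rule prob_grid_hit_lower[OF assms(1,2) _ _ _ A above]) auto
      also have "\<dots> = exp (- (lam * c)) * exp (- (lam^2 * (s + 2 ^ m) / 2))
        + ?L * (exp (2 * lam * (1 / sqrt (2 ^ m))) * prob (A - above_grid lam s (1 / 4 ^ m) c (8 ^ m))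
         + (2 ^ m)^3 * (exp (- (2 ^ m * (1 / sqrt (2 ^ m)))) * exp ((2 * lam + 2 ^ m) * 2 ^ m * (1 / (2 ^ m)^2) / 2)))"
        unfolding sq by (simp only: of_nat_power of_nat_numeral sq)
      also have "\<dots> \<le> ?f (2 ^ m)"
      proof (intro add_mono order_refl mult_left_mono)
        show "prob (A - above_grid lam s (1 / 4 ^ m) c (8 ^ m)) \<le> ?p"
          using sets.sets_into_space[OF AM]
          by (intro finite_measure_mono sets.Int AM grid_hit_events \<open>0 \<le> s\<close>) (auto simp: grid_hit_def)
      qed auto
      finally show ?thesis .
    qed
    then show "\<exists>N. \<forall>n\<ge>N. ?I \<le> ?f (2 ^ n)" by blast
  qed
  have "exp (2 * lam * c) * ?I \<le> exp (2 * lam * c) * (?L * ?p)" using lo by (intro mult_left_mono) auto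
  then have "?p = exp (2 * lam * c) * ?I"
    using up by (simp add: mult.assoc[symmetric] exp_add[symmetric])
  also have "\<dots> = (LINT \<omega>|M. exp (2 * lam * c) * (indicator A \<omega> * exp (- (2 * lam * X lam s \<omega>))))" by simp
  also have "\<dots> = (LINT \<omega>|M. indicator A \<omega> * hit_prob lam c (X lam s \<omega>))"
  proof (rule Bochner_Integration.integral_cong[OF refl])
    fix \<omega>
    show "exp (2 * lam * c) * (indicator A \<omega> * exp (- (2 * lam * X lam s \<omega>))) = indicator A \<omega> * hit_prob lam c (X lam s \<omega>)"
    proof (cases "\<omega> \<in> A")
      case True
      from above[OF True] show ?thesis using True
        by (simp add: hit_prob_above exp_add[symmetric] algebra_simps)
    qed simp
  qed
  finally show ?thesis .
qed

lemma integrable_indicator_bounded: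
  fixes f :: "real \<Rightarrow> real"
  assumes "0 \<le> s" "A \<in> sets M" "f \<in> borel_measurable borel" "\<And>x. \<bar>f x\<bar> \<le> K"
  shows "integrable M (\<lambda>\<omega>. indicator A \<omega> * f (X lam s \<omega>))"
proof -
  have "integrable M (\<lambda>\<omega>. f (X lam s \<omega>))"
    using assms by (intro integrable_const_bound[where B=K] measurable_compose[OF measurable_X assms(3)]) auto
  from integrable_mult_indicator[OF assms(2) this] show ?thesis by simp
qed

lemma abs_hit_prob_le: "0 < lam \<Longrightarrow> \<bar>hit_prob lam z x\<bar> \<le> 1"
  using hit_prob_le_1[of lam z x] hit_prob_pos[of lam z x] by simp

text \<open>Where \<open>X lam s\<close> is at or below \<open>c\<close>, the grid is hit at
  \<open>j = 0\<close> and \<open>hit_prob\<close> is 1; the rest is the case of a start above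
  \<open>c\<close>.\<close>

lemma prob_grid_hit:
  assumes "0 < lam" "0 \<le> s" and A: "A \<in> sets (past s)"
  shows "prob (A \<inter> grid_hit lam s c) = (LINT \<omega>|M. indicator A \<omega> * hit_prob lam c (X lam s \<omega>))"
proof -
  define C where "C = {\<omega> \<in> space M. c < X lam s \<omega>}"
  have "{\<omega> \<in> space (past s). c < X lam s \<omega>} \<in> sets (past s)"
    by (rule borel_measurable_less[OF borel_measurable_const measurable_X_past]) (use assms in auto)
  then have C: "C \<in> sets (past s)" by (simp add: C_def)
  have M: "A \<in> sets M" "C \<in> sets M" "grid_hit lam s c \<in> sets M"
    using sets_past[OF A] sets_past[OF C] assms by auto
  have "A - C \<subseteq> grid_hit lam s c"
  proof
    fix \<omega> assume w: "\<omega> \<in> A - C"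
    then have "\<omega> \<in> space M" using sets.sets_into_space[OF M(1)] by auto
    with w show "\<omega> \<in> grid_hit lam s c"
      unfolding grid_hit_iff C_def by (auto intro!: exI[of _ "0::nat"])
  qed
  then have "(A - C) \<inter> grid_hit lam s c = A - C" by blast
  moreover have "prob (A \<inter> grid_hit lam s c) = prob ((A \<inter> C) \<inter> grid_hit lam s c) + prob ((A - C) \<inter> grid_hit lam s c)"
    using M by (subst finite_measure_Union[symmetric]) (auto intro!: arg_cong[where f=prob])
  ultimately have "prob (A \<inter> grid_hit lam s c) = prob ((A \<inter> C) \<inter> grid_hit lam s c) + prob (A - C)"
    by simp
  also have "prob ((A \<inter> C) \<inter> grid_hit lam s c) = (LINT \<omega>|M. indicator (A \<inter> C) \<omega> * hit_prob lam c (X lam s \<omega>))"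
    by (rule prob_grid_hit_above[OF assms(1,2)]) (use A C in \<open>auto simp: C_def\<close>)
  also have "prob (A - C) = (LINT \<omega>|M. indicator (A - C) \<omega>)" using M by simp
  also have "\<dots> = (LINT \<omega>|M. indicator (A - C) \<omega> * hit_prob lam c (X lam s \<omega>))"
  proof (rule Bochner_Integration.integral_cong[OF refl])
    fix \<omega> assume "\<omega> \<in> space M"
    then show "indicator (A - C) \<omega> = indicator (A - C) \<omega> * hit_prob lam c (X lam s \<omega>)"
      by (cases "\<omega> \<in> A - C") (auto simp: C_def hit_prob_below)
  qed
  also have "(LINT \<omega>|M. indicator (A \<inter> C) \<omega> * hit_prob lam c (X lam s \<omega>)) + \<dots>
      = (LINT \<omega>|M. indicator A \<omega> * hit_prob lam c (X lam s \<omega>))"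
    using integrable_indicator_bounded[OF \<open>0 \<le> s\<close> sets.top borel_measurable_hit_prob abs_hit_prob_le[OF \<open>0 < lam\<close>]]
    by (intro integral_indicator_split[symmetric] M)
       (simp cong: Bochner_Integration.integrable_cong)
  finally show ?thesis .
qed

text \<open>Raising the level by \<open>e\<close> lowers \<open>\<alpha>_fun\<close> by at most
  \<open>2 * e\<close>. The additive form is uniform in \<open>x\<close>, so it survives
  integration.\<close>

lemma hit_prob_shift_le:
  assumes "0 < lam" "0 \<le> e"
  shows "hit_prob lam (c + e) x \<le> hit_prob lam c x + (exp (2 * lam * e) - 1)"
proof -
  have "hit_prob lam (c + e) x \<le> exp (2 * lam * e) * hit_prob lam c x"
  proof -
    have "- (lam * \<alpha>_fun (c + e) x) \<le> 2 * lam * e + - (lam * \<alpha>_fun c x)"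
    proof -
      have "\<alpha>_fun c x \<le> 2 * e + \<alpha>_fun (c + e) x" using assms by (simp add: \<alpha>_fun_def)
      then have "lam * \<alpha>_fun c x \<le> lam * (2 * e + \<alpha>_fun (c + e) x)" using assms by (intro mult_left_mono) auto
      then show ?thesis by (simp add: algebra_simps)
    qed
    then show ?thesis by (simp add: hit_prob_def exp_add[symmetric])
  qed
  also have "\<dots> = hit_prob lam c x + (exp (2 * lam * e) - 1) * hit_prob lam c x" by (simp add: algebra_simps)
  also have "(exp (2 * lam * e) - 1) * hit_prob lam c x \<le> (exp (2 * lam * e) - 1) * 1"
    using assms by (intro mult_left_mono hit_prob_le_1) auto
  finally show ?thesis by simp
qed

lemma grid_hit_mono: "c \<le> c' \<Longrightarrow> grid_hit lam s c \<subseteq> grid_hit lam s c'"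
  by (auto simp: grid_hit_iff) (meson order_trans)

text \<open>A path that touches \<open>c\<close> between grid points is detected only at levels
  above \<open>c\<close>. The gap between hitting all those levels on the grid and hitting
  \<open>c\<close> itself is null, because hitting probabilities are continuous in the
  level.\<close>

lemma AE_grid_hit_closed:
  assumes "0 < lam" "0 \<le> s"
  shows "AE \<omega> in M. (\<forall>n. \<omega> \<in> grid_hit lam s (c + 1 / real (Suc n))) \<longrightarrow> \<omega> \<in> grid_hit lam s c"
proof -
  let ?D = "(\<Inter>n. grid_hit lam s (c + 1 / real (Suc n))) - grid_hit lam s c"
  have D: "?D \<in> sets M" using assms by (intro sets.Diff sets.countable_INT) auto
  have sp: "space M \<in> sets (past s)" by (metis sets.top space_completed_natural_filtration)
  have le: "prob ?D \<le> exp (2 * lam * (1 / real (Suc n))) - 1" for n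
  proof -
    let ?c = "c + 1 / real (Suc n)"
    have P: "prob (grid_hit lam s b) = (LINT \<omega>|M. hit_prob lam b (X lam s \<omega>))" for b
    proof -
      have "space M \<inter> grid_hit lam s b = grid_hit lam s b" using grid_hit_iff by blast
      then have "prob (grid_hit lam s b) = (LINT \<omega>|M. indicator (space M) \<omega> * hit_prob lam b (X lam s \<omega>))"
        using prob_grid_hit[OF assms sp, of b] by simp
      then show ?thesis by (simp cong: Bochner_Integration.integral_cong)
    qed
    have int: "integrable M (\<lambda>\<omega>. hit_prob lam b (X lam s \<omega>))" for b
      using integrable_indicator_bounded[OF \<open>0 \<le> s\<close> sets.top borel_measurable_hit_prob abs_hit_prob_le[OF \<open>0 < lam\<close>]]
      by (simp cong: Bochner_Integration.integrable_cong)
    have "prob ?D \<le> prob (grid_hit lam s ?c - grid_hit lam s c)"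
      using assms by (intro finite_measure_mono) auto
    also have "\<dots> = prob (grid_hit lam s ?c) - prob (grid_hit lam s c)"
      using assms by (intro finite_measure_Diff grid_hit_mono) auto
    also have "\<dots> \<le> (LINT \<omega>|M. hit_prob lam c (X lam s \<omega>) + (exp (2 * lam * (1 / real (Suc n))) - 1)) - (LINT \<omega>|M. hit_prob lam c (X lam s \<omega>))"
      unfolding P using assms by (intro diff_right_mono integral_mono int hit_prob_shift_le Bochner_Integration.integrable_add) auto
    also have "\<dots> = exp (2 * lam * (1 / real (Suc n))) - 1"
      using int by (simp add: prob_space)
    finally show ?thesis .
  qed
  have "(\<lambda>n. exp (2 * lam * (1 / real (Suc n))) - 1) \<longlonglongrightarrow> 0" by real_asymp
  then have "prob ?D \<le> 0" by (rule LIMSEQ_le_const) (use le in blast)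
  then have "?D \<in> null_sets M"
    using D by (rule prob_le_0_null[rotated])
  then show ?thesis by (rule AE_I') (use sets.sets_into_space in auto)
qed

lemma X_continuous_AE: "AE \<omega> in M. continuous_on {0..} (\<lambda>t. X lam t \<omega>)"
  using continuous_paths by eventually_elim (auto simp: drifted_def intro!: continuous_intros)

lemma AE_grid_hit_iff:
  assumes "0 < lam" "0 \<le> s"
  shows "AE \<omega> in M. \<omega> \<in> grid_hit lam s c \<longleftrightarrow> (\<exists>u\<ge>s. X lam u \<omega> \<le> c)"
  using AE_grid_hit_closed[OF assms, of c] X_continuous_AE[of lam] AE_space
proof eventually_elim
  case (elim \<omega>)
  show ?case
  proof
    assume "\<omega> \<in> grid_hit lam s c"
    then obtain m j where "X lam (s + real j / 4 ^ m) \<omega> \<le> c" unfolding grid_hit_iff by auto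
    then show "\<exists>u\<ge>s. X lam u \<omega> \<le> c" by (intro exI[of _ "s + real j / 4 ^ m"]) auto
  next
    assume "\<exists>u\<ge>s. X lam u \<omega> \<le> c"
    then obtain u where u: "s \<le> u" "X lam u \<omega> \<le> c" by blast
    have "\<omega> \<in> grid_hit lam s (c + e)" if "0 < e" for e
    proof -
      have "continuous (at u within {0..}) (\<lambda>t. X lam t \<omega>)"
        using elim(2) u assms by (auto simp: continuous_on_eq_continuous_within)
      then obtain d where d: "0 < d" "\<And>t. 0 \<le> t \<Longrightarrow> dist t u < d \<Longrightarrow> dist (X lam t \<omega>) (X lam u \<omega>) < e"
        unfolding continuous_within_eps_delta using \<open>0 < e\<close> by fastforce
      have "\<forall>\<^sub>F m in sequentially. 1 / 4 ^ m < d \<and> u - s + 1 \<le> 2 ^ m"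
      proof (rule eventually_conj)
        have "(\<lambda>m. 1 / 4 ^ m :: real) \<longlonglongrightarrow> 0" by real_asymp
        then show "\<forall>\<^sub>F m in sequentially. 1 / 4 ^ m < d" using d(1) by (rule order_tendstoD)
        have "filterlim (\<lambda>m::nat. 2 ^ m :: real) at_top sequentially" by real_asymp
        then show "\<forall>\<^sub>F m in sequentially. u - s + 1 \<le> 2 ^ m" by (auto simp: filterlim_at_top)
      qed
      then obtain m :: nat where m: "1 / 4 ^ m < d" "u - s + 1 \<le> 2 ^ m"
        by (auto simp: eventually_sequentially)
      \<comment> \<open>The mesh is below the radius of continuity, and the extra \<open>1\<close>
        demanded of the horizon \<open>2^m\<close> absorbs the rounding up, so \<open>j\<close>
        stays within \<open>8^m\<close>.\<close>
      define j where "j = nat \<lceil>(u - s) * 4 ^ m\<rceil>"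
      have j: "(u - s) * 4 ^ m \<le> real j" "real j < (u - s) * 4 ^ m + 1"
        using u(1) by (auto simp: j_def) linarith
      have e48: "(2::real) ^ m * 4 ^ m = 8 ^ m" by (simp flip: power_mult_distrib)
      have "real j \<le> (u - s + 1) * 4 ^ m"
      proof -
        have "1 \<le> (4::real) ^ m" by simp
        with j(2) show ?thesis unfolding distrib_right by linarith
      qed
      also have "\<dots> \<le> 2 ^ m * 4 ^ m" using m(2) by (intro mult_right_mono) auto
      finally have "real j \<le> real (8 ^ m)" unfolding e48 by simp
      then have j8: "j \<le> 8 ^ m" by (simp only: of_nat_le_iff)
      have "u - s \<le> real j / 4 ^ m" "real j / 4 ^ m < (u - s) + 1 / 4 ^ m"
        using j by (simp_all add: field_simps)
      then have "dist (X lam (s + real j / 4 ^ m) \<omega>) (X lam u \<omega>) < e"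
        using m(1) u(1) assms by (intro d(2)) (auto simp: dist_real_def)
      then have "X lam (s + real j / 4 ^ m) \<omega> \<le> c + e" using u(2) by (simp add: dist_real_def)
      then show ?thesis unfolding grid_hit_iff using elim(3) j8 by blast
    qed
    then show "\<omega> \<in> grid_hit lam s c" using elim(1) by simp
  qed
qed

text \<open>The chance of being at or below \<open>c\<close> after time \<open>n\<close> is at most
  \<open>exp (lam * c)\<close> times the mean of \<open>exp (- lam * X)\<close> at time
  \<open>n\<close>, which decays geometrically; an event contained in all of these is null.\<close>

lemma X_tendsto_infinity_AE:
  assumes "0 < lam"
  shows "AE \<omega> in M. \<exists>T\<ge>0. \<forall>u\<ge>T. c < X lam u \<omega>"
proof -
  let ?G = "\<Inter>n. grid_hit lam (real n) c"
  have G: "?G \<in> sets M" by (intro sets.countable_INT) auto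
  have le: "prob ?G \<le> exp (lam * c) * exp (- (lam^2 / 2) * real n)" for n
  proof -
    have sp: "space M \<in> sets (past (real n))" by (metis sets.top space_completed_natural_filtration)
    have eq: "space M \<inter> grid_hit lam (real n) c = grid_hit lam (real n) c" using grid_hit_iff by blast
    have "prob ?G \<le> prob (space M \<inter> grid_hit lam (real n) c)"
      by (intro finite_measure_mono) (auto simp: eq)
    also have "\<dots> = (LINT \<omega>|M. indicator (space M) \<omega> * hit_prob lam c (X lam (real n) \<omega>))"
      by (rule prob_grid_hit[OF assms _ sp]) simp
    also have "\<dots> \<le> (LINT \<omega>|M. exp (lam * c) * exp (- (lam * X lam (real n) \<omega>)))"
    proof (rule integral_mono)
      show "integrable M (\<lambda>\<omega>. indicator (space M) \<omega> * hit_prob lam c (X lam (real n) \<omega>))"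
        by (rule integrable_indicator_bounded[OF _ _ borel_measurable_hit_prob abs_hit_prob_le[OF \<open>0 < lam\<close>]]) auto
      show "integrable M (\<lambda>\<omega>. exp (lam * c) * exp (- (lam * X lam (real n) \<omega>)))"
        by (intro integrable_mult_right integrable_exp_X(1)) simp
      fix \<omega> assume "\<omega> \<in> space M"
      have "- (lam * \<alpha>_fun c x) \<le> lam * c - lam * x" for x
      proof -
        have "x - c \<le> \<alpha>_fun c x" by (simp add: \<alpha>_fun_def)
        then have "lam * (x - c) \<le> lam * \<alpha>_fun c x" using assms by (intro mult_left_mono) auto
        then show ?thesis by (simp add: algebra_simps)
      qed
      then show "indicator (space M) \<omega> * hit_prob lam c (X lam (real n) \<omega>) \<le> exp (lam * c) * exp (- (lam * X lam (real n) \<omega>))"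
        using \<open>\<omega> \<in> space M\<close> by (simp add: hit_prob_def exp_add[symmetric])
    qed
    also have "\<dots> = exp (lam * c) * exp (- (lam^2 / 2) * real n)"
      using integrable_exp_X(2)[of "real n" lam lam] by (simp add: power2_eq_square algebra_simps)
    finally show ?thesis .
  qed
  have "(\<lambda>n. exp (lam * c) * exp (- (lam^2 / 2) * real n)) \<longlonglongrightarrow> 0" using assms by real_asymp
  then have "prob ?G \<le> 0" by (rule LIMSEQ_le_const) (use le in blast)
  then have "?G \<in> null_sets M"
    using G by (rule prob_le_0_null[rotated])
  then have "AE \<omega> in M. \<omega> \<notin> ?G" by (rule AE_not_in)
  moreover have "AE \<omega> in M. \<forall>n. \<omega> \<in> grid_hit lam (real n) c \<longleftrightarrow> (\<exists>u\<ge>real n. X lam u \<omega> \<le> c)"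
    unfolding AE_all_countable using AE_grid_hit_iff[OF assms] by simp
  ultimately show ?thesis
  proof eventually_elim
    case (elim \<omega>)
    then obtain n where "\<not> (\<exists>u\<ge>real n. X lam u \<omega> \<le> c)" by blast
    then show ?case by (metis not_le of_nat_0_le_iff)
  qed
qed

end

section \<open>The process stopped at the last passage time\<close>

text \<open>From below \<open>z\<close>, the intermediate value theorem gives a later visit to
  \<open>z\<close>; visits are bounded by \<open>T\<close>, and closedness makes their supremum a
  visit. A time with \<open>f s = z\<close> is excluded because it may be \<open>\<sigma>\<close>
  itself; \<open>s = 0\<close> is safe as \<open>f 0 = 0 < z\<close>.\<close>

lemma last_zero_properties:
  fixes f :: "real \<Rightarrow> real"
  assumes cont: "continuous_on {0..} f" and f0: "f 0 = 0" and "0 < z" and T: "0 \<le> T" "\<forall>u\<ge>T. z < f u"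
  defines "\<sigma> \<equiv> Sup {t. 0 < t \<and> f t = z}"
  shows "0 < \<sigma>" "f \<sigma> = z"
    and "\<And>s. 0 \<le> s \<Longrightarrow> s = 0 \<or> f s \<noteq> z \<Longrightarrow> s < \<sigma> \<longleftrightarrow> (\<exists>u\<ge>s. f u \<le> z)"
proof -
  let ?S = "{t. 0 < t \<and> f t = z}"
  have next_zero: "\<exists>t\<in>?S. u < t" if u: "0 \<le> u" "f u < z" for u
  proof -
    have "\<exists>t\<ge>u. t \<le> max u T \<and> f t = z"
    proof (rule IVT')
      show "f u \<le> z" "z \<le> f (max u T)" "u \<le> max u T"
        using u T(2)[rule_format, of "max u T"] by linarith+
      show "continuous_on {u..max u T} f"
        by (rule continuous_on_subset[OF cont]) (use u in auto)
    qed
    then obtain t where t: "u \<le> t" "f t = z" by blast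
    with u have "u \<noteq> t" by auto
    with u t show ?thesis by (intro bexI[of _ t]) auto
  qed
  have ne: "?S \<noteq> {}" using next_zero[of 0] f0 \<open>0 < z\<close> by auto
  have bdd: "bdd_above ?S"
    by (rule bdd_aboveI[of _ T]) (metis (mono_tags, lifting) T(2) less_irrefl linear mem_Collect_eq)
  have "closed {x \<in> {0..}. f x = z}"
    by (rule continuous_closed_preimage_constant[OF cont]) simp
  also have "{x \<in> {0..}. f x = z} = ?S" using f0 \<open>0 < z\<close> by (auto simp: less_le)
  finally have in_S: "\<sigma> \<in> ?S" unfolding \<sigma>_def by (rule closed_contains_Sup[OF ne bdd])
  then show "0 < \<sigma>" and fz: "f \<sigma> = z" by auto
  have upper: "t \<le> \<sigma>" if "t \<in> ?S" for t
    unfolding \<sigma>_def by (rule cSup_upper[OF that bdd])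
  show "s < \<sigma> \<longleftrightarrow> (\<exists>u\<ge>s. f u \<le> z)" if s: "0 \<le> s" "s = 0 \<or> f s \<noteq> z" for s
  proof
    assume "s < \<sigma>"
    with fz show "\<exists>u\<ge>s. f u \<le> z" by (intro exI[of _ \<sigma>]) auto
  next
    assume "\<exists>u\<ge>s. f u \<le> z"
    then obtain u where u: "s \<le> u" "f u \<le> z" by blast
    show "s < \<sigma>"
    proof (cases "f u = z")
      case True
      then have "u \<noteq> s" using s f0 \<open>0 < z\<close> by auto
      with True u s upper[of u] show ?thesis by auto
    next
      case False
      with u s obtain t where "t \<in> ?S" "u < t" using next_zero[of u] by auto
      with upper u show ?thesis by fastforce
    qed
  qed
qed

section \<open>The last passage time and the two filtrations\<close>

locale stopped_drifted_bm = standard_brownian_motion M B + complete_measure M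
  for M :: "'a measure" and B +
  fixes lam z :: real
  assumes lam_pos: "0 < lam" and z_pos: "0 < z"
begin

abbreviation "\<sigma> \<equiv> last_passage B lam z"
abbreviation "\<xi> \<equiv> stopped B lam z"
abbreviation "F \<equiv> completed_natural_filtration M \<xi>"

lemma AE_last_passage:
  "AE \<omega> in M. continuous_on {0..} (\<lambda>t. X lam t \<omega>) \<and> X lam 0 \<omega> = 0 \<and> 0 < \<sigma> \<omega> \<and> X lam (\<sigma> \<omega>) \<omega> = z
     \<and> (\<forall>s\<ge>0. s = 0 \<or> X lam s \<omega> \<noteq> z \<longrightarrow> (s < \<sigma> \<omega> \<longleftrightarrow> (\<exists>u\<ge>s. X lam u \<omega> \<le> z)))"
  using X_continuous_AE[of lam] X_zero_AE[of lam] X_tendsto_infinity_AE[OF lam_pos, of z]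
proof eventually_elim
  case (elim \<omega>)
  then obtain T where T: "0 \<le> T" "\<forall>u\<ge>T. z < X lam u \<omega>" by blast
  from last_zero_properties[OF elim(1,2) z_pos T] elim(1,2) show ?case
    unfolding last_passage_def by blast
qed

text \<open>As \<open>X lam s\<close> almost surely differs from \<open>z\<close>, survival past
  \<open>s\<close> means being at or below \<open>z\<close> at some later time, which the grids
  detect up to a null set.\<close>

lemma AE_less_last_passage:
  assumes "0 \<le> s"
  shows "AE \<omega> in M. s < \<sigma> \<omega> \<longleftrightarrow> \<omega> \<in> grid_hit lam s z"
proof -
  have "AE \<omega> in M. s = 0 \<or> X lam s \<omega> \<noteq> z"
    using X_ne_const_AE[of s lam z] assms by (cases "s = 0") auto
  with AE_last_passage AE_grid_hit_iff[OF lam_pos assms, of z] show ?thesis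
  proof eventually_elim
    case (elim \<omega>)
    with assms show ?case by blast
  qed
qed

lemma AE_last_passage_ne:
  assumes "0 \<le> s"
  shows "AE \<omega> in M. \<sigma> \<omega> \<noteq> s"
proof -
  have "AE \<omega> in M. s = 0 \<or> X lam s \<omega> \<noteq> z"
    using X_ne_const_AE[of s lam z] assms by (cases "s = 0") auto
  with AE_last_passage show ?thesis by eventually_elim auto
qed

lemma stopped_before: "s < \<sigma> \<omega> \<Longrightarrow> r \<le> s \<Longrightarrow> \<xi> r \<omega> = X lam r \<omega>"
  by (simp add: stopped_def)

text \<open>A supremum over uncountably many times carries no measurability of its own; completeness
  transfers it from the grid event.\<close>

lemma less_last_passage_events:
  assumes "0 \<le> s"
  shows "{\<omega> \<in> space M. s < \<sigma> \<omega>} \<in> sets M"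
proof (rule AE_eq_sets[of M "grid_hit lam s z"])
  show "AE \<omega> in M. \<omega> \<in> grid_hit lam s z \<longleftrightarrow> \<omega> \<in> {\<omega> \<in> space M. s < \<sigma> \<omega>}"
    using AE_less_last_passage[OF assms] AE_space by eventually_elim auto
qed (use assms grid_hit_iff in auto)

lemma AE_stopped: "AE \<omega> in M. \<forall>s. \<xi> s \<omega> = (if s < \<sigma> \<omega> then X lam s \<omega> else z)"
  using AE_last_passage by eventually_elim (auto simp: stopped_def min_def)

lemma measurable_stopped:
  assumes "0 \<le> s"
  shows "\<xi> s \<in> borel_measurable M"
proof (rule AE_eq_measurable)
  have [measurable]: "X lam s \<in> borel_measurable M" "{\<omega> \<in> space M. s < \<sigma> \<omega>} \<in> sets M"
    using measurable_X[OF assms] less_last_passage_events[OF assms] by auto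
  show "(\<lambda>\<omega>. if s < \<sigma> \<omega> then X lam s \<omega> else z) \<in> borel_measurable M"
    by measurable
  show "AE \<omega> in M. (if s < \<sigma> \<omega> then X lam s \<omega> else z) = \<xi> s \<omega>"
    using AE_stopped by eventually_elim simp
qed auto

lemma subalgebra_F: "subalgebra M (F s)"
  by (rule subalgebra_completed_natural_filtration[OF measurable_stopped])

lemma sets_F: "A \<in> sets (F s) \<Longrightarrow> A \<in> sets M"
  using subalgebra_F by (auto simp: subalgebra_def)

lemma null_F: "null_sets M \<subseteq> sets (F s)"
  using null_sets_completed_natural_filtration by blast

text \<open>Almost surely \<open>\<sigma> < s\<close> iff \<open>\<xi> q = \<xi> s\<close> for some rational \<open>q < s\<close>, because the increments of
  \<open>X\<close> have no atoms; this makes \<open>\<sigma>\<close> a stopping time of the completed filtration of \<open>\<xi>\<close>.\<close>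

lemma less_last_passage_F:
  assumes "0 \<le> s"
  shows "{\<omega> \<in> space M. s < \<sigma> \<omega>} \<in> sets (F s)"
proof -
  let ?Q = "\<rat> \<inter> {0..<s}"
  let ?A = "{\<omega> \<in> space (F s). \<forall>q\<in>?Q. \<xi> q \<omega> \<noteq> \<xi> s \<omega>}"
  have cQ: "countable ?Q" using countable_rat by (rule countable_subset[rotated]) auto
  have A: "?A \<in> sets (F s)"
  proof (rule sets.sets_Collect_countable_All'[OF _ cQ])
    fix q assume "q \<in> ?Q"
    then have "\<xi> q \<in> borel_measurable (F s)" "\<xi> s \<in> borel_measurable (F s)"
      using assms by (auto intro!: measurable_completed_natural_filtration)
    then show "{\<omega> \<in> space (F s). \<xi> q \<omega> \<noteq> \<xi> s \<omega>} \<in> sets (F s)" by measurable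
  qed
  have ne: "AE \<omega> in M. \<forall>q\<in>?Q. X lam q \<omega> \<noteq> X lam s \<omega>"
  proof (subst AE_ball_countable[OF cQ], rule ballI)
    fix q assume "q \<in> ?Q"
    then show "AE \<omega> in M. X lam q \<omega> \<noteq> X lam s \<omega>"
      using X_ne_AE[of q s lam 0] by (auto elim!: eventually_mono)
  qed
  show ?thesis
  proof (rule AE_eq_sets[OF null_F A])
    show "AE \<omega> in M. \<omega> \<in> ?A \<longleftrightarrow> \<omega> \<in> {\<omega> \<in> space M. s < \<sigma> \<omega>}"
      using ne AE_stopped AE_last_passage AE_last_passage_ne[OF assms] AE_space
    proof eventually_elim
      case (elim \<omega>)
      show ?case
      proof (cases "s < \<sigma> \<omega>")
        case True
        then have "\<xi> q \<omega> \<noteq> \<xi> s \<omega>" if "q \<in> ?Q" for q using elim(1,2) that by auto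
        with True elim(5) show ?thesis by auto
      next
        case False
        with elim have "\<sigma> \<omega> < s" "0 < \<sigma> \<omega>" by auto
        then obtain q where q: "q \<in> \<rat>" "\<sigma> \<omega> < q" "q < s" using Rats_dense_in_real by blast
        then have "\<xi> q \<omega> = \<xi> s \<omega>" using elim(2) False by auto
        moreover have "q \<in> ?Q" using q \<open>0 < \<sigma> \<omega>\<close> by auto
        ultimately show ?thesis using False by blast
      qed
    qed
  qed auto
qed

text \<open>Before \<open>\<sigma>\<close> stopping has no effect, so generators of
  \<open>F s\<close> have counterparts in \<open>past s\<close> on \<open>s < \<sigma>\<close>, and
  this passes through complements and countable unions. It gives access to the Markov property,
  which refers to \<open>past s\<close>.\<close>

lemma F_trace:
  assumes "A \<in> sets (F s)"
  shows "\<exists>A'\<in>sets (past s). \<forall>\<omega>. s < \<sigma> \<omega> \<longrightarrow> (\<omega> \<in> A \<longleftrightarrow> \<omega> \<in> A')"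
  using assms unfolding sets_completed_natural_filtration[of M \<xi>]
proof (induction rule: sigma_sets.induct)
  case (Basic A)
  then consider r C where "A = \<xi> r -` C \<inter> space M" "0 \<le> r" "r \<le> s" "C \<in> sets borel" | "A \<in> null_sets M"
    by blast
  then show ?case
  proof cases
    case 1
    have "X lam r -` C \<inter> space (past s) \<in> sets (past s)"
      using 1 by (intro measurable_sets[OF measurable_X_past]) auto
    then show ?thesis
      by (rule bexI[rotated]) (use 1 in \<open>auto simp: stopped_before\<close>)
  next
    case 2
    then show ?thesis using null_sets_completed_natural_filtration by blast
  qed
next
  case Empty
  show ?case by (rule bexI[of _ "{}"]) auto
next
  case (Compl A)
  then obtain A' where "A' \<in> sets (past s)" "\<forall>\<omega>. s < \<sigma> \<omega> \<longrightarrow> (\<omega> \<in> A \<longleftrightarrow> \<omega> \<in> A')" by blast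
  moreover from this have "space (past s) - A' \<in> sets (past s)" by blast
  ultimately show ?case by (intro bexI[of _ "space (past s) - A'"]) auto
next
  case (Union A)
  then obtain A' where "\<And>i. A' i \<in> sets (past s)" "\<And>i. \<forall>\<omega>. s < \<sigma> \<omega> \<longrightarrow> (\<omega> \<in> A i \<longleftrightarrow> \<omega> \<in> A' i)"
    by metis
  then show ?case by (intro bexI[of _ "\<Union>i. A' i"]) auto
qed

text \<open>The conditional probability of \<open>s < \<sigma>\<close> given \<open>past s\<close>
  is \<open>\<phi>\<close> at the current position; the factors measurable for the past come out of
  the conditional expectation.\<close>

lemma integral_alive:
  assumes "0 \<le> s" and A: "A \<in> sets (past s)"
    and f: "f \<in> borel_measurable borel" "\<And>x. \<bar>f x\<bar> \<le> K"
  shows "(LINT \<omega>|M. indicator A \<omega> * (of_bool (s < \<sigma> \<omega>) * f (X lam s \<omega>)))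
    = (LINT \<omega>|M. indicator A \<omega> * (hit_prob lam z (X lam s \<omega>) * f (X lam s \<omega>)))"
proof -
  interpret P: finite_measure_subalgebra M "past s"
    by unfold_locales (rule subalgebra_past)
  let ?U = "grid_hit lam s z"
  have [measurable]: "?U \<in> sets M" "X lam s \<in> borel_measurable (past s)" "X lam s \<in> borel_measurable M"
      "f \<in> borel_measurable borel" "A \<in> sets (past s)" "A \<in> sets M"
      "{\<omega> \<in> space M. s < \<sigma> \<omega>} \<in> sets M"
    using assms measurable_X_past[of s s] measurable_X[of s] sets_past[OF A] less_last_passage_events by auto
  have ce: "AE \<omega> in M. real_cond_exp M (past s) (indicator ?U) \<omega> = hit_prob lam z (X lam s \<omega>)"
  proof (rule P.real_cond_exp_charact)
    fix C assume C: "C \<in> sets (past s)"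
    then have [measurable]: "C \<in> sets M" by (rule sets_past)
    have "(LINT \<omega>:C|M. indicator ?U \<omega>) = (LINT \<omega>|M. indicator (C \<inter> ?U) \<omega> :: real)"
      by (simp add: set_lebesgue_integral_def indicator_inter_arith)
    also have "\<dots> = prob (C \<inter> ?U)" by simp
    also have "\<dots> = (LINT \<omega>:C|M. hit_prob lam z (X lam s \<omega>))"
      unfolding prob_grid_hit[OF lam_pos \<open>0 \<le> s\<close> C] by (simp add: set_lebesgue_integral_def)
    finally show "(LINT \<omega>:C|M. indicator ?U \<omega>) = (LINT \<omega>:C|M. hit_prob lam z (X lam s \<omega>))" .
  next
    show "integrable M (indicator ?U :: 'a \<Rightarrow> real)" by (simp add: less_top[symmetric])
    show "integrable M (\<lambda>\<omega>. hit_prob lam z (X lam s \<omega>))"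
      using abs_hit_prob_le[OF lam_pos] by (intro integrable_const_bound[where B=1]) auto
    show "(\<lambda>\<omega>. hit_prob lam z (X lam s \<omega>)) \<in> borel_measurable (past s)" by measurable
  qed
  let ?g = "\<lambda>\<omega>. indicator A \<omega> * f (X lam s \<omega>)"
  have g: "?g \<in> borel_measurable (past s)" by measurable
  have "(LINT \<omega>|M. indicator A \<omega> * (of_bool (s < \<sigma> \<omega>) * f (X lam s \<omega>))) = (LINT \<omega>|M. ?g \<omega> * indicator ?U \<omega>)"
  proof (rule integral_cong_AE)
    show "AE \<omega> in M. indicator A \<omega> * (of_bool (s < \<sigma> \<omega>) * f (X lam s \<omega>)) = ?g \<omega> * indicator ?U \<omega>"
      using AE_less_last_passage[OF \<open>0 \<le> s\<close>] by eventually_elim (auto simp: indicator_def)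
  qed measurable
  also have "\<dots> = (LINT \<omega>|M. ?g \<omega> * real_cond_exp M (past s) (indicator ?U) \<omega>)"
  proof (rule P.real_cond_exp_intg(2)[OF _ g, symmetric])
    show "integrable M (\<lambda>\<omega>. ?g \<omega> * indicator ?U \<omega>)"
      using f(2) order_trans[OF abs_ge_zero f(2)]
      by (intro integrable_const_bound[where B=K]) (auto simp: indicator_def)
  qed measurable
  also have "\<dots> = (LINT \<omega>|M. indicator A \<omega> * (hit_prob lam z (X lam s \<omega>) * f (X lam s \<omega>)))"
  proof (rule integral_cong_AE)
    show "AE \<omega> in M. ?g \<omega> * real_cond_exp M (past s) (indicator ?U) \<omega>
        = indicator A \<omega> * (hit_prob lam z (X lam s \<omega>) * f (X lam s \<omega>))"
      using ce by eventually_elim simp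
  qed measurable
  finally show ?thesis .
qed

text \<open>Survival at \<open>s + t\<close> is exchanged for the weight \<open>\<phi>\<close>, the
  Markov property of \<open>X\<close> moves back to time \<open>s\<close>, and the weight is
  exchanged for survival at \<open>s\<close>. The bound \<open>K\<close> makes the last exchange
  legitimate; it will come from the generator limit.\<close>

lemma semigroup_Q_markov:
  assumes "0 \<le> s" "0 < t" and A: "A \<in> sets (F s)" and h: "h \<in> C0 state_space"
    and K: "\<And>x. \<bar>semigroup_Q lam z t h (1, x) - h (1, x)\<bar> \<le> K"
  shows "(LINT \<omega>|M. indicator A \<omega> * (of_bool (s + t < \<sigma> \<omega>) * (h (1, X lam (s + t) \<omega>) - h (0, z))))
    = (LINT \<omega>|M. indicator A \<omega> * (of_bool (s < \<sigma> \<omega>) * (semigroup_Q lam z t h (1, X lam s \<omega>) - h (0, z))))"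
proof -
  obtain A' where A': "A' \<in> sets (past s)" "\<And>\<omega>. s < \<sigma> \<omega> \<Longrightarrow> \<omega> \<in> A \<longleftrightarrow> \<omega> \<in> A'"
    using F_trace[OF A] by blast
  have "A' \<in> sets (past (s + t))"
    using A' sets_completed_natural_filtration_mono[of s "s + t" M B] assms by auto
  note A'' = this
  \<comment> \<open>Survival at \<open>s + r\<close> implies survival at \<open>s\<close>, where
    \<open>A\<close> and \<open>A'\<close> agree, so the event of \<open>F s\<close> may be replaced
    by one of \<open>past s\<close>.\<close>
  have ind: "indicator A \<omega> * (of_bool (s + r < \<sigma> \<omega>) * x) = indicator A' \<omega> * (of_bool (s + r < \<sigma> \<omega>) * (x::real))"
    if "0 \<le> r" for \<omega> r x
    using A'(2)[of \<omega>] that by (auto simp: indicator_def)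
  have ind0: "indicator A \<omega> * (of_bool (s < \<sigma> \<omega>) * x) = indicator A' \<omega> * (of_bool (s < \<sigma> \<omega>) * (x::real))" for \<omega> x
    using A'(2)[of \<omega>] by (auto simp: indicator_def)
  let ?u = "kill_transform lam z h" and ?q = "\<lambda>x. semigroup_Q lam z t h (1, x) - h (0, z)"
  obtain L where L: "\<And>x. x \<in> state_space \<Longrightarrow> \<bar>h x\<bar> \<le> L" using C0_bounded[OF h] by blast
  have h1: "\<bar>h (1, x) - h (0, z)\<bar> \<le> 2 * L" for x
    using L[of "(1, x)"] L[of "(0, z)"] by (auto simp: state_space_def)
  have [measurable]: "(\<lambda>x. h (1, x)) \<in> borel_measurable borel"
    by (intro borel_measurable_continuous_onI C0_state_space_continuous h) simp
  obtain Ku where Ku: "\<And>x. \<bar>?u x\<bar> \<le> Ku" using kill_transform_C0(3)[OF lam_pos h] by blast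
  note u[measurable] = kill_transform_C0(2)[OF lam_pos h, of z]
  have q: "?q x = bm_transition lam t ?u x / hit_prob lam z x" for x
    using semigroup_Q_diff_eq[OF lam_pos \<open>0 < t\<close> h, of z x] hit_prob_pos[of lam z x]
    by (simp add: kill_transform_def field_simps)
  note [measurable] = borel_measurable_bm_transition[OF u, of lam t]
  have qm: "?q \<in> borel_measurable borel" unfolding q by measurable
  have qb: "\<bar>?q x\<bar> \<le> K + 2 * L" for x using K[of x] h1[of x] by linarith
  have "(LINT \<omega>|M. indicator A \<omega> * (of_bool (s + t < \<sigma> \<omega>) * (h (1, X lam (s + t) \<omega>) - h (0, z))))
     = (LINT \<omega>|M. indicator A' \<omega> * (of_bool (s + t < \<sigma> \<omega>) * (h (1, X lam (s + t) \<omega>) - h (0, z))))"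
    using assms by (simp add: ind)
  also have "\<dots> = (LINT \<omega>|M. indicator A' \<omega> * (hit_prob lam z (X lam (s + t) \<omega>) * (h (1, X lam (s + t) \<omega>) - h (0, z))))"
    by (rule integral_alive[where f="\<lambda>x. h (1, x) - h (0, z)", OF _ A'' _ h1]) (use assms in auto)
  also have "\<dots> = (LINT \<omega>|M. indicator A' \<omega> * ?u (X lam (s + t) \<omega>))"
    by (simp add: kill_transform_def mult.commute)
  also have "\<dots> = (LINT \<omega>|M. indicator A' \<omega> * bm_transition lam t ?u (X lam s \<omega>))"
    by (rule markov_X[OF assms(1,2) A'(1) u Ku])
  also have "\<dots> = (LINT \<omega>|M. indicator A' \<omega> * (hit_prob lam z (X lam s \<omega>) * ?q (X lam s \<omega>)))"
    unfolding q using hit_prob_pos[of lam z] by (simp add: less_imp_neq[symmetric])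
  also have "\<dots> = (LINT \<omega>|M. indicator A' \<omega> * (of_bool (s < \<sigma> \<omega>) * ?q (X lam s \<omega>)))"
    by (rule integral_alive[OF assms(1) A'(1) qm qb, symmetric])
  finally show ?thesis unfolding ind0 .
qed

end

section \<open>Dynkin formula\<close>

text \<open>The forward increment bound is uniform in the base point, so it also yields the left
  difference quotient, taken from the base point \<open>y < x\<close>; continuity of
  \<open>n\<close> then moves \<open>n y\<close> to \<open>n x\<close>. Each of the two errors gets
  \<open>e / 2\<close>.\<close>

lemma uniform_increment_integral:
  fixes m n :: "real \<Rightarrow> real"
  assumes "s \<le> T" and cont: "continuous_on {s..T} n"
    and inc: "\<And>e. 0 < e \<Longrightarrow> \<exists>d>0. \<forall>\<delta> r. 0 < \<delta> \<and> \<delta> < d \<and> s \<le> r \<longrightarrow> \<bar>m (r + \<delta>) - m r - \<delta> * n r\<bar> \<le> e * \<delta>"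
  shows "m T - m s = (LINT r:{s..T}|lborel. n r)"
proof -
  have "(m has_vector_derivative n x) (at x within {s..T})" if x: "x \<in> {s..T}" for x
    unfolding has_vector_derivative_def has_derivative_within_alt
  proof (intro conjI allI impI)
    show "bounded_linear (\<lambda>y. y *\<^sub>R n x)" by (rule bounded_linear_scaleR_left)
    fix e :: real assume e: "0 < e"
    then have e2: "0 < e / 2" by simp
    obtain d where d: "0 < d" "\<And>\<delta> r. 0 < \<delta> \<Longrightarrow> \<delta> < d \<Longrightarrow> s \<le> r \<Longrightarrow> \<bar>m (r + \<delta>) - m r - \<delta> * n r\<bar> \<le> e / 2 * \<delta>"
      using inc[OF e2] by blast
    obtain d' where d': "0 < d'" "\<And>y. y \<in> {s..T} \<Longrightarrow> dist y x < d' \<Longrightarrow> dist (n y) (n x) < e / 2"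
      using cont x e2 unfolding continuous_on_iff by metis
    show "\<exists>d>0. \<forall>y\<in>{s..T}. norm (y - x) < d \<longrightarrow> norm (m y - m x - (y - x) *\<^sub>R n x) \<le> e * norm (y - x)"
    proof (intro exI[of _ "min d d'"] conjI ballI impI)
      fix y assume y: "y \<in> {s..T}" "norm (y - x) < min d d'"
      consider "y = x" | "x < y" | "y < x" by linarith
      then show "norm (m y - m x - (y - x) *\<^sub>R n x) \<le> e * norm (y - x)"
      proof cases
        case 2
        then have "\<bar>m y - m x - (y - x) * n x\<bar> \<le> e / 2 * (y - x)"
          using d(2)[of "y - x" x] x y by simp
        also have "\<dots> \<le> e * (y - x)" using 2 e by (intro mult_right_mono) auto
        finally show ?thesis using 2 by simp
      next
        case 3
        have 1: "\<bar>m x - m y - (x - y) * n y\<bar> \<le> e / 2 * (x - y)"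
          using d(2)[of "x - y" y] x y 3 by simp
        have "\<bar>n y - n x\<bar> \<le> e / 2"
          using d'(2)[OF y(1)] y(2) by (simp add: dist_real_def)
        then have "(x - y) * \<bar>n y - n x\<bar> \<le> (x - y) * (e / 2)"
          using 3 by (intro mult_left_mono) auto
        then have 2: "\<bar>(x - y) * (n y - n x)\<bar> \<le> e / 2 * (x - y)"
          using 3 by (simp add: abs_mult mult.commute)
        have "m y - m x - (y - x) * n x = - (m x - m y - (x - y) * n y) - (x - y) * (n y - n x)"
          by algebra
        with 1 2 have "\<bar>m y - m x - (y - x) * n x\<bar> \<le> e / 2 * (x - y) + e / 2 * (x - y)" by linarith
        then show ?thesis using 3 by simp
      qed simp
    qed (use d d' in auto)
  qed
  then have "(n has_integral (m T - m s)) {s..T}"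
    by (intro fundamental_theorem_of_calculus \<open>s \<le> T\<close>)
  moreover have "set_integrable lborel {s..T} n"
    using borel_integrable_compact[OF compact_Icc cont] by (simp add: set_integrable_def indicator_def of_bool_def if_distrib cong: if_cong)
  ultimately show ?thesis
    using set_borel_integral_eq_integral(2) integral_unique by metis
qed

text \<open>Limit of the processes sampled at times rounded down to multiples of
  \<open>1 / (n + 1)\<close>, each taking countably many time values. Clamping comes after rounding,
  so only times in \<open>[0, t]\<close> are sampled.\<close>

lemma measurable_continuous_process:
  fixes Y :: "real \<Rightarrow> 'a \<Rightarrow> real"
  assumes "0 \<le> t" and Y: "\<And>r. 0 \<le> r \<Longrightarrow> r \<le> t \<Longrightarrow> Y r \<in> borel_measurable G"
    and cont: "\<And>\<omega>. \<omega> \<in> space G \<Longrightarrow> continuous_on {0..t} (\<lambda>r. Y r \<omega>)"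
  shows "(\<lambda>(\<omega>, r). Y (max 0 (min t r)) \<omega>) \<in> borel_measurable (G \<Otimes>\<^sub>M borel)"
proof -
  define c where "c r = max 0 (min t r)" for r
  have c: "0 \<le> c r" "c r \<le> t" for r using \<open>0 \<le> t\<close> by (auto simp: c_def)
  let ?f = "\<lambda>n (\<omega>, r). Y (c (real_of_int \<lfloor>real (Suc n) * r\<rfloor> / real (Suc n))) \<omega>"
  show ?thesis unfolding c_def[symmetric]
  proof (rule borel_measurable_LIMSEQ_real[where u="?f"])
    fix p assume p: "p \<in> space (G \<Otimes>\<^sub>M (borel :: real measure))"
    obtain \<omega> r where pr: "p = (\<omega>, r)" by (cases p)
    have \<omega>: "\<omega> \<in> space G" using p pr by (auto simp: space_pair_measure)
    have "(\<lambda>n. real_of_int \<lfloor>real (Suc n) * r\<rfloor> / real (Suc n)) \<longlonglongrightarrow> r"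
    proof (rule tendsto_sandwich)
      show "\<forall>\<^sub>F n in sequentially. r - 1 / real (Suc n) \<le> real_of_int \<lfloor>real (Suc n) * r\<rfloor> / real (Suc n)"
      proof (rule always_eventually, rule allI)
        fix n
        have "real (Suc n) * r - 1 \<le> real_of_int \<lfloor>real (Suc n) * r\<rfloor>" by linarith
        then have "(real (Suc n) * r - 1) / real (Suc n) \<le> real_of_int \<lfloor>real (Suc n) * r\<rfloor> / real (Suc n)"
          by (rule divide_right_mono) simp
        then show "r - 1 / real (Suc n) \<le> real_of_int \<lfloor>real (Suc n) * r\<rfloor> / real (Suc n)"
          by (simp add: diff_divide_distrib del: of_nat_Suc)
      qed
      show "\<forall>\<^sub>F n in sequentially. real_of_int \<lfloor>real (Suc n) * r\<rfloor> / real (Suc n) \<le> r"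
      proof (rule always_eventually, rule allI)
        fix n
        have "real_of_int \<lfloor>real (Suc n) * r\<rfloor> \<le> r * real (Suc n)"
          using of_int_floor_le[of "real (Suc n) * r"] by (simp only: mult.commute)
        then show "real_of_int \<lfloor>real (Suc n) * r\<rfloor> / real (Suc n) \<le> r"
          by (simp add: pos_divide_le_eq del: of_nat_Suc)
      qed
      show "(\<lambda>n. r - 1 / real (Suc n)) \<longlonglongrightarrow> r"
        using tendsto_diff[OF tendsto_const[of r] LIMSEQ_Suc[OF lim_1_over_n]] by simp
    qed simp
    moreover have "isCont c r" unfolding c_def by (intro continuous_intros)
    ultimately have "(\<lambda>n. c (real_of_int \<lfloor>real (Suc n) * r\<rfloor> / real (Suc n))) \<longlonglongrightarrow> c r"
      by (metis isCont_tendsto_compose)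
    then have "(\<lambda>n. Y (c (real_of_int \<lfloor>real (Suc n) * r\<rfloor> / real (Suc n))) \<omega>) \<longlonglongrightarrow> Y (c r) \<omega>"
      using c by (intro continuous_on_tendsto_compose[OF cont[OF \<omega>]]) auto
    then show "(\<lambda>n. ?f n p) \<longlonglongrightarrow> (case p of (\<omega>, r) \<Rightarrow> Y (c r) \<omega>)" by (simp add: pr)
  next
    fix n
    have "(\<lambda>p. Y (c (real_of_int \<lfloor>real (Suc n) * snd p\<rfloor> / real (Suc n))) (fst p))
        \<in> borel_measurable (G \<Otimes>\<^sub>M borel)"
    proof (rule measurable_compose_countable[where f="\<lambda>i p. Y (c (real_of_int i / real (Suc n))) (fst p)"
          and g="\<lambda>p. \<lfloor>real (Suc n) * snd p\<rfloor>"])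
      show "(\<lambda>p. Y (c (real_of_int i / real (Suc n))) (fst p)) \<in> borel_measurable (G \<Otimes>\<^sub>M (borel :: real measure))" for i
        by (rule measurable_compose[OF measurable_fst Y]) (rule c)+
      show "(\<lambda>p. \<lfloor>real (Suc n) * snd p\<rfloor>) \<in> measurable (G \<Otimes>\<^sub>M borel) (count_space UNIV)"
        by measurable
    qed
    then show "?f n \<in> borel_measurable (G \<Otimes>\<^sub>M borel)" by (simp add: case_prod_beta')
  qed
qed

lemma (in stopped_drifted_bm) filtration_F: "filtration (space M) F"
  by unfold_locales (auto intro: sets_completed_natural_filtration_mono[THEN subsetD])

lemma (in stopped_drifted_bm) F_mono: "s \<le> t \<Longrightarrow> A \<in> sets (F s) \<Longrightarrow> A \<in> sets (F t)"
  using sets_completed_natural_filtration_mono by blast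

section \<open>Expectations of \<open>h\<close> along the stopped process\<close>

locale stopped_bm_generator = stopped_drifted_bm +
  fixes h g :: "real \<times> real \<Rightarrow> real"
  assumes h_C0: "h \<in> C0 state_space" and g_C0: "g \<in> C0 state_space"
    and generator: "uniform_limit state_space (\<lambda>t x. (semigroup_Q lam z t h x - h x) / t) g (at_right 0)"
begin

lemma measurable_h [measurable]: "(\<lambda>x. h (1, x)) \<in> borel_measurable borel"
  by (intro borel_measurable_continuous_onI C0_state_space_continuous h_C0) simp

lemma measurable_g [measurable]: "(\<lambda>x. g (1, x)) \<in> borel_measurable borel"
  by (intro borel_measurable_continuous_onI C0_state_space_continuous g_C0) simp

lemma bounds: "\<exists>K. \<forall>x. \<bar>h (1, x) - h (0, z)\<bar> \<le> K \<and> \<bar>g (1, x)\<bar> \<le> K"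
proof -
  obtain K where K: "\<And>x. x \<in> state_space \<Longrightarrow> \<bar>h x\<bar> \<le> K" using C0_bounded[OF h_C0] by blast
  obtain L where L: "\<And>x. x \<in> state_space \<Longrightarrow> \<bar>g x\<bar> \<le> L" using C0_bounded[OF g_C0] by blast
  show ?thesis
  proof (intro exI[of _ "max (2 * K) L"] allI conjI)
    fix x
    show "\<bar>h (1, x) - h (0, z)\<bar> \<le> max (2 * K) L"
      using K[of "(1, x)"] K[of "(0, z)"] by (auto simp: state_space_def)
    show "\<bar>g (1, x)\<bar> \<le> max (2 * K) L"
      using L[of "(1, x)"] by (auto simp: state_space_def)
  qed
qed

text \<open>The process in the theorem's first term minus its value from \<open>\<sigma>\<close> on,
  so that it vanishes there; under the indicator \<open>X\<close> and the stopped process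
  coincide.\<close>

definition Zh :: "real \<Rightarrow> 'a \<Rightarrow> real" where
  "Zh r \<omega> = of_bool (r < \<sigma> \<omega>) * (h (1, X lam r \<omega>) - h (0, z))"

definition Zg :: "real \<Rightarrow> 'a \<Rightarrow> real" where
  "Zg r \<omega> = of_bool (r < \<sigma> \<omega>) * g (1, X lam r \<omega>)"

lemma measurable_alive:
  fixes f :: "real \<Rightarrow> real"
  assumes "0 \<le> r" and [measurable]: "f \<in> borel_measurable borel"
  shows "(\<lambda>\<omega>. of_bool (r < \<sigma> \<omega>) * f (X lam r \<omega>)) \<in> borel_measurable M"
proof -
  have [measurable]: "X lam r \<in> borel_measurable M" "{\<omega> \<in> space M. r < \<sigma> \<omega>} \<in> sets M"
    using assms measurable_X[of r] less_last_passage_events by auto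
  show ?thesis by measurable
qed

lemma integrable_alive:
  fixes f :: "real \<Rightarrow> real"
  assumes "0 \<le> r" "f \<in> borel_measurable borel" "\<And>x. \<bar>f x\<bar> \<le> K" and A: "A \<in> sets M"
  shows "integrable M (\<lambda>\<omega>. indicator A \<omega> * (of_bool (r < \<sigma> \<omega>) * f (X lam r \<omega>)))"
proof -
  have "integrable M (\<lambda>\<omega>. of_bool (r < \<sigma> \<omega>) * f (X lam r \<omega>))"
    using order_trans[OF abs_ge_zero assms(3)] assms(3)
    by (intro integrable_const_bound[where B=K] measurable_alive assms) auto
  from integrable_mult_indicator[OF A this] show ?thesis by simp
qed

text \<open>The error is the mean of \<open>Q\<^sub>\<delta> h - h - \<delta> g\<close> over
  surviving paths, hence at most a supremum. As the generator limit is uniform on the state space,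
  \<open>d\<close> depends on \<open>e\<close> alone, not on the time or the event.\<close>

lemma increment_estimate:
  assumes "0 < e"
  shows "\<exists>d>0. \<forall>\<delta> r A. 0 < \<delta> \<and> \<delta> < d \<and> 0 \<le> r \<and> A \<in> sets (F r) \<longrightarrow>
    \<bar>(LINT \<omega>|M. indicator A \<omega> * Zh (r + \<delta>) \<omega>) - (LINT \<omega>|M. indicator A \<omega> * Zh r \<omega>)
      - \<delta> * (LINT \<omega>|M. indicator A \<omega> * Zg r \<omega>)\<bar> \<le> e * \<delta>"
proof -
  obtain K where K: "\<And>x. \<bar>h (1, x) - h (0, z)\<bar> \<le> K" "\<And>x. \<bar>g (1, x)\<bar> \<le> K" using bounds by blast
  have "\<forall>\<^sub>F \<delta> in at_right 0. \<forall>x\<in>state_space. dist ((semigroup_Q lam z \<delta> h x - h x) / \<delta>) (g x) < e"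
    using uniform_limitD[OF generator assms] .
  then obtain d where d: "0 < d" "\<And>\<delta> x. 0 < \<delta> \<Longrightarrow> \<delta> < d \<Longrightarrow> x \<in> state_space \<Longrightarrow>
      dist ((semigroup_Q lam z \<delta> h x - h x) / \<delta>) (g x) < e"
    unfolding eventually_at_right_field by blast
  show ?thesis
  proof (intro exI[of _ d] conjI allI impI)
    fix \<delta> r A assume "0 < \<delta> \<and> \<delta> < d \<and> 0 \<le> r \<and> A \<in> sets (F r)"
    then have \<delta>: "0 < \<delta>" "\<delta> < d" and r: "0 \<le> r" and A: "A \<in> sets (F r)" by auto
    let ?q = "\<lambda>x. semigroup_Q lam z \<delta> h (1, x)"
    define w where "w x = ?q x - h (1, x) - \<delta> * g (1, x)" for x
    have w: "\<bar>w x\<bar> \<le> e * \<delta>" for x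
    proof -
      have "\<bar>(?q x - h (1, x)) / \<delta> - g (1, x)\<bar> < e"
        using d(2)[OF \<delta>, of "(1, x)"] by (simp add: state_space_def dist_real_def)
      then have "\<bar>(?q x - h (1, x)) / \<delta> - g (1, x)\<bar> * \<delta> \<le> e * \<delta>"
        using \<delta> by (intro mult_right_mono) auto
      also have "\<bar>(?q x - h (1, x)) / \<delta> - g (1, x)\<bar> * \<delta> = \<bar>((?q x - h (1, x)) / \<delta> - g (1, x)) * \<delta>\<bar>"
        using \<delta> by (simp add: abs_mult)
      also have "((?q x - h (1, x)) / \<delta> - g (1, x)) * \<delta> = w x"
        using \<delta> by (simp add: w_def field_simps)
      finally show ?thesis .
    qed
    have qb: "\<bar>?q x - h (1, x)\<bar> \<le> e * \<delta> + \<delta> * K" for x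
    proof -
      have "\<bar>\<delta> * g (1, x)\<bar> \<le> \<delta> * K" using K(2)[of x] \<delta> by (simp add: abs_mult)
      then show ?thesis using w[of x] unfolding w_def by linarith
    qed
    note [measurable] = borel_measurable_bm_transition[OF kill_transform_C0(2)[OF lam_pos h_C0, of z], of lam \<delta>]
      kill_transform_C0(2)[OF lam_pos h_C0, of z]
    have qm: "(\<lambda>x. ?q x - h (1, x)) \<in> borel_measurable borel"
      unfolding semigroup_Q_diff_eq[OF lam_pos \<delta>(1) h_C0] by measurable
    have wm [measurable]: "w \<in> borel_measurable borel"
      unfolding w_def[abs_def] using qm by measurable
    have AM: "A \<in> sets M" by (rule sets_F[OF A])
    have i: "integrable M (\<lambda>\<omega>. indicator A \<omega> * Zh r \<omega>)" "integrable M (\<lambda>\<omega>. indicator A \<omega> * Zg r \<omega>)"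
       "integrable M (\<lambda>\<omega>. indicator A \<omega> * (of_bool (r < \<sigma> \<omega>) * w (X lam r \<omega>)))"
      unfolding Zh_def Zg_def
      using integrable_alive[where f="\<lambda>x. h (1, x) - h (0, z)", OF r _ K(1) AM] integrable_alive[OF r measurable_g K(2) AM] integrable_alive[OF r wm w AM]
      by simp_all
    have "(LINT \<omega>|M. indicator A \<omega> * Zh (r + \<delta>) \<omega>)
       = (LINT \<omega>|M. indicator A \<omega> * (of_bool (r < \<sigma> \<omega>) * (?q (X lam r \<omega>) - h (0, z))))"
      unfolding Zh_def by (rule semigroup_Q_markov[OF r \<delta>(1) A h_C0 qb])
    also have "\<dots> = (LINT \<omega>|M. indicator A \<omega> * Zh r \<omega> + \<delta> * (indicator A \<omega> * Zg r \<omega>)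
        + indicator A \<omega> * (of_bool (r < \<sigma> \<omega>) * w (X lam r \<omega>)))"
      by (intro Bochner_Integration.integral_cong) (auto simp: Zh_def Zg_def w_def algebra_simps)
    also have "\<dots> = (LINT \<omega>|M. indicator A \<omega> * Zh r \<omega>) + \<delta> * (LINT \<omega>|M. indicator A \<omega> * Zg r \<omega>)
        + (LINT \<omega>|M. indicator A \<omega> * (of_bool (r < \<sigma> \<omega>) * w (X lam r \<omega>)))"
      using i by simp
    finally have "(LINT \<omega>|M. indicator A \<omega> * Zh (r + \<delta>) \<omega>) - (LINT \<omega>|M. indicator A \<omega> * Zh r \<omega>)
      - \<delta> * (LINT \<omega>|M. indicator A \<omega> * Zg r \<omega>)
       = (LINT \<omega>|M. indicator A \<omega> * (of_bool (r < \<sigma> \<omega>) * w (X lam r \<omega>)))" by simp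
    also have "\<bar>\<dots>\<bar> \<le> (LINT \<omega>|M. \<bar>indicator A \<omega> * (of_bool (r < \<sigma> \<omega>) * w (X lam r \<omega>))\<bar>)"
      by (rule integral_abs_bound)
    also have "\<dots> \<le> (LINT \<omega>|M. e * \<delta>)"
    proof (rule integral_mono)
      show "integrable M (\<lambda>\<omega>. \<bar>indicator A \<omega> * (of_bool (r < \<sigma> \<omega>) * w (X lam r \<omega>))\<bar>)"
        using i(3) by (rule integrable_abs)
      show "\<bar>indicator A \<omega> * (of_bool (r < \<sigma> \<omega>) * w (X lam r \<omega>))\<bar> \<le> e * \<delta>" for \<omega>
        using w[of "X lam r \<omega>"] order_trans[OF abs_ge_zero w] by (auto simp: indicator_def)
    qed simp
    also have "\<dots> = e * \<delta>" by (simp add: prob_space)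
    finally show "\<bar>(LINT \<omega>|M. indicator A \<omega> * Zh (r + \<delta>) \<omega>) - (LINT \<omega>|M. indicator A \<omega> * Zh r \<omega>)
      - \<delta> * (LINT \<omega>|M. indicator A \<omega> * Zg r \<omega>)\<bar> \<le> e * \<delta>" .
  qed (use d in simp)
qed

text \<open>Dominated convergence along paths: the integrand can jump in \<open>r\<close> only at
  \<open>\<sigma>\<close>, and \<open>\<sigma> \<noteq> r\<close> almost surely for each fixed
  \<open>r\<close>.\<close>

lemma continuous_integral_Zg:
  assumes A: "A \<in> sets M"
  shows "continuous_on {0..} (\<lambda>r. LINT \<omega>|M. indicator A \<omega> * Zg r \<omega>)"
proof -
  obtain K where K: "\<And>x. \<bar>g (1, x)\<bar> \<le> K" using bounds by blast
  note K0 = order_trans[OF abs_ge_zero K]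
  show ?thesis
    unfolding continuous_on_sequentially comp_def
  proof (intro allI ballI impI)
    fix x :: "nat \<Rightarrow> real" and r :: real
    assume "r \<in> {0..}" "(\<forall>n. x n \<in> {0..}) \<and> x \<longlonglongrightarrow> r"
    then have r: "0 \<le> (r::real)" and x: "\<And>n. 0 \<le> x n" "x \<longlonglongrightarrow> r" by auto
    have m: "(\<lambda>\<omega>. indicator A \<omega> * Zg q \<omega>) \<in> borel_measurable M" if "0 \<le> q" for q :: real
      using measurable_alive[OF that measurable_g] A unfolding Zg_def by measurable
    show "(\<lambda>n. LINT \<omega>|M. indicator A \<omega> * Zg (x n) \<omega>) \<longlonglongrightarrow> (LINT \<omega>|M. indicator A \<omega> * Zg r \<omega>)"
    proof (rule integral_dominated_convergence[where w="\<lambda>_. K"])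
      show "AE \<omega> in M. (\<lambda>n. indicator A \<omega> * Zg (x n) \<omega>) \<longlonglongrightarrow> indicator A \<omega> * Zg r \<omega>"
        using AE_last_passage AE_last_passage_ne[OF r]
      proof eventually_elim
        case (elim \<omega>)
        have "(\<lambda>n. X lam (x n) \<omega>) \<longlonglongrightarrow> X lam r \<omega>"
          using elim(1) r x by (intro continuous_on_tendsto_compose[of "{0..}" "\<lambda>t. X lam t \<omega>" x r]) auto
        then have "(\<lambda>n. g (1, X lam (x n) \<omega>)) \<longlonglongrightarrow> g (1, X lam r \<omega>)"
          using C0_state_space_continuous[OF g_C0, of 1 UNIV]
          by (intro continuous_on_tendsto_compose[of UNIV "\<lambda>y. g (1, y)"]) auto
        moreover have "(\<lambda>n. of_bool (x n < \<sigma> \<omega>) :: real) \<longlonglongrightarrow> of_bool (r < \<sigma> \<omega>)"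
        proof (rule tendsto_eventually)
          show "\<forall>\<^sub>F n in sequentially. of_bool (x n < \<sigma> \<omega>) = (of_bool (r < \<sigma> \<omega>) :: real)"
          proof (cases "r < \<sigma> \<omega>")
            case True
            from order_tendstoD(2)[OF x(2) True] show ?thesis
              by eventually_elim (use True in simp)
          next
            case False
            with elim(2) have "\<sigma> \<omega> < r" by simp
            from order_tendstoD(1)[OF x(2) this] show ?thesis
              by eventually_elim (use False in simp)
          qed
        qed
        ultimately show ?case unfolding Zg_def by (intro tendsto_intros)
      qed
      show "AE \<omega> in M. norm (indicator A \<omega> * Zg (x n) \<omega>) \<le> K" for n
        using K K0 by (auto simp: Zg_def indicator_def)
    qed (use m r x in auto)
  qed
qed

text \<open>The event \<open>A\<close> stays in \<open>F r\<close> for every later \<open>r\<close>,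
  so the uniform increment bound applies with each such \<open>r\<close> as base point.\<close>

lemma Zh_increment:
  assumes "0 \<le> s" "s \<le> t" and A: "A \<in> sets (F s)"
  shows "(LINT \<omega>|M. indicator A \<omega> * Zh t \<omega>) - (LINT \<omega>|M. indicator A \<omega> * Zh s \<omega>)
    = (LINT r:{s..t}|lborel. (LINT \<omega>|M. indicator A \<omega> * Zg r \<omega>))"
proof (rule uniform_increment_integral[OF assms(2)])
  show "continuous_on {s..t} (\<lambda>r. LINT \<omega>|M. indicator A \<omega> * Zg r \<omega>)"
    by (rule continuous_on_subset[OF continuous_integral_Zg[OF sets_F[OF A]]]) (use assms in auto)
  fix e :: real assume "0 < e"
  from increment_estimate[OF this] obtain d where d: "0 < d"
     "\<And>\<delta> r A. 0 < \<delta> \<Longrightarrow> \<delta> < d \<Longrightarrow> 0 \<le> r \<Longrightarrow> A \<in> sets (F r) \<Longrightarrow>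
    \<bar>(LINT \<omega>|M. indicator A \<omega> * Zh (r + \<delta>) \<omega>) - (LINT \<omega>|M. indicator A \<omega> * Zh r \<omega>)
      - \<delta> * (LINT \<omega>|M. indicator A \<omega> * Zg r \<omega>)\<bar> \<le> e * \<delta>" by blast
  show "\<exists>d>0. \<forall>\<delta> r. 0 < \<delta> \<and> \<delta> < d \<and> s \<le> r \<longrightarrow>
    \<bar>(LINT \<omega>|M. indicator A \<omega> * Zh (r + \<delta>) \<omega>) - (LINT \<omega>|M. indicator A \<omega> * Zh r \<omega>)
      - \<delta> * (LINT \<omega>|M. indicator A \<omega> * Zg r \<omega>)\<bar> \<le> e * \<delta>"
    using d(1) F_mono[OF _ A] \<open>0 \<le> s\<close> by (intro exI[of _ d] conjI allI impI d(2)) auto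
qed

text \<open>The value \<open>0\<close> at \<open>z\<close> encodes absorption: from
  \<open>\<sigma>\<close> on the stopped process rests at \<open>z\<close>, where both indicators in
  the theorem vanish as well. Before \<open>\<sigma>\<close>, a fixed time finds the process at
  \<open>z\<close> with probability zero.\<close>

definition drift :: "real \<Rightarrow> real" where
  "drift y = (if y = z then 0 else g (1, y))"

lemma measurable_drift [measurable]: "drift \<in> borel_measurable borel"
  unfolding drift_def by measurable

lemma drift_bound: "\<exists>K. \<forall>x. \<bar>drift x\<bar> \<le> K"
proof -
  obtain K where K: "\<And>x. \<bar>g (1, x)\<bar> \<le> K" using bounds by blast
  have "\<bar>drift x\<bar> \<le> K" for x using K[of x] order_trans[OF abs_ge_zero K[of x]] by (simp add: drift_def)
  then show ?thesis by blast
qed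

lemma drift_stopped_AE:
  assumes "0 \<le> r"
  shows "AE \<omega> in M. drift (\<xi> r \<omega>) = Zg r \<omega>"
proof -
  have "AE \<omega> in M. r < \<sigma> \<omega> \<longrightarrow> X lam r \<omega> \<noteq> z"
    using X_ne_const_AE[of r lam z] X_zero_AE[of lam] assms z_pos by (cases "r = 0") auto
  with AE_stopped show ?thesis
    by eventually_elim (auto simp: drift_def Zg_def)
qed

lemma continuous_stopped:
  assumes "continuous_on {0..} (\<lambda>t. X lam t \<omega>)" "0 < \<sigma> \<omega>"
  shows "continuous_on {0..} (\<lambda>t. \<xi> t \<omega>)"
  unfolding stopped_def
  by (rule continuous_on_compose2[OF assms(1)]) (use assms in \<open>auto intro!: continuous_intros\<close>)

section \<open>A jointly measurable version and its drift integral\<close>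

lemma good_set: "\<exists>G\<in>sets M. space M - G \<in> null_sets M \<and> (\<forall>\<omega>\<in>G. continuous_on {0..} (\<lambda>t. \<xi> t \<omega>))"
proof -
  have "AE \<omega> in M. continuous_on {0..} (\<lambda>t. \<xi> t \<omega>)"
    using AE_last_passage by eventually_elim (auto intro: continuous_stopped)
  then obtain N where N: "{\<omega> \<in> space M. \<not> continuous_on {0..} (\<lambda>t. \<xi> t \<omega>)} \<subseteq> N" "emeasure M N = 0" "N \<in> sets M"
    by (rule AE_E)
  have "space M - (space M - N) = N" using sets.sets_into_space[OF N(3)] by blast
  then show ?thesis using N by (intro bexI[of _ "space M - N"]) auto
qed

definition good :: "'a set" where
  "good = (SOME G. G \<in> sets M \<and> space M - G \<in> null_sets M \<and> (\<forall>\<omega>\<in>G. continuous_on {0..} (\<lambda>t. \<xi> t \<omega>)))"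

lemma good: "good \<in> sets M" "space M - good \<in> null_sets M" "\<And>\<omega>. \<omega> \<in> good \<Longrightarrow> continuous_on {0..} (\<lambda>t. \<xi> t \<omega>)"
  using someI_ex[OF good_set[unfolded Bex_def]] unfolding good_def[symmetric] by blast+

lemma AE_good: "AE \<omega> in M. \<omega> \<in> good"
  by (rule AE_I'[OF good(2)]) auto

text \<open>Joint measurability is derived from continuity of every path, not just almost every one,
  so the bad paths are made constant. Adaptedness survives because the completed filtration contains
  the null set removed.\<close>

definition xi' :: "real \<Rightarrow> 'a \<Rightarrow> real" where
  "xi' r \<omega> = (if \<omega> \<in> good then \<xi> r \<omega> else 0)"

lemma good_F: "good \<in> sets (F t)"
proof -
  have "space (F t) - (space M - good) \<in> sets (F t)"
    using null_F good(2) by blast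
  moreover have "space M - (space M - good) = good"
    using sets.sets_into_space[OF good(1)] by blast
  ultimately show ?thesis by simp
qed

lemma measurable_xi':
  assumes "0 \<le> t"
  shows "(\<lambda>(\<omega>, r). xi' (max 0 (min t r)) \<omega>) \<in> borel_measurable (F t \<Otimes>\<^sub>M borel)"
proof (rule measurable_continuous_process[OF assms])
  fix r assume "0 \<le> r" "r \<le> t"
  then have [measurable]: "\<xi> r \<in> borel_measurable (F t)" "good \<in> sets (F t)"
    using good_F by (auto intro: measurable_completed_natural_filtration)
  show "xi' r \<in> borel_measurable (F t)" unfolding xi'_def[abs_def] by measurable
next
  fix \<omega>
  show "continuous_on {0..t} (\<lambda>r. xi' r \<omega>)"
  proof (cases "\<omega> \<in> good")
    case True
    then show ?thesis using continuous_on_subset[OF good(3)[OF True], of "{0..t}"]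
      by (simp add: xi'_def)
  next
    case False
    then show ?thesis by (simp add: xi'_def)
  qed
qed

lemma measurable_drift_xi':
  assumes "0 \<le> s" "s \<le> t"
  shows "(\<lambda>(\<omega>, r). indicator {s..t} r * drift (xi' r \<omega>)) \<in> borel_measurable (F t \<Otimes>\<^sub>M lborel)"
proof -
  have "(\<lambda>(\<omega>, r). indicator {s..t} r * drift (xi' r \<omega>))
      = (\<lambda>p. indicator {s..t} (snd p) * drift ((\<lambda>(\<omega>, r). xi' (max 0 (min t r)) \<omega>) p))"
    using assms by (auto simp: fun_eq_iff indicator_def min_def max_def)
  moreover have "(\<lambda>p. indicator {s..t} (snd p) * drift ((\<lambda>(\<omega>, r). xi' (max 0 (min t r)) \<omega>) p))
      \<in> borel_measurable (F t \<Otimes>\<^sub>M borel)"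
    using measurable_xi'[OF order_trans[OF assms]] by measurable
  ultimately show ?thesis by (simp cong: measurable_cong_sets sets_pair_measure_cong)
qed

definition drift_integral :: "real \<Rightarrow> real \<Rightarrow> 'a \<Rightarrow> real" where
  "drift_integral s t \<omega> = (LINT r|lborel. indicator {s..t} r * drift (xi' r \<omega>))"

lemma measurable_drift_integral:
  assumes "0 \<le> s" "s \<le> t"
  shows "drift_integral s t \<in> borel_measurable (F t)"
  unfolding drift_integral_def[abs_def]
  by (rule lborel.borel_measurable_lebesgue_integral[OF measurable_drift_xi'[OF assms]])

lemma integrable_drift_xi':
  assumes "0 \<le> s" "s \<le> t" "\<omega> \<in> space M"
  shows "integrable lborel (\<lambda>r. indicator {s..t} r * drift (xi' r \<omega>))"
proof -
  obtain K where K: "\<And>x. \<bar>drift x\<bar> \<le> K" using drift_bound by blast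
  show ?thesis
  proof (rule integrableI_bounded_set[where A="{s..t}" and B=K])
    show "(\<lambda>r. indicator {s..t} r * drift (xi' r \<omega>)) \<in> borel_measurable lborel"
      using measurable_Pair2[OF measurable_drift_xi'[OF assms(1,2)], of \<omega>] assms(3) by simp
    show "AE r in lborel. r \<in> {s..t} \<longrightarrow> norm (indicator {s..t} r * drift (xi' r \<omega>)) \<le> K"
      using K by auto
  qed (auto simp: emeasure_lborel_Icc_eq)
qed

lemma drift_integral_add:
  assumes "0 \<le> s" "s \<le> t" "\<omega> \<in> space M"
  shows "drift_integral 0 t \<omega> = drift_integral 0 s \<omega> + drift_integral s t \<omega>"
proof -
  have "drift_integral 0 t \<omega> = (LINT r|lborel. indicator {0..s} r * drift (xi' r \<omega>) + indicator {s..t} r * drift (xi' r \<omega>))"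
    unfolding drift_integral_def
  proof (rule integral_cong_AE)
    \<comment> \<open>The closed intervals overlap in the single point \<open>s\<close>.\<close>
    show "AE r in lborel. indicator {0..t} r * drift (xi' r \<omega>)
        = indicator {0..s} r * drift (xi' r \<omega>) + indicator {s..t} r * drift (xi' r \<omega>)"
      using AE_lborel_singleton[of s] by eventually_elim (use assms in \<open>auto simp: indicator_def\<close>)
  qed (use integrable_drift_xi'[of _ _ \<omega>] assms in \<open>auto intro!: borel_measurable_add intro: borel_measurable_integrable\<close>)
  also have "\<dots> = drift_integral 0 s \<omega> + drift_integral s t \<omega>"
    unfolding drift_integral_def using assms by (intro Bochner_Integration.integral_add integrable_drift_xi') auto
  finally show ?thesis .
qed

lemma abs_drift_integral:
  assumes "0 \<le> s" "s \<le> t"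
  shows "\<exists>K. \<forall>\<omega>\<in>space M. \<bar>drift_integral s t \<omega>\<bar> \<le> K"
proof -
  obtain K where K: "\<And>x. \<bar>drift x\<bar> \<le> K" using drift_bound by blast
  have "\<bar>drift_integral s t \<omega>\<bar> \<le> K * (t - s)" if w: "\<omega> \<in> space M" for \<omega>
  proof -
    have "\<bar>drift_integral s t \<omega>\<bar> \<le> (LINT r|lborel. \<bar>indicator {s..t} r * drift (xi' r \<omega>)\<bar>)"
      unfolding drift_integral_def by (rule integral_abs_bound)
    also have "\<dots> \<le> (LINT r|lborel. K * indicator {s..t} r)"
    proof (rule integral_mono)
      show "integrable lborel (\<lambda>r. \<bar>indicator {s..t} r * drift (xi' r \<omega>)\<bar>)"
        by (rule integrable_abs[OF integrable_drift_xi'[OF assms w]])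
      show "integrable lborel (\<lambda>r. K * indicator {s..t} r)"
        by (intro integrable_mult_right integrable_real_indicator) (auto simp: emeasure_lborel_Icc_eq)
    qed (use K in \<open>auto simp: indicator_def\<close>)
    also have "\<dots> = K * (t - s)" using assms by simp
    finally show ?thesis .
  qed
  then show ?thesis by blast
qed

lemma integrable_drift_integral:
  assumes "0 \<le> s" "s \<le> t"
  shows "integrable M (drift_integral s t)"
proof -
  obtain K where "\<And>\<omega>. \<omega> \<in> space M \<Longrightarrow> \<bar>drift_integral s t \<omega>\<bar> \<le> K" using abs_drift_integral[OF assms] by blast
  then show ?thesis
    using measurable_from_subalg[OF subalgebra_F measurable_drift_integral[OF assms]]
    by (intro integrable_const_bound[where B=K]) auto
qed

text \<open>After exchanging the integrals it suffices to know
  \<open>drift (xi' r \<omega>) = Zg r \<omega>\<close> almost surely for each single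
  \<open>r\<close>, which the absence of atoms provides.\<close>

lemma fubini_drift_integral:
  assumes "0 \<le> s" "s \<le> t" and A: "A \<in> sets M"
  shows "(LINT \<omega>|M. indicator A \<omega> * drift_integral s t \<omega>)
    = (LINT r:{s..t}|lborel. (LINT \<omega>|M. indicator A \<omega> * Zg r \<omega>))"
proof -
  obtain K where K: "\<And>x. \<bar>drift x\<bar> \<le> K" using drift_bound by blast
  interpret P: pair_sigma_finite M lborel ..
  let ?f = "\<lambda>\<omega> r. indicator A \<omega> * (indicator {s..t} r * drift (xi' r \<omega>))"
  have m0: "(\<lambda>(\<omega>, r). indicator {s..t} r * drift (xi' r \<omega>)) \<in> borel_measurable (M \<Otimes>\<^sub>M lborel)"
  proof -
    have id: "(\<lambda>\<omega>. \<omega>) \<in> measurable M (F t)"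
      by (rule measurable_from_subalg[OF subalgebra_F[of t]]) simp
    have "(\<lambda>p. (fst p, snd p)) \<in> measurable (M \<Otimes>\<^sub>M lborel) (F t \<Otimes>\<^sub>M lborel)"
      by (rule measurable_Pair[OF measurable_compose[OF measurable_fst id] measurable_snd])
    then have "(\<lambda>p. p) \<in> measurable (M \<Otimes>\<^sub>M lborel) (F t \<Otimes>\<^sub>M lborel)" by simp
    then show ?thesis by (rule measurable_compose[OF _ measurable_drift_xi'[OF assms(1,2)]])
  qed
  have m: "case_prod ?f \<in> borel_measurable (M \<Otimes>\<^sub>M lborel)"
    unfolding case_prod_beta' using m0[unfolded case_prod_beta'] A by measurable
  have int: "integrable (M \<Otimes>\<^sub>M lborel) (case_prod ?f)"
  proof (rule integrableI_bounded_set[where A="space M \<times> {s..t}" and B=K])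
    show "emeasure (M \<Otimes>\<^sub>M lborel) (space M \<times> {s..t}) < \<infinity>"
      by (subst lborel.emeasure_pair_measure_Times) (use assms in \<open>auto simp: emeasure_space_1\<close>)
    show "AE p in M \<Otimes>\<^sub>M lborel. p \<in> space M \<times> {s..t} \<longrightarrow> norm (case_prod ?f p) \<le> K"
      using K order_trans[OF abs_ge_zero K] by (auto simp: indicator_def)
    show "AE p in M \<Otimes>\<^sub>M lborel. p \<notin> space M \<times> {s..t} \<longrightarrow> case_prod ?f p = 0"
      using sets.sets_into_space[OF A] by (intro AE_I2) (auto simp: indicator_def)
  qed (use m in auto)
  have "(LINT \<omega>|M. indicator A \<omega> * drift_integral s t \<omega>) = (LINT \<omega>|M. (LINT r|lborel. ?f \<omega> r))"
    by (simp add: drift_integral_def)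
  also have "\<dots> = (LINT r|lborel. (LINT \<omega>|M. ?f \<omega> r))"
    by (rule P.Fubini_integral[OF int, symmetric])
  also have "\<dots> = (LINT r:{s..t}|lborel. (LINT \<omega>|M. indicator A \<omega> * Zg r \<omega>))"
    unfolding set_lebesgue_integral_def
  proof (rule Bochner_Integration.integral_cong[OF refl])
    fix r
    show "(LINT \<omega>|M. ?f \<omega> r) = indicator {s..t} r *\<^sub>R (LINT \<omega>|M. indicator A \<omega> * Zg r \<omega>)"
    proof (cases "r \<in> {s..t}")
      case True
      then have r: "0 \<le> r" using assms by auto
      have "(LINT \<omega>|M. ?f \<omega> r) = (LINT \<omega>|M. indicator A \<omega> * Zg r \<omega>)"
      proof (rule integral_cong_AE)
        show "(\<lambda>\<omega>. ?f \<omega> r) \<in> borel_measurable M"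
          using measurable_Pair1[OF m, of r] by simp
        show "(\<lambda>\<omega>. indicator A \<omega> * Zg r \<omega>) \<in> borel_measurable M"
          using measurable_alive[OF r measurable_g] A unfolding Zg_def by measurable
        show "AE \<omega> in M. ?f \<omega> r = indicator A \<omega> * Zg r \<omega>"
          using drift_stopped_AE[OF r] AE_good by eventually_elim (use True in \<open>simp add: xi'_def\<close>)
      qed
      then show ?thesis using True by simp
    qed simp
  qed
  finally show ?thesis .
qed

text \<open>The integrands agree at every time: off \<open>z\<close> the differential expression is
  \<open>g\<close>, and at \<open>z\<close> both indicators and \<open>drift\<close> are zero, which
  shields the unspecified values of \<open>D2\<close> there. Integrability enters when the integral
  is split in two.\<close>

lemma process_eq_AE:
  assumes "0 \<le> t"
  shows "AE \<omega> in M. h (0, z) - h (1, 0) + Zh t \<omega> - drift_integral 0 t \<omega>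
    = h (of_bool (t < \<sigma> \<omega>), \<xi> t \<omega>) - h (1, 0)
      - (LINT s:{0..t}|lborel.
           (- lam * D2 h (1, \<xi> s \<omega>) + 1 / 2 * D2 (D2 h) (1, \<xi> s \<omega>)) * of_bool (z < \<xi> s \<omega>))
      - (LINT s:{0..t}|lborel.
           (lam * D2 h (1, \<xi> s \<omega>) + 1 / 2 * D2 (D2 h) (1, \<xi> s \<omega>)) * of_bool (\<xi> s \<omega> < z))"
  using AE_good AE_stopped AE_space
proof eventually_elim
  case (elim \<omega>)
  obtain K where K: "\<And>x. \<bar>g (1, x)\<bar> \<le> K" using bounds by blast
  note K0 = order_trans[OF abs_ge_zero K]
  have xi': "xi' r \<omega> = \<xi> r \<omega>" for r using elim by (simp add: xi'_def)
  have above: "(- lam * D2 h (1, y) + 1 / 2 * D2 (D2 h) (1, y)) * of_bool (z < y) = g (1, y) * of_bool (z < y)" for y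
    using generator_eq_D2[OF lam_pos h_C0 g_C0 generator, of y] by (cases "z < y") auto
  have below: "(lam * D2 h (1, y) + 1 / 2 * D2 (D2 h) (1, y)) * of_bool (y < z) = g (1, y) * of_bool (y < z)" for y
    using generator_eq_D2[OF lam_pos h_C0 g_C0 generator, of y] by (cases "y < z") auto
  have int: "set_integrable lborel {0..t} (\<lambda>s. g (1, \<xi> s \<omega>) * of_bool (P (\<xi> s \<omega>)))"
    if [measurable]: "Measurable.pred borel P" for P
    unfolding set_integrable_def
  proof (rule integrableI_bounded_set[where A="{0..t}" and B=K])
    have "continuous_on UNIV (\<lambda>s. \<xi> (max 0 s) \<omega>)"
      by (rule continuous_on_compose2[OF good(3)[OF elim(1)]]) (auto intro!: continuous_intros)
    then have [measurable]: "(\<lambda>s. \<xi> (max 0 s) \<omega>) \<in> borel_measurable borel"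
      by (rule borel_measurable_continuous_onI)
    have "(\<lambda>s. indicator {0..t} s *\<^sub>R (g (1, \<xi> s \<omega>) * of_bool (P (\<xi> s \<omega>))))
      = (\<lambda>s. indicator {0..t} s *\<^sub>R (g (1, \<xi> (max 0 s) \<omega>) * of_bool (P (\<xi> (max 0 s) \<omega>))))"
      by (auto simp: fun_eq_iff indicator_def max_def)
    also have "\<dots> \<in> borel_measurable borel" by measurable
    finally show "(\<lambda>s. indicator {0..t} s *\<^sub>R (g (1, \<xi> s \<omega>) * of_bool (P (\<xi> s \<omega>)))) \<in> borel_measurable lborel"
      by simp
    show "AE s in lborel. s \<in> {0..t} \<longrightarrow> norm (indicator {0..t} s *\<^sub>R (g (1, \<xi> s \<omega>) * of_bool (P (\<xi> s \<omega>)))) \<le> K"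
      using K K0 by auto
  qed (auto simp: emeasure_lborel_Icc_eq)
  have "drift_integral 0 t \<omega> = (LINT s:{0..t}|lborel.
     g (1, \<xi> s \<omega>) * of_bool (z < \<xi> s \<omega>) + g (1, \<xi> s \<omega>) * of_bool (\<xi> s \<omega> < z))"
    unfolding drift_integral_def set_lebesgue_integral_def
    by (intro Bochner_Integration.integral_cong) (auto simp: xi' drift_def)
  also have "\<dots> = (LINT s:{0..t}|lborel. g (1, \<xi> s \<omega>) * of_bool (z < \<xi> s \<omega>))
      + (LINT s:{0..t}|lborel. g (1, \<xi> s \<omega>) * of_bool (\<xi> s \<omega> < z))"
    using int[of "\<lambda>y. z < y"] int[of "\<lambda>y. y < z"] by (intro set_integral_add(2)) auto
  finally have "drift_integral 0 t \<omega> = (LINT s:{0..t}|lborel. g (1, \<xi> s \<omega>) * of_bool (z < \<xi> s \<omega>))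
      + (LINT s:{0..t}|lborel. g (1, \<xi> s \<omega>) * of_bool (\<xi> s \<omega> < z))" .
  moreover have "h (0, z) + Zh t \<omega> = h (of_bool (t < \<sigma> \<omega>), \<xi> t \<omega>)"
    using elim(2) by (cases "t < \<sigma> \<omega>") (auto simp: Zh_def)
  ultimately show ?case unfolding above below by simp
qed

text \<open>Under the indicator of survival, \<open>X\<close> may be replaced by the adapted process
  \<open>\<xi>\<close>.\<close>

lemma measurable_Zh_F:
  assumes "0 \<le> t"
  shows "Zh t \<in> borel_measurable (F t)"
proof -
  have [measurable]: "\<xi> t \<in> borel_measurable (F t)" "{\<omega> \<in> space (F t). t < \<sigma> \<omega>} \<in> sets (F t)"
    using assms less_last_passage_F[OF assms] by (auto intro: measurable_completed_natural_filtration)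
  have "(\<lambda>\<omega>. of_bool (t < \<sigma> \<omega>) * (h (1, \<xi> t \<omega>) - h (0, z))) \<in> borel_measurable (F t)"
    by measurable
  also have "(\<lambda>\<omega>. of_bool (t < \<sigma> \<omega>) * (h (1, \<xi> t \<omega>) - h (0, z))) = Zh t"
    by (auto simp: Zh_def fun_eq_iff stopped_before)
  finally show ?thesis .
qed

text \<open>Since the filtration contains all null sets, the martingale property may be proved for
  \<open>W\<close> and transferred to any \<open>Y\<close> equal to it almost surely at each single
  time.\<close>

lemma martingaleI:
  assumes Y: "\<And>t. 0 \<le> t \<Longrightarrow> AE \<omega> in M. h (0, z) - h (1, 0) + Zh t \<omega> - drift_integral 0 t \<omega> = Y t \<omega>"
  shows "martingale M F Y"
proof -
  define W where "W t \<omega> = h (0, z) - h (1, 0) + Zh t \<omega> - drift_integral 0 t \<omega>" for t \<omega>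
  have WY: "AE \<omega> in M. W t \<omega> = Y t \<omega>" if "0 \<le> t" for t
    using Y[OF that] by (simp add: W_def)
  obtain K where K: "\<And>x. \<bar>h (1, x) - h (0, z)\<bar> \<le> K" using bounds by blast
  have Wm: "W t \<in> borel_measurable (F t)" if "0 \<le> t" for t
    unfolding W_def[abs_def] using measurable_Zh_F[OF that] measurable_drift_integral[of 0 t] that by measurable
  have iZ: "integrable M (\<lambda>\<omega>. indicator A \<omega> * Zh t \<omega>)" if "0 \<le> t" "A \<in> sets M" for t A
    unfolding Zh_def using K by (intro integrable_alive that) measurable
  have iZ': "integrable M (Zh t)" if "0 \<le> t" for t
    using iZ[OF that sets.top] by (simp cong: Bochner_Integration.integrable_cong)
  have iD: "integrable M (\<lambda>\<omega>. indicator A \<omega> * drift_integral s t \<omega>)" if "0 \<le> s" "s \<le> t" "A \<in> sets M" for s t A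
    using integrable_mult_indicator[OF that(3) integrable_drift_integral[OF that(1,2)]] by simp
  have Wi: "integrable M (W t)" if "0 \<le> t" for t
    unfolding W_def[abs_def]
    by (intro Bochner_Integration.integrable_diff Bochner_Integration.integrable_add iZ' integrable_drift_integral that) auto
  have Ym: "Y t \<in> borel_measurable (F t)" if "0 \<le> t" for t
    by (rule AE_eq_measurable[OF _ null_F Wm[OF that] WY[OF that]]) auto
  note M = measurable_from_subalg[OF subalgebra_F]
  have Yi: "integrable M (Y t)" if "0 \<le> t" for t
    using integrable_cong_AE_imp[OF Wi[OF that] M[OF Ym[OF that]]] WY[OF that] by (auto elim: eventually_mono)
  have ce: "AE \<omega> in M. real_cond_exp M (F s) (Y t) \<omega> = Y s \<omega>" if st: "0 \<le> s" "s \<le> t" for s t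
  proof -
    interpret P: finite_measure_subalgebra M "F s"
      by unfold_locales (rule subalgebra_F)
    have t: "0 \<le> t" using st by simp
    show ?thesis
    proof (rule P.real_cond_exp_charact)
      fix A assume A: "A \<in> sets (F s)"
      note AM = sets_F[OF A]
      have YW: "(LINT \<omega>:A|M. Y r \<omega>) = (LINT \<omega>|M. indicator A \<omega> * W r \<omega>)" if r: "0 \<le> r" for r
        unfolding set_lebesgue_integral_def
      proof (rule integral_cong_AE)
        show "AE \<omega> in M. indicator A \<omega> *\<^sub>R Y r \<omega> = indicator A \<omega> * W r \<omega>"
          using WY[OF r] by eventually_elim simp
      qed (use M[OF Ym[OF r]] M[OF Wm[OF r]] AM in measurable)
      \<comment> \<open>Over \<open>A\<close>, the increment of \<open>Zh\<close> is the time
        integral of the means of \<open>Zg\<close>, which by Fubini is the mean of the drift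
        integral; the two cancel.\<close>
      have "(LINT \<omega>|M. indicator A \<omega> * W t \<omega>) - (LINT \<omega>|M. indicator A \<omega> * W s \<omega>)
        = (LINT \<omega>|M. indicator A \<omega> * W t \<omega> - indicator A \<omega> * W s \<omega>)"
        using integrable_mult_indicator[OF AM Wi[OF t]] integrable_mult_indicator[OF AM Wi[OF st(1)]] by simp
      also have "\<dots> = (LINT \<omega>|M. indicator A \<omega> * Zh t \<omega> - indicator A \<omega> * Zh s \<omega> - indicator A \<omega> * drift_integral s t \<omega>)"
        using drift_integral_add[OF st] by (intro Bochner_Integration.integral_cong) (auto simp: W_def algebra_simps)
      also have "\<dots> = (LINT \<omega>|M. indicator A \<omega> * Zh t \<omega>) - (LINT \<omega>|M. indicator A \<omega> * Zh s \<omega>)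
          - (LINT \<omega>|M. indicator A \<omega> * drift_integral s t \<omega>)"
        using iZ[OF t AM] iZ[OF st(1) AM] iD[OF st AM] by simp
      also have "\<dots> = 0"
        using Zh_increment[OF st A] fubini_drift_integral[OF st AM] by simp
      finally show "(LINT \<omega>:A|M. Y t \<omega>) = (LINT \<omega>:A|M. Y s \<omega>)"
        using YW st t by simp
    qed (use Yi t st Ym in auto)
  qed
  show ?thesis
    unfolding martingale_def using filtration_F subalgebra_F Ym Yi ce by blast
qed

end

theorem theorem6p3:
  fixes M :: "'a measure" and B :: "real \<Rightarrow> 'a \<Rightarrow> real"
    and lam z :: real and h :: "real \<times> real \<Rightarrow> real"
  assumes "standard_brownian_motion M B" and "complete_measure M"
    and "lam > 0" and "z > 0"
    and "h \<in> generator_domain state_space (semigroup_Q lam z)"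
  shows "martingale M (completed_natural_filtration M (stopped B lam z))
    (\<lambda>t \<omega>. h (of_bool (t < last_passage B lam z \<omega>), stopped B lam z t \<omega>) - h (1, 0)
      - (LINT s:{0..t}|lborel.
           (- lam * D2 h (1, stopped B lam z s \<omega>) + 1 / 2 * D2 (D2 h) (1, stopped B lam z s \<omega>))
             * of_bool (z < stopped B lam z s \<omega>))
      - (LINT s:{0..t}|lborel.
           (lam * D2 h (1, stopped B lam z s \<omega>) + 1 / 2 * D2 (D2 h) (1, stopped B lam z s \<omega>))
             * of_bool (stopped B lam z s \<omega> < z)))"
proof -
  obtain g where "h \<in> C0 state_space" "g \<in> C0 state_space"
    "uniform_limit state_space (\<lambda>t x. (semigroup_Q lam z t h x - h x) / t) g (at_right 0)"
    using assms(5) unfolding generator_domain_def by blast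
  with assms interpret stopped_bm_generator M B lam z h g
    by (intro stopped_bm_generator.intro stopped_drifted_bm.intro stopped_drifted_bm_axioms.intro
        stopped_bm_generator_axioms.intro) auto
  show ?thesis by (rule martingaleI[OF process_eq_AE])
qed

end
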